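(* Let $\varphi$ be a minimal counterexample to Vaught's conjecture and let $\lambda<\omega_1$ be a limit ordinal with $\lambda\in\mathfrak F$ and $\lambda>\mathrm{qr}(\varphi)$. Then: $$x(\lambda)\iff\omega_1^{K_\lambda}=\lambda,\qquad y_g(\lambda)\iff\omega_1^{K_{\lambda+1}}=\lambda .$$ Moreover, always $\omega_1^{K_\lambda}\ge\lambda$ and $\omega_1^{K_{\lambda+1}}\ge\lambda$. If $y_g(\lambda)$ holds, then the models $A\in W^{\mathrm{high}}_\lambda$ lying in $\mathcal C_{\lambda+1}$ form a single isomorphism type, namely that of $K_{\lambda+1}$.
   Context: Structures are countable structures in a countable vocabulary; classes of models are counted up to isomorphism; ordinals are countable. $\Sigma^{\mathrm{in}}_0=\Pi^{\mathrm{in}}_0$ is the set of finitary quantifier-free formulas; for $\alpha>0$, $\Sigma^{\mathrm{in}}_\alpha$ consists of countable disjunctions of formulas $\exists\bar x\,\psi$ with $\psi\in\Pi^{\mathrm{in}}_\beta$, $\beta<\alpha$, and $\Pi^{\mathrm{in}}_\alpha$ is dual. $M\equiv_\alpha N$ means that $M,N$ satisfy the same $\Pi^{\mathrm{in}}_\alpha$ (equivalently $\Sigma^{\mathrm{in}}_\alpha$) sentences. A Scott sentence of $M$ is an $L_{\omega_1\omega}$ sentence whose countable models are exactly the copies of $M$. $\mathrm{cSR}(M)$ is the least $\alpha$ such that $M$ has a $\Pi^{\mathrm{in}}_{\alpha+1}$ Scott sentence. $\omega_1^A=\min\{\omega_1^X: X\in 2^\omega \text{ computes a copy of }A\}$.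 $\mathrm{qr}(S)$ is the least $\beta$ with $S\in\Pi^{\mathrm{in}}_\beta\cup\Sigma^{\mathrm{in}}_\beta$. Standing hypotheses: Vaught's conjecture fails, and $\varphi$ is a minimal counterexample: an $L_{\omega_1\omega}$ sentence with exactly $\aleph_1$ countable models up to isomorphism, scattered (for each $\alpha<\omega_1$ there are at most countably many $\equiv_\alpha$-classes among its models), and such that for every $L_{\omega_1\omega}$ sentence $\psi$ one of $\varphi\wedge\psi$, $\varphi\wedge\neg\psi$ has only countably many models. Moreover for each $\alpha<\omega_1$ only countably many $\Sigma^{\mathrm{in}}_\alpha$-types are realized in models of $\varphi$. For each $\beta<\omega_1$ exactly one $\equiv_\beta$-class of models of $\varphi$ is uncountable; it is denoted $\mathcal C_\beta$. For $\beta\ge\mathrm{qr}(\varphi)$, the label $K_\beta$ is the unique (up to isomorphism) member of $\mathcal C_\beta$ of least $\mathrm{cSR}$ (it exists). $f(\alpha)=\min\{\beta:(\forall M\models\varphi)(M\notin\mathcal C_\alpha\Rightarrow\mathrm{cSR}(M)<\beta)\}$ and $\mathfrak F=\{\alpha<\omega_1:f(\alpha)\le\alpha\}$. $W_\lambda=\{A\models\varphi:\omega_1^A=\lambda,\ \mathrm{cSR}(A)\ge\lambda\}$; $W^{\mathrm{high}}_\lambda=\{A\in W_\lambda:\mathrm{cSR}(A)=\lambda+1\}$. $x(\lambda)$: some $A\in W_\lambda$ has $\mathrm{cSR}(A)=\lambda$. $y_g(\lambda)$: some $A\in W^{\mathrm{high}}_\lambda$ lies in $\mathcal C_{\lambda+1}$.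 *)

theory Defs
  imports Main "HOL-Library.Nat_Bijection" "HOL-Library.Countable_Set_Type"
begin

unbundle cardinal_syntax

section \<open>Countable ordinals\<close>

text \<open>The elements of the type below are the ordinals less than \<open>\<omega>\<^sub>1\<close>: the order is a
  well-order, the type is uncountable, and every proper initial segment is countable.\<close>

typedef omega1 = "Field (cardSuc natLeq)"
proof -
  have "infinite (Field (cardSuc natLeq))"
    using cardSuc_finite[of natLeq] natLeq_Card_order Field_natLeq by simp
  then show ?thesis by (metis finite.emptyI ex_in_conv)
qed

instantiation omega1 :: wellorder
begin

definition "a \<le> b \<longleftrightarrow> (Rep_omega1 a, Rep_omega1 b) \<in> cardSuc natLeq"
definition "(a :: omega1) < b \<longleftrightarrow> a \<le> b \<and> a \<noteq> b"

instance
proof -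
  have wo: "Well_order (cardSuc natLeq)"
    using cardSuc_Card_order[OF natLeq_Card_order] card_order_on_well_order_on by blast
  then have lin: "refl_on (Field (cardSuc natLeq)) (cardSuc natLeq)"
      "trans (cardSuc natLeq)" "antisym (cardSuc natLeq)"
      "total_on (Field (cardSuc natLeq)) (cardSuc natLeq)" "wf (cardSuc natLeq - Id)"
    by (auto simp: order_on_defs)
  show "OFCLASS(omega1, wellorder_class)"
  proof (standard, goal_cases)
    case (1 x y)
    then show ?case
      using lin(3) by (metis antisymD Rep_omega1_inject less_eq_omega1_def less_omega1_def)
  next
    case (2 x)
    then show ?case using lin(1) Rep_omega1 by (auto simp: less_eq_omega1_def refl_on_def)
  next
    case (3 x y z)
    then show ?case using lin(2) by (auto simp: less_eq_omega1_def intro: transD)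
  next
    case (4 x y)
    then show ?case
      using lin(3) by (metis antisymD Rep_omega1_inject less_eq_omega1_def)
  next
    case (5 x y)
    then show ?case
      using lin(1,4) Rep_omega1
      by (metis less_eq_omega1_def refl_onD total_on_def)
  next
    case (6 P a)
    have "wf (inv_image (cardSuc natLeq - Id) Rep_omega1)"
      using lin(5) by (rule wf_inv_image)
    then show ?case
    proof (induction a rule: wf_induct_rule)
      case (less a)
      show ?case
      proof (rule 6)
        fix y assume "y < a"
        then show "P y"
          using less by (auto simp: less_eq_omega1_def less_omega1_def Rep_omega1_inject)
      qed
    qed
  qed
qed

end

lemma uncountable_omega1: "uncountable (UNIV :: omega1 set)"
proof
  assume "countable (UNIV :: omega1 set)"
  then have "countable (Field (cardSuc natLeq))"
    using type_definition.Rep_range[OF type_definition_omega1] by (metis countable_image)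
  then have "|Field (cardSuc natLeq)| \<le>o natLeq"
    using countable_card_le_natLeq by blast
  moreover have "natLeq <o |Field (cardSuc natLeq)|"
    using cardSuc_greater[OF natLeq_Card_order] cardSuc_Card_order[OF natLeq_Card_order]
      card_of_Field_ordIso ordIso_symmetric ordLess_ordIso_trans by blast
  ultimately show False using not_ordLeq_ordLess by blast
qed

lemma countable_lessThan_omega1: "countable {..<a :: omega1}"
proof -
  let ?r = "cardSuc natLeq"
  have co: "Card_order ?r" using cardSuc_Card_order[OF natLeq_Card_order] .
  have "|underS ?r (Rep_omega1 a)| <o ?r"
    using card_of_underS[OF co Rep_omega1] .
  then have "|underS ?r (Rep_omega1 a)| \<le>o natLeq"
    using cardSuc_ordLeq_ordLess[OF natLeq_Card_order card_of_Card_order] by blast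
  then have "countable (underS ?r (Rep_omega1 a))"
    using countable_card_le_natLeq by blast
  moreover have "Rep_omega1 ` {..<a} \<subseteq> underS ?r (Rep_omega1 a)"
    by (auto simp: underS_def less_eq_omega1_def less_omega1_def Rep_omega1_inject)
  ultimately have "countable (Rep_omega1 ` {..<a})" using countable_subset by blast
  then show ?thesis
    using countable_image_inj_on[of Rep_omega1 "{..<a}"] by (simp add: inj_on_def Rep_omega1_inject)
qed

instantiation omega1 :: zero
begin
definition "(0 :: omega1) = (LEAST a. True)"
instance ..
end

definition osuc :: "omega1 \<Rightarrow> omega1" where
  "osuc a = (LEAST b. a < b)"

definition limit_ord :: "omega1 \<Rightarrow> bool" where
  "limit_ord a \<longleftrightarrow> a \<noteq> 0 \<and> (\<forall>b<a. osuc b < a)"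


section \<open>Vocabularies and countable structures\<close>

text \<open>A symbol is a pair (index, arity). Since the arity is part of the symbol, a symbol applied
  to a list of arguments is determined by its index and the length of the list. Constants are
  function symbols of arity 0.\<close>

record vocab =
  rels :: "(nat \<times> nat) set"
  funs :: "(nat \<times> nat) set"

text \<open>Every countable structure has a copy whose universe is a set of natural numbers. Values of
  the interpretations at symbols outside the vocabulary, or at arguments outside the universe,
  carry no information and are ignored by all notions below.\<close>

record struct =
  univ :: "nat set"
  rel_interp :: "nat \<Rightarrow> nat list \<Rightarrow> bool"
  fun_interp :: "nat \<Rightarrow> nat list \<Rightarrow> nat"

definition is_structure :: "vocab \<Rightarrow> struct \<Rightarrow> bool" where
  "is_structure L M \<longleftrightarrow> univ M \<noteq> {} \<and>
     (\<forall>i as. (i, length as) \<in> funs L \<and> set as \<subseteq> univ M \<longrightarrow> fun_interp M i as \<in> univ M)"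

definition isomorphic :: "vocab \<Rightarrow> struct \<Rightarrow> struct \<Rightarrow> bool" where
  "isomorphic L M N \<longleftrightarrow> is_structure L M \<and> is_structure L N \<and>
     (\<exists>h. bij_betw h (univ M) (univ N) \<and>
        (\<forall>i as. (i, length as) \<in> rels L \<and> set as \<subseteq> univ M \<longrightarrow>
           rel_interp N i (map h as) = rel_interp M i as) \<and>
        (\<forall>i as. (i, length as) \<in> funs L \<and> set as \<subseteq> univ M \<longrightarrow>
           fun_interp N i (map h as) = h (fun_interp M i as)))"

definition iso_types :: "vocab \<Rightarrow> struct set \<Rightarrow> struct set set" where
  "iso_types L K = K // {(M, N). isomorphic L M N}"


section \<open>Infinitary formulas\<close>

datatype tm = Var nat | App nat "tm list"

primrec tm_wf :: "vocab \<Rightarrow> tm \<Rightarrow> bool" where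
  "tm_wf L (Var x) \<longleftrightarrow> True"
| "tm_wf L (App i ts) \<longleftrightarrow> (i, length ts) \<in> funs L \<and> list_all (tm_wf L) ts"

primrec tm_vars :: "tm \<Rightarrow> nat set" where
  "tm_vars (Var x) = {x}"
| "tm_vars (App i ts) = \<Union> (set (map tm_vars ts))"

primrec tm_val :: "struct \<Rightarrow> (nat \<Rightarrow> nat) \<Rightarrow> tm \<Rightarrow> nat" where
  "tm_val M e (Var x) = e x"
| "tm_val M e (App i ts) = fun_interp M i (map (tm_val M e) ts)"

text \<open>Countable conjunctions and disjunctions are indexed by all of \<open>\<nat>\<close>; finite nonempty ones
  arise by repetition, empty ones via \<open>Bot\<close>.\<close>

datatype fm =
    Bot
  | Eq tm tm
  | Rel nat "tm list"
  | Neg fm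
  | And fm fm
  | Or fm fm
  | Conj "nat \<Rightarrow> fm"
  | Disj "nat \<Rightarrow> fm"
  | Ex nat fm
  | All nat fm

primrec fm_wf :: "vocab \<Rightarrow> fm \<Rightarrow> bool" where
  "fm_wf L Bot \<longleftrightarrow> True"
| "fm_wf L (Eq s t) \<longleftrightarrow> tm_wf L s \<and> tm_wf L t"
| "fm_wf L (Rel i ts) \<longleftrightarrow> (i, length ts) \<in> rels L \<and> list_all (tm_wf L) ts"
| "fm_wf L (Neg p) \<longleftrightarrow> fm_wf L p"
| "fm_wf L (And p q) \<longleftrightarrow> fm_wf L p \<and> fm_wf L q"
| "fm_wf L (Or p q) \<longleftrightarrow> fm_wf L p \<and> fm_wf L q"
| "fm_wf L (Conj P) \<longleftrightarrow> (\<forall>i. fm_wf L (P i))"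
| "fm_wf L (Disj P) \<longleftrightarrow> (\<forall>i. fm_wf L (P i))"
| "fm_wf L (Ex x p) \<longleftrightarrow> fm_wf L p"
| "fm_wf L (All x p) \<longleftrightarrow> fm_wf L p"

primrec fv :: "fm \<Rightarrow> nat set" where
  "fv Bot = {}"
| "fv (Eq s t) = tm_vars s \<union> tm_vars t"
| "fv (Rel i ts) = \<Union> (set (map tm_vars ts))"
| "fv (Neg p) = fv p"
| "fv (And p q) = fv p \<union> fv q"
| "fv (Or p q) = fv p \<union> fv q"
| "fv (Conj P) = (\<Union>i. fv (P i))"
| "fv (Disj P) = (\<Union>i. fv (P i))"
| "fv (Ex x p) = fv p - {x}"
| "fv (All x p) = fv p - {x}"

primrec sat :: "struct \<Rightarrow> (nat \<Rightarrow> nat) \<Rightarrow> fm \<Rightarrow> bool" where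
  "sat M e Bot \<longleftrightarrow> False"
| "sat M e (Eq s t) \<longleftrightarrow> tm_val M e s = tm_val M e t"
| "sat M e (Rel i ts) \<longleftrightarrow> rel_interp M i (map (tm_val M e) ts)"
| "sat M e (Neg p) \<longleftrightarrow> \<not> sat M e p"
| "sat M e (And p q) \<longleftrightarrow> sat M e p \<and> sat M e q"
| "sat M e (Or p q) \<longleftrightarrow> sat M e p \<or> sat M e q"
| "sat M e (Conj P) \<longleftrightarrow> (\<forall>i. sat M e (P i))"
| "sat M e (Disj P) \<longleftrightarrow> (\<exists>i. sat M e (P i))"
| "sat M e (Ex x p) \<longleftrightarrow> (\<exists>a\<in>univ M. sat M (e(x := a)) p)"
| "sat M e (All x p) \<longleftrightarrow> (\<forall>a\<in>univ M. sat M (e(x := a)) p)"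

text \<open>A sentence has no free variables; hence each of its subformulas has only finitely many.\<close>

definition sentence :: "vocab \<Rightarrow> fm \<Rightarrow> bool" where
  "sentence L S \<longleftrightarrow> fm_wf L S \<and> fv S = {}"

definition models :: "struct \<Rightarrow> fm \<Rightarrow> bool" where
  "models M S \<longleftrightarrow> (\<forall>e. sat M e S)"

definition Mod :: "vocab \<Rightarrow> fm \<Rightarrow> struct set" where
  "Mod L S = {M. is_structure L M \<and> models M S}"


section \<open>The hierarchy of infinitary formulas\<close>

primrec qfree :: "fm \<Rightarrow> bool" where
  "qfree Bot \<longleftrightarrow> True"
| "qfree (Eq s t) \<longleftrightarrow> True"
| "qfree (Rel i ts) \<longleftrightarrow> True"
| "qfree (Neg p) \<longleftrightarrow> qfree p"
| "qfree (And p q) \<longleftrightarrow> qfree p \<and> qfree q"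
| "qfree (Or p q) \<longleftrightarrow> qfree p \<and> qfree q"
| "qfree (Conj P) \<longleftrightarrow> False"
| "qfree (Disj P) \<longleftrightarrow> False"
| "qfree (Ex x p) \<longleftrightarrow> False"
| "qfree (All x p) \<longleftrightarrow> False"

inductive Sigma_in :: "omega1 \<Rightarrow> fm \<Rightarrow> bool" and Pi_in :: "omega1 \<Rightarrow> fm \<Rightarrow> bool" where
  Sigma_zero: "qfree p \<Longrightarrow> Sigma_in 0 p"
| Pi_zero: "qfree p \<Longrightarrow> Pi_in 0 p"
| Sigma_pos: "0 < a \<Longrightarrow> (\<And>i. \<exists>xs p b. P i = foldr Ex xs p \<and> b < a \<and> Pi_in b p) \<Longrightarrow>
    Sigma_in a (Disj P)"
| Pi_pos: "0 < a \<Longrightarrow> (\<And>i. \<exists>xs p b. P i = foldr All xs p \<and> b < a \<and> Sigma_in b p) \<Longrightarrow>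
    Pi_in a (Conj P)"

definition equiv_upto :: "vocab \<Rightarrow> omega1 \<Rightarrow> struct \<Rightarrow> struct \<Rightarrow> bool" where
  "equiv_upto L a M N \<longleftrightarrow> (\<forall>S. sentence L S \<and> Pi_in a S \<longrightarrow> (models M S \<longleftrightarrow> models N S))"

definition Scott_sentence :: "vocab \<Rightarrow> struct \<Rightarrow> fm \<Rightarrow> bool" where
  "Scott_sentence L M S \<longleftrightarrow> sentence L S \<and> Mod L S = {N. isomorphic L N M}"

definition cSR :: "vocab \<Rightarrow> struct \<Rightarrow> omega1" where
  "cSR L M = (LEAST a. \<exists>S. Scott_sentence L M S \<and> Pi_in (osuc a) S)"

text \<open>Complexity is taken up to logical equivalence, since an arbitrary infinitary sentence need
  not literally have the normal form of the hierarchy.\<close>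

definition qr :: "vocab \<Rightarrow> fm \<Rightarrow> omega1" where
  "qr L S = (LEAST b. \<exists>T. sentence L T \<and> Mod L T = Mod L S \<and> (Pi_in b T \<or> Sigma_in b T))"

definition Sigma_type :: "vocab \<Rightarrow> omega1 \<Rightarrow> struct \<Rightarrow> nat list \<Rightarrow> fm set" where
  "Sigma_type L a M as =
     {p. fm_wf L p \<and> Sigma_in a p \<and> fv p \<subseteq> {..<length as} \<and> sat M (\<lambda>i. as ! i) p}"


section \<open>Relative computability\<close>

text \<open>Total functions recursive in \<open>X\<close>, presented as unary functions via the Cantor pairing
  function. Minimization is applied to regular functions only.\<close>

inductive recursive_in :: "nat set \<Rightarrow> (nat \<Rightarrow> nat) \<Rightarrow> bool" for X where
  query: "recursive_in X (\<lambda>n. if n \<in> X then 1 else 0)"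
| zero: "recursive_in X (\<lambda>n. 0)"
| suc: "recursive_in X Suc"
| left: "recursive_in X (\<lambda>n. fst (prod_decode n))"
| right: "recursive_in X (\<lambda>n. snd (prod_decode n))"
| pair: "recursive_in X f \<Longrightarrow> recursive_in X g \<Longrightarrow> recursive_in X (\<lambda>n. prod_encode (f n, g n))"
| comp: "recursive_in X f \<Longrightarrow> recursive_in X g \<Longrightarrow> recursive_in X (\<lambda>n. f (g n))"
| prec: "recursive_in X f \<Longrightarrow> recursive_in X g \<Longrightarrow>
    recursive_in X (\<lambda>n. case prod_decode n of (a, m) \<Rightarrow>
      rec_nat (f a) (\<lambda>y r. g (prod_encode (a, prod_encode (y, r)))) m)"
| mu: "recursive_in X f \<Longrightarrow> (\<And>a. \<exists>m. f (prod_encode (a, m)) = 0) \<Longrightarrow>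
    recursive_in X (\<lambda>a. LEAST m. f (prod_encode (a, m)) = 0)"

definition computes_set :: "nat set \<Rightarrow> nat set \<Rightarrow> bool" where
  "computes_set X Y \<longleftrightarrow> recursive_in X (\<lambda>n. if n \<in> Y then 1 else 0)"

text \<open>\<open>\<omega>\<^sub>1\<close> relative to \<open>X\<close>: the least ordinal that is not the order type of an \<open>X\<close>-computable
  well-order of a set of natural numbers. Well-orders are reflexive, so their fields are
  \<open>X\<close>-computable as well.\<close>

definition omega1_rel :: "nat set \<Rightarrow> omega1" where
  "omega1_rel X = (LEAST a. \<not> (\<exists>r :: nat rel. Well_order r \<and> computes_set X (prod_encode ` r) \<and>
     r =o {(b, c). b \<le> c \<and> c < a}))"

text \<open>Codes for the universe, the true relational facts and the graphs of the functions.\<close>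

definition diagram :: "vocab \<Rightarrow> struct \<Rightarrow> nat set" where
  "diagram L M =
     {list_encode [0, a] | a. a \<in> univ M} \<union>
     {list_encode (1 # i # as) | i as.
        (i, length as) \<in> rels L \<and> set as \<subseteq> univ M \<and> rel_interp M i as} \<union>
     {list_encode (2 # i # fun_interp M i as # as) | i as.
        (i, length as) \<in> funs L \<and> set as \<subseteq> univ M}"

definition computes_copy :: "vocab \<Rightarrow> nat set \<Rightarrow> struct \<Rightarrow> bool" where
  "computes_copy L X A \<longleftrightarrow> (\<exists>B. isomorphic L B A \<and> computes_set X (diagram L B))"

definition omega1_struct :: "vocab \<Rightarrow> struct \<Rightarrow> omega1" where
  "omega1_struct L A = (LEAST a. \<exists>X. computes_copy L X A \<and> a = omega1_rel X)"


section \<open>Minimal counterexamples to Vaught's conjecture\<close>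

definition equiv_classes :: "vocab \<Rightarrow> fm \<Rightarrow> omega1 \<Rightarrow> struct set set" where
  "equiv_classes L \<phi> a = {{N \<in> Mod L \<phi>. equiv_upto L a M N} | M. M \<in> Mod L \<phi>}"

definition minimal_counterexample :: "vocab \<Rightarrow> fm \<Rightarrow> bool" where
  "minimal_counterexample L \<phi> \<longleftrightarrow>
     sentence L \<phi> \<and>
     |iso_types L (Mod L \<phi>)| =o cardSuc natLeq \<and>
     (\<forall>a. countable (equiv_classes L \<phi> a)) \<and>
     (\<forall>\<psi>. sentence L \<psi> \<longrightarrow>
        countable (iso_types L (Mod L (And \<phi> \<psi>))) \<or>
        countable (iso_types L (Mod L (And \<phi> (Neg \<psi>))))) \<and>
     (\<forall>a. countable {Sigma_type L a M as | M as. M \<in> Mod L \<phi> \<and> set as \<subseteq> univ M})"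

definition big_class :: "vocab \<Rightarrow> fm \<Rightarrow> omega1 \<Rightarrow> struct set" where
  "big_class L \<phi> b = (THE K. K \<in> equiv_classes L \<phi> b \<and> uncountable (iso_types L K))"

text \<open>In the usual notation, \<open>big_class\<close> is \<open>\<C>\<^sub>\<beta>\<close> (exactly one class is uncountable if \<open>\<phi>\<close> is a
  minimal counterexample), \<open>label\<close> is \<open>K\<^sub>\<beta>\<close>, \<open>rank_bound\<close> is \<open>f\<close> and \<open>closure_points\<close> is the set of
  \<open>\<alpha>\<close> with \<open>f(\<alpha>) \<le> \<alpha>\<close>. The label is determined only up to isomorphism; a representative is chosen.\<close>

definition label :: "vocab \<Rightarrow> fm \<Rightarrow> omega1 \<Rightarrow> struct" where
  "label L \<phi> b = (SOME K. K \<in> big_class L \<phi> b \<and>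
     (\<forall>N \<in> big_class L \<phi> b. cSR L K \<le> cSR L N \<and> (cSR L N = cSR L K \<longrightarrow> isomorphic L N K)))"

definition rank_bound :: "vocab \<Rightarrow> fm \<Rightarrow> omega1 \<Rightarrow> omega1" where
  "rank_bound L \<phi> a = (LEAST b. \<forall>M \<in> Mod L \<phi>. M \<notin> big_class L \<phi> a \<longrightarrow> cSR L M < b)"

definition closure_points :: "vocab \<Rightarrow> fm \<Rightarrow> omega1 set" where
  "closure_points L \<phi> = {a. rank_bound L \<phi> a \<le> a}"

definition W_all :: "vocab \<Rightarrow> fm \<Rightarrow> omega1 \<Rightarrow> struct set" where
  "W_all L \<phi> l = {A \<in> Mod L \<phi>. omega1_struct L A = l \<and> l \<le> cSR L A}"

definition W_high :: "vocab \<Rightarrow> fm \<Rightarrow> omega1 \<Rightarrow> struct set" where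
  "W_high L \<phi> l = {A \<in> W_all L \<phi> l. cSR L A = osuc l}"

definition x_prop :: "vocab \<Rightarrow> fm \<Rightarrow> omega1 \<Rightarrow> bool" where
  "x_prop L \<phi> l \<longleftrightarrow> (\<exists>A \<in> W_all L \<phi> l. cSR L A = l)"

definition y_g :: "vocab \<Rightarrow> fm \<Rightarrow> omega1 \<Rightarrow> bool" where
  "y_g L \<phi> l \<longleftrightarrow> (\<exists>A \<in> W_high L \<phi> l. A \<in> big_class L \<phi> (osuc l))"

end

(* Let K(b) be the label of the big class C(b), for b >= qr phi. Omitting the countably many
   unsupported Sigma_b types gives a model in C(b) all of whose tuples have a Pi_b type supported by a
   Sigma_b formula; such a model has a Pi_(b+1) Scott sentence. Conversely a model N in C(b) with a
   Pi_(b+1) Scott sentence S is isomorphic to it: a failure of S in the atomic model would be a Pi_b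
   property of a tuple, hence implied by a Sigma_b formula that N also realizes. So K(b) is this
   atomic model, cSR K(b) = b, and it is the only member of C(b) of that rank.

   Since l is a closure point, the models of rank l lie in C(l) and are copies of K(l); the models of
   rank l + 1 in C(l + 1) are copies of K(l + 1). The inequalities are Nadel's bound
   cSR A <= omega_1(A) + 1. For the latter, consider the tree of attempts to extend a map of tuples
   to an automorphism of a copy computable in X. If there is no automorphism, the tree is
   well-founded, its Kleene-Brouwer order is a well-order computable in X, and the rank of a node
   bounds the complexity of a formula that separates the two sides of the node. *)

theory Submission
  imports Defs
begin

section \<open>Countable ordinals\<close>

text \<open>What makes the construction of K(b) possible is that C(b) is the class of models of one
  Pi_(b+1) sentence; this is where scatteredness and qr phi \<le> b enter. The construction adds
  finitely many Pi_c facts, c < b, about named elements at a time. It can provide witnesses for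
  Sigma_b formulas, so universal statements about them, hence Pi_(b+1) sentences, survive into the
  limit. A type is then bounded by a finite set of such facts, and a support is one existential
  block over a Pi_c formula. This form keeps the Scott sentence at Pi_(b+1), since the block is
  absorbed into the leading universal quantifiers. Consistency of a set of facts means that some
  member of C(b) satisfies it; this replaces a completeness theorem. In the tree for Nadel's bound,
  elements are put alternately into range and domain, so that an infinite path is onto on both
  sides. This alternation is why the separating formulas change sides from one stage to the
  next.\<close>

lemma countable_bounded_omega1:
  fixes A :: "omega1 set"
  assumes "countable A"
  shows "\<exists>b. \<forall>a\<in>A. a < b"
proof (rule ccontr)
  assume "\<not> ?thesis"
  \<comment> \<open>An unbounded countable set would write omega_1 as a countable union of countable
    initial segments.\<close>
  then have "UNIV = (\<Union>a\<in>A. insert a {..<a})"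
    by (auto simp: not_less) (metis order_le_less)
  moreover have "countable (\<Union>a\<in>A. insert a {..<a})"
    using assms countable_lessThan_omega1 by auto
  ultimately show False using uncountable_omega1 by simp
qed

lemma less_osuc: "a < osuc a"
proof -
  have "\<exists>b. a < b" using countable_bounded_omega1[of "{a}"] by auto
  then show ?thesis unfolding osuc_def by (rule LeastI_ex)
qed

lemma osuc_le_iff: "osuc a \<le> b \<longleftrightarrow> a < b"
  using less_osuc[of a] by (auto simp: osuc_def intro: Least_le)

lemma less_osuc_iff: "a < osuc b \<longleftrightarrow> a \<le> b"
  using osuc_le_iff[of b a] by (meson not_le)

lemma zero_le_omega1: "0 \<le> (a :: omega1)"
  by (simp add: zero_omega1_def Least_le)

lemma osuc_pos: "0 < osuc a"
  using zero_le_omega1 less_osuc_iff by blast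


section \<open>Definable properties\<close>

lemma tm_val_cong: "(\<And>x. x \<in> tm_vars t \<Longrightarrow> e x = e' x) \<Longrightarrow> tm_val M e t = tm_val M e' t"
proof (induction t)
  case (App i ts)
  then have "map (tm_val M e) ts = map (tm_val M e') ts" by auto
  then show ?case by (simp del: map_eq_conv)
qed auto

lemma sat_cong: "(\<And>x. x \<in> fv p \<Longrightarrow> e x = e' x) \<Longrightarrow> sat M e p = sat M e' p"
proof (induction p arbitrary: e e')
  case (Eq s t)
  then have "tm_val M e s = tm_val M e' s" "tm_val M e t = tm_val M e' t"
    by (auto intro!: tm_val_cong)
  then show ?case by simp
next
  case (Rel i ts)
  then have "map (tm_val M e) ts = map (tm_val M e') ts" by (auto intro!: tm_val_cong)
  then show ?case by (simp del: map_eq_conv)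
next
  case (Neg p)
  from Neg.IH[of e e'] Neg.prems show ?case by simp
next
  case (And p q)
  from And.IH(1)[of e e'] And.IH(2)[of e e'] And.prems show ?case by simp
next
  case (Or p q)
  from Or.IH(1)[of e e'] Or.IH(2)[of e e'] Or.prems show ?case by simp
next
  case (Conj P)
  have "sat M e (P i) = sat M e' (P i)" for i by (rule Conj.IH) (use Conj.prems in auto)
  then show ?case by simp
next
  case (Disj P)
  have "sat M e (P i) = sat M e' (P i)" for i by (rule Disj.IH) (use Disj.prems in auto)
  then show ?case by simp
next
  case (Ex x p)
  have "sat M (e(x := a)) p = sat M (e'(x := a)) p" for a
    by (rule Ex.IH) (use Ex.prems in auto)
  then show ?case by simp
next
  case (All x p)
  have "sat M (e(x := a)) p = sat M (e'(x := a)) p" for a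
    by (rule All.IH) (use All.prems in auto)
  then show ?case by simp
qed auto

section \<open>Blocks of quantifiers as changes of the assignment\<close>

definition reassign :: "struct \<Rightarrow> nat list \<Rightarrow> (nat \<Rightarrow> nat) \<Rightarrow> (nat \<Rightarrow> nat) \<Rightarrow> bool" where
  "reassign M xs e e' \<longleftrightarrow> (\<forall>x. x \<notin> set xs \<longrightarrow> e' x = e x) \<and> (\<forall>x\<in>set xs. e' x \<in> univ M)"

lemma reassign_Nil [simp]: "reassign M [] e e' \<longleftrightarrow> e' = e"
  by (auto simp: reassign_def)

lemma reassign_Cons:
  "reassign M (x # xs) e e' \<longleftrightarrow> (\<exists>a\<in>univ M. reassign M xs (e(x := a)) e')"
  unfolding reassign_def
  by (cases "x \<in> set xs") (auto intro: bexI[of _ "e' x"])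

lemma sat_foldr_Ex: "sat M e (foldr Ex xs p) \<longleftrightarrow> (\<exists>e'. reassign M xs e e' \<and> sat M e' p)"
  by (induction xs arbitrary: e) (auto simp: reassign_Cons)

lemma sat_foldr_All: "sat M e (foldr All xs p) \<longleftrightarrow> (\<forall>e'. reassign M xs e e' \<longrightarrow> sat M e' p)"
  by (induction xs arbitrary: e) (auto simp: reassign_Cons)

lemma fv_foldr_Ex: "fv (foldr Ex xs p) = fv p - set xs"
  by (induction xs) auto

lemma fv_foldr_All: "fv (foldr All xs p) = fv p - set xs"
  by (induction xs) auto

lemma fm_wf_foldr_Ex [simp]: "fm_wf L (foldr Ex xs p) = fm_wf L p"
  by (induction xs) auto

lemma fm_wf_foldr_All [simp]: "fm_wf L (foldr All xs p) = fm_wf L p"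
  by (induction xs) auto

text \<open>A formula of the hierarchy has a rigid normal form, so the levels are closed under
  connectives, renaming and inclusion only up to equivalence. Hence the closure rules below are
  about properties. Equivalence is required at all assignments, which makes a property depend on the
  variables in \<open>V\<close> alone.\<close>

definition sigma_definable ::
    "vocab \<Rightarrow> omega1 \<Rightarrow> nat set \<Rightarrow> (struct \<Rightarrow> (nat \<Rightarrow> nat) \<Rightarrow> bool) \<Rightarrow> bool" where
  "sigma_definable L a V Q \<longleftrightarrow>
     (\<exists>p. Sigma_in a p \<and> fm_wf L p \<and> fv p \<subseteq> V \<and> (\<forall>M e. sat M e p \<longleftrightarrow> Q M e))"

definition pi_definable ::
    "vocab \<Rightarrow> omega1 \<Rightarrow> nat set \<Rightarrow> (struct \<Rightarrow> (nat \<Rightarrow> nat) \<Rightarrow> bool) \<Rightarrow> bool" where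
  "pi_definable L a V Q \<longleftrightarrow>
     (\<exists>p. Pi_in a p \<and> fm_wf L p \<and> fv p \<subseteq> V \<and> (\<forall>M e. sat M e p \<longleftrightarrow> Q M e))"

lemma sigma_definableI:
  "Sigma_in a p \<Longrightarrow> fm_wf L p \<Longrightarrow> fv p \<subseteq> V \<Longrightarrow> sigma_definable L a V (\<lambda>M e. sat M e p)"
  unfolding sigma_definable_def by blast

lemma pi_definableI:
  "Pi_in a p \<Longrightarrow> fm_wf L p \<Longrightarrow> fv p \<subseteq> V \<Longrightarrow> pi_definable L a V (\<lambda>M e. sat M e p)"
  unfolding pi_definable_def by blast

lemma sigma_definable_cong:
  "sigma_definable L a V Q \<Longrightarrow> (\<And>x. x \<in> V \<Longrightarrow> e x = e' x) \<Longrightarrow> Q M e = Q M e'"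
  unfolding sigma_definable_def by (metis sat_cong subsetD)

lemma pi_definable_cong:
  "pi_definable L a V Q \<Longrightarrow> (\<And>x. x \<in> V \<Longrightarrow> e x = e' x) \<Longrightarrow> Q M e = Q M e'"
  unfolding pi_definable_def by (metis sat_cong subsetD)

lemma sigma_definable_vars: "sigma_definable L a V Q \<Longrightarrow> V \<subseteq> V' \<Longrightarrow> sigma_definable L a V' Q"
  unfolding sigma_definable_def by blast

lemma pi_definable_vars: "pi_definable L a V Q \<Longrightarrow> V \<subseteq> V' \<Longrightarrow> pi_definable L a V' Q"
  unfolding pi_definable_def by blast

lemma Sigma_in_zero: "Sigma_in 0 p \<longleftrightarrow> qfree p"
  by (auto elim: Sigma_in.cases intro: Sigma_zero)

lemma Pi_in_zero: "Pi_in 0 p \<longleftrightarrow> qfree p"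
  by (auto elim: Pi_in.cases intro: Pi_zero)

text \<open>Dualizing goes through the hierarchy block by block; a \<open>Neg\<close> is added only
  at the quantifier-free bottom. Well-formedness and free variables are carried along because the
  dual formula must be definable in the same variables.\<close>

lemma sigma_pi_definable_neg_aux:
  "Sigma_in a p \<Longrightarrow> fm_wf L p \<longrightarrow>
     (\<exists>q. Pi_in a q \<and> fm_wf L q \<and> fv q \<subseteq> fv p \<and> (\<forall>M e. sat M e q \<longleftrightarrow> \<not> sat M e p))"
  "Pi_in a p \<Longrightarrow> fm_wf L p \<longrightarrow>
     (\<exists>q. Sigma_in a q \<and> fm_wf L q \<and> fv q \<subseteq> fv p \<and> (\<forall>M e. sat M e q \<longleftrightarrow> \<not> sat M e p))"
proof (induction rule: Sigma_in_Pi_in.inducts)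
  case (Sigma_zero p)
  show ?case by (rule impI, rule exI[of _ "Neg p"]) (use Sigma_zero in \<open>auto intro: Pi_zero\<close>)
next
  case (Pi_zero p)
  show ?case by (rule impI, rule exI[of _ "Neg p"]) (use Pi_zero in \<open>auto intro: Sigma_zero\<close>)
next
  case (Sigma_pos a P)
  show ?case
  proof
    assume wf: "fm_wf L (Disj P)"
    obtain xs p b where P: "\<And>i. P i = foldr Ex (xs i) (p i)" "\<And>i. b i < a"
        and IH: "\<And>i. fm_wf L (p i) \<longrightarrow> (\<exists>q. Pi_in (b i) (p i) \<and> Sigma_in (b i) q \<and> fm_wf L q \<and>
          fv q \<subseteq> fv (p i) \<and> (\<forall>M e. sat M e q \<longleftrightarrow> \<not> sat M e (p i)))"
      using Sigma_pos(2) by metis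
    from wf P have "\<And>i. fm_wf L (p i)" by auto
    with IH obtain q where q: "\<And>i. Sigma_in (b i) (q i) \<and> fm_wf L (q i) \<and> fv (q i) \<subseteq> fv (p i)"
        "\<And>i M e. sat M e (q i) \<longleftrightarrow> \<not> sat M e (p i)"
      by metis
    show "\<exists>q. Pi_in a q \<and> fm_wf L q \<and> fv q \<subseteq> fv (Disj P) \<and>
        (\<forall>M e. sat M e q \<longleftrightarrow> \<not> sat M e (Disj P))"
    proof (intro exI[of _ "Conj (\<lambda>i. foldr All (xs i) (q i))"] conjI)
      show "Pi_in a (Conj (\<lambda>i. foldr All (xs i) (q i)))"
        by (rule Pi_pos[OF Sigma_pos(1)]) (use P q in blast)
    qed (use q in \<open>auto simp: P fv_foldr_Ex fv_foldr_All sat_foldr_Ex sat_foldr_All\<close>)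
  qed
next
  case (Pi_pos a P)
  show ?case
  proof
    assume wf: "fm_wf L (Conj P)"
    obtain xs p b where P: "\<And>i. P i = foldr All (xs i) (p i)" "\<And>i. b i < a"
        and IH: "\<And>i. fm_wf L (p i) \<longrightarrow> (\<exists>q. Sigma_in (b i) (p i) \<and> Pi_in (b i) q \<and> fm_wf L q \<and>
          fv q \<subseteq> fv (p i) \<and> (\<forall>M e. sat M e q \<longleftrightarrow> \<not> sat M e (p i)))"
      using Pi_pos(2) by metis
    from wf P have "\<And>i. fm_wf L (p i)" by auto
    with IH obtain q where q: "\<And>i. Pi_in (b i) (q i) \<and> fm_wf L (q i) \<and> fv (q i) \<subseteq> fv (p i)"
        "\<And>i M e. sat M e (q i) \<longleftrightarrow> \<not> sat M e (p i)"
      by metis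
    show "\<exists>q. Sigma_in a q \<and> fm_wf L q \<and> fv q \<subseteq> fv (Conj P) \<and>
        (\<forall>M e. sat M e q \<longleftrightarrow> \<not> sat M e (Conj P))"
    proof (intro exI[of _ "Disj (\<lambda>i. foldr Ex (xs i) (q i))"] conjI)
      show "Sigma_in a (Disj (\<lambda>i. foldr Ex (xs i) (q i)))"
        by (rule Sigma_pos[OF Pi_pos(1)]) (use P q in blast)
    qed (use q in \<open>auto simp: P fv_foldr_Ex fv_foldr_All sat_foldr_Ex sat_foldr_All\<close>)
  qed
qed

lemma pi_definable_not_iff: "pi_definable L a V (\<lambda>M e. \<not> Q M e) \<longleftrightarrow> sigma_definable L a V Q"
proof
  assume "pi_definable L a V (\<lambda>M e. \<not> Q M e)"
  then obtain p where p: "Pi_in a p" "fm_wf L p" "fv p \<subseteq> V" "\<And>M e. sat M e p \<longleftrightarrow> \<not> Q M e"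
    unfolding pi_definable_def by blast
  from sigma_pi_definable_neg_aux(2)[OF p(1), of L] p show "sigma_definable L a V Q"
    unfolding sigma_definable_def by (metis order_trans)
next
  assume "sigma_definable L a V Q"
  then obtain p where p: "Sigma_in a p" "fm_wf L p" "fv p \<subseteq> V" "\<And>M e. sat M e p \<longleftrightarrow> Q M e"
    unfolding sigma_definable_def by blast
  from sigma_pi_definable_neg_aux(1)[OF p(1), of L] p show "pi_definable L a V (\<lambda>M e. \<not> Q M e)"
    unfolding pi_definable_def by (metis order_trans)
qed

lemma sigma_definable_not_iff: "sigma_definable L a V (\<lambda>M e. \<not> Q M e) \<longleftrightarrow> pi_definable L a V Q"
  using pi_definable_not_iff[of L a V "\<lambda>M e. \<not> Q M e"] by simp

text \<open>The normal form read semantically: countably many existential blocks over properties of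
  lower Pi level. The closure proofs below combine these data instead of formulas.\<close>

lemma sigma_definable_iff_blocks:
  assumes "0 < a"
  shows "sigma_definable L a V Q \<longleftrightarrow> (\<exists>xs b R. (\<forall>i::nat. b i < a \<and>
     pi_definable L (b i) (V \<union> set (xs i)) (R i)) \<and>
     Q = (\<lambda>M e. \<exists>i e'. reassign M (xs i) e e' \<and> R i M e'))" (is "_ = ?rhs")
proof
  assume "sigma_definable L a V Q"
  then obtain p where p: "Sigma_in a p" "fm_wf L p" "fv p \<subseteq> V" "\<And>M e. sat M e p \<longleftrightarrow> Q M e"
    unfolding sigma_definable_def by blast
  from p(1) assms obtain P where P: "p = Disj P"
      "\<And>i. \<exists>xs p b. P i = foldr Ex xs p \<and> b < a \<and> Pi_in b p"
    by (auto elim: Sigma_in.cases)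
  then obtain xs q b where q: "\<And>i. P i = foldr Ex (xs i) (q i)" "\<And>i. b i < a"
      "\<And>i. Pi_in (b i) (q i)" by metis
  have "pi_definable L (b i) (V \<union> set (xs i)) (\<lambda>M e. sat M e (q i))" for i
    using p(2,3) q(3) by (intro pi_definableI) (auto simp: P q(1) fv_foldr_Ex)
  moreover have "Q = (\<lambda>M e. \<exists>i e'. reassign M (xs i) e e' \<and> sat M e' (q i))"
    using p(4) by (auto simp: P q(1) sat_foldr_Ex fun_eq_iff)
  ultimately show ?rhs using q(2)
    by (intro exI[of _ xs] exI[of _ b] exI[of _ "\<lambda>i M e. sat M e (q i)"]) auto
next
  assume ?rhs
  then obtain xs b R where bR: "\<forall>i::nat. b i < a \<and> pi_definable L (b i) (V \<union> set (xs i)) (R i)"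
     and Q: "Q = (\<lambda>M e. \<exists>i e'. reassign M (xs i) e e' \<and> R i M e')"
    by (elim exE conjE)
  note R = bR[THEN spec, THEN conjunct1] bR[THEN spec, THEN conjunct2] Q
  from R(2) obtain q where q: "\<And>i. Pi_in (b i) (q i)" "\<And>i. fm_wf L (q i)"
      "\<And>i. fv (q i) \<subseteq> V \<union> set (xs i)" "\<And>i M e. sat M e (q i) \<longleftrightarrow> R i M e"
    unfolding pi_definable_def by metis
  have "Sigma_in a (Disj (\<lambda>i. foldr Ex (xs i) (q i)))"
    by (rule Sigma_pos[OF assms]) (use R q in blast)
  then show "sigma_definable L a V Q"
    unfolding sigma_definable_def
    by (intro exI[of _ "Disj (\<lambda>i. foldr Ex (xs i) (q i))"])
       (use q in \<open>auto simp: fv_foldr_Ex R(3) sat_foldr_Ex\<close>)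
qed

lemma sigma_definable_blocksE:
  fixes V :: "nat set"
  assumes "sigma_definable L a V Q" "0 < a"
  obtains xs b R where "\<And>i::nat. b i < a" "\<And>i. pi_definable L (b i) (V \<union> set (xs i)) (R i)"
     "Q = (\<lambda>M e. \<exists>i e'. reassign M (xs i) e e' \<and> R i M e')"
proof -
  from assms(1) obtain xs b R where
    "\<forall>i::nat. b i < a \<and> pi_definable L (b i) (V \<union> set (xs i)) (R i)"
    "Q = (\<lambda>M e. \<exists>i e'. reassign M (xs i) e e' \<and> R i M e')"
    unfolding sigma_definable_iff_blocks[OF assms(2)] by (elim exE conjE)
  then show thesis by (intro that[of b xs R]) simp_all
qed

lemma sigma_definable_blocksI:
  assumes "0 < a" "\<And>i::nat. b i < a" "\<And>i. pi_definable L (b i) (V \<union> set (xs i)) (R i)"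
    "\<And>M e. Q M e \<longleftrightarrow> (\<exists>i e'. reassign M (xs i) e e' \<and> R i M e')"
  shows "sigma_definable L a V Q"
proof -
  have "Q = (\<lambda>M e. \<exists>i e'. reassign M (xs i) e e' \<and> R i M e')"
    by (intro ext) (rule assms(4))
  moreover have "\<forall>i. b i < a \<and> pi_definable L (b i) (V \<union> set (xs i)) (R i)"
    using assms(2,3) by simp
  ultimately show ?thesis unfolding sigma_definable_iff_blocks[OF assms(1)] by (intro exI conjI)
qed

lemma sigma_definable_if_pi:
  assumes "pi_definable L b V Q" "b < a"
  shows "sigma_definable L a V Q"
proof -
  have "0 < a" using assms(2) zero_le_omega1 le_less_trans by blast
  then show ?thesis
    by (subst sigma_definable_iff_blocks)
       (use assms in \<open>auto intro!: exI[of _ "\<lambda>_. []"] exI[of _ "\<lambda>_. b"] exI[of _ "\<lambda>_. Q"]\<close>)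
qed

lemma pi_definable_if_sigma: "sigma_definable L b V Q \<Longrightarrow> b < a \<Longrightarrow> pi_definable L a V Q"
  using sigma_definable_if_pi[of L b V "\<lambda>M e. \<not> Q M e" a] pi_definable_not_iff
    sigma_definable_not_iff by blast

text \<open>Level 0 is special: a quantifier-free formula is not a disjunction of blocks. It belongs
  to Sigma_0 and Pi_0 at once and climbs as a Pi property.\<close>

lemma sigma_definable_mono:
  assumes "sigma_definable L b V Q" "b \<le> a"
  shows "sigma_definable L a V Q"
proof (cases "b = 0 \<or> b = a")
  case True
  then show ?thesis
  proof
    assume "b = 0"
    with assms(1) have "pi_definable L b V Q"
      unfolding sigma_definable_def pi_definable_def by (simp add: Sigma_in_zero Pi_in_zero)
    with assms show ?thesis using sigma_definable_if_pi[of L b V Q a] by (auto simp: order_le_less)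
  qed (use assms(1) in simp)
next
  case False
  then have "0 < b" using zero_le_omega1[of b] by (simp add: order_less_le)
  then have pos: "0 < b" "0 < a" using assms(2) by auto
  from assms(1) obtain xs c R where
    R: "\<forall>i::nat. c i < b \<and> pi_definable L (c i) (V \<union> set (xs i)) (R i)"
      "Q = (\<lambda>M e. \<exists>i e'. reassign M (xs i) e e' \<and> R i M e')"
    unfolding sigma_definable_iff_blocks[OF pos(1)] by (elim exE conjE)
  from R(1) assms(2) have "\<forall>i::nat. c i < a \<and> pi_definable L (c i) (V \<union> set (xs i)) (R i)"
    using less_le_trans by blast
  with R(2) show ?thesis unfolding sigma_definable_iff_blocks[OF pos(2)] by blast
qed

lemma pi_definable_mono: "pi_definable L b V Q \<Longrightarrow> b \<le> a \<Longrightarrow> pi_definable L a V Q"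
  using sigma_definable_mono sigma_definable_not_iff by blast

lemma sigma_definable_disj:
  assumes "0 < a" "\<And>i::nat. sigma_definable L a V (Q i)"
  shows "sigma_definable L a V (\<lambda>M e. \<exists>i. Q i M e)"
proof -
  define good where "good i z \<longleftrightarrow> (case z of (xs, b, R) \<Rightarrow>
     (\<forall>j::nat. b j < a \<and> pi_definable L (b j) (V \<union> set (xs j)) (R j)) \<and>
     Q i = (\<lambda>M e. \<exists>j e'. reassign M (xs j) e e' \<and> R j M e'))" for i z
  have "\<exists>z. good i z" for i
  proof -
    from assms(2)[of i] obtain xs b R where "good i (xs, b, R)"
      unfolding sigma_definable_iff_blocks[OF assms(1)] good_def prod.case by (elim exE)
    then show ?thesis by blast
  qed
  then obtain z where z: "\<And>i. good i (z i)" by metis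
  define xs where "xs i = fst (z i)" for i
  define b where "b i = fst (snd (z i))" for i
  define R where "R i = snd (snd (z i))" for i
  have zi: "z i = (xs i, b i, R i)" for i by (simp add: xs_def b_def R_def)
  have R: "\<And>i j::nat. b i j < a \<and> pi_definable L (b i j) (V \<union> set (xs i j)) (R i j)"
      "\<And>i. Q i = (\<lambda>M e. \<exists>j e'. reassign M (xs i j) e e' \<and> R i j M e')"
    using z unfolding good_def zi prod.case by blast+
  \<comment> \<open>A disjunction of disjunctions is one disjunction, indexed by coded
    pairs.\<close>
  let ?d = "\<lambda>g n. (case prod_decode n of (i, j) \<Rightarrow> g i j)"
  have "\<forall>n. ?d b n < a \<and> pi_definable L (?d b n) (V \<union> set (?d xs n)) (?d R n)"
    using R(1) by (simp split: prod.split)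
  moreover have "(\<lambda>M e. \<exists>i. Q i M e) =
      (\<lambda>M e. \<exists>n e'. reassign M (?d xs n) e e' \<and> ?d R n M e')"
  proof (intro ext iffI)
    fix M e assume "\<exists>i. Q i M e"
    then obtain i j e' where "reassign M (xs i j) e e' \<and> R i j M e'"
      unfolding R(2) by blast
    then show "\<exists>n e'. reassign M (?d xs n) e e' \<and> ?d R n M e'"
      by (intro exI[of _ "prod_encode (i, j)"] exI[of _ e']) simp
  next
    fix M e assume "\<exists>n e'. reassign M (?d xs n) e e' \<and> ?d R n M e'"
    then show "\<exists>i. Q i M e" unfolding R(2) by (force split: prod.splits)
  qed
  ultimately show ?thesis unfolding sigma_definable_iff_blocks[OF assms(1)]
    by (intro exI conjI)
qed

lemma pi_definable_conj:
  assumes "0 < a" "\<And>i::nat. pi_definable L a V (Q i)"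
  shows "pi_definable L a V (\<lambda>M e. \<forall>i. Q i M e)"
  using sigma_definable_disj[OF assms(1), of L V "\<lambda>i M e. \<not> Q i M e"] assms(2)
  unfolding not_all[symmetric] sigma_definable_not_iff by simp

text \<open>Level 0 has only finite disjunctions, so the syntactic \<open>Or\<close> serves there;
  above it, the second disjunct is repeated to fill the index set.\<close>

lemma sigma_definable_or:
  assumes "sigma_definable L a V Q" "sigma_definable L a V R"
  shows "sigma_definable L a V (\<lambda>M e. Q M e \<or> R M e)"
proof (cases "a = 0")
  case True
  from assms(1) obtain p where
    p: "qfree p \<and> fm_wf L p \<and> fv p \<subseteq> V \<and> (\<forall>M e. sat M e p \<longleftrightarrow> Q M e)"
    unfolding sigma_definable_def True Sigma_in_zero by (elim exE)
  from assms(2) obtain q where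
    q: "qfree q \<and> fm_wf L q \<and> fv q \<subseteq> V \<and> (\<forall>M e. sat M e q \<longleftrightarrow> R M e)"
    unfolding sigma_definable_def True Sigma_in_zero by (elim exE)
  show ?thesis unfolding sigma_definable_def True Sigma_in_zero
    by (rule exI[of _ "Or p q"]) (use p q in simp)
next
  case False
  then have "0 < a" using zero_le_omega1 by (metis order_le_less)
  have "(\<lambda>M e. Q M e \<or> R M e) = (\<lambda>M e. \<exists>i::nat. (if i = 0 then Q else R) M e)"
  proof (intro ext iffI)
    fix M e assume "Q M e \<or> R M e"
    then show "\<exists>i::nat. (if i = 0 then Q else R) M e"
      by (elim disjE) (rule exI[of _ 0], simp, rule exI[of _ 1], simp)
  next
    fix M e assume "\<exists>i::nat. (if i = 0 then Q else R) M e"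
    then show "Q M e \<or> R M e" by (elim exE) (simp split: if_split_asm)
  qed
  with sigma_definable_disj[OF \<open>0 < a\<close>, of L V "\<lambda>i. if i = 0 then Q else R"] assms
  show ?thesis by simp
qed

lemma pi_definable_and:
  assumes "pi_definable L a V Q" "pi_definable L a V R"
  shows "pi_definable L a V (\<lambda>M e. Q M e \<and> R M e)"
  using sigma_definable_or[of L a V "\<lambda>M e. \<not> Q M e" "\<lambda>M e. \<not> R M e"] assms
  unfolding de_Morgan_conj[symmetric] sigma_definable_not_iff by simp

lemma reassign_append:
  "reassign M (xs @ ys) e e' \<longleftrightarrow> (\<exists>d. reassign M xs e d \<and> reassign M ys d e')"
  by (induction xs arbitrary: e) (auto simp: reassign_Cons)

lemma sigma_definable_ex_block:
  assumes "0 < a" "sigma_definable L a (V \<union> set ys) Q"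
  shows "sigma_definable L a V (\<lambda>M e. \<exists>e'. reassign M ys e e' \<and> Q M e')"
proof -
  obtain xs b R where R: "\<And>i::nat. b i < a" "\<And>i. pi_definable L (b i) (V \<union> set ys \<union> set (xs i)) (R i)"
     "Q = (\<lambda>M e. \<exists>i e'. reassign M (xs i) e e' \<and> R i M e')"
    by (rule sigma_definable_blocksE[OF assms(2,1)]) (rule that, assumption+)
  show ?thesis
  proof (rule sigma_definable_blocksI[OF assms(1) R(1), where xs = "\<lambda>i. ys @ xs i"])
    show "pi_definable L (b i) (V \<union> set (ys @ xs i)) (R i)" for i
      using R(2)[of i] by (simp add: Un_assoc)
  qed (auto simp: R(3) reassign_append)
qed

lemma pi_definable_all_block:
  assumes "0 < a" "pi_definable L a (V \<union> set ys) Q"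
  shows "pi_definable L a V (\<lambda>M e. \<forall>e'. reassign M ys e e' \<longrightarrow> Q M e')"
  using sigma_definable_ex_block[OF assms(1), of L V ys "\<lambda>M e. \<not> Q M e"] assms(2)
  unfolding not_imp[symmetric] not_all[symmetric] sigma_definable_not_iff by simp

section \<open>Renaming of variables\<close>

primrec rename_tm :: "(nat \<Rightarrow> nat) \<Rightarrow> tm \<Rightarrow> tm" where
  "rename_tm r (Var x) = Var (r x)"
| "rename_tm r (App i ts) = App i (map (rename_tm r) ts)"

lemma rename_tm_props:
  "tm_val M e (rename_tm r t) = tm_val M (\<lambda>x. e (r x)) t"
  "tm_vars (rename_tm r t) = r ` tm_vars t"
  "tm_wf L (rename_tm r t) = tm_wf L t"
proof (induction t)
  case (App i ts)
  { case 1
    then have "map (tm_val M e \<circ> rename_tm r) ts = map (tm_val M (\<lambda>x. e (r x))) ts" using App by simp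
    then show ?case by (simp del: map_eq_conv) }
  { case 2 show ?case using App by auto }
  { case 3 show ?case using App by (auto simp: list_all_iff) }
qed auto

lemma rename_qfree:
  "qfree p \<Longrightarrow> fm_wf L p \<Longrightarrow>
     \<exists>q. qfree q \<and> fm_wf L q \<and> fv q \<subseteq> r ` fv p \<and> (\<forall>M e. sat M e q \<longleftrightarrow> sat M (\<lambda>x. e (r x)) p)"
proof (induction p)
  case Bot
  then show ?case by (intro exI[of _ Bot]) auto
next
  case (Eq s t)
  then show ?case
    by (intro exI[of _ "Eq (rename_tm r s) (rename_tm r t)"]) (auto simp: rename_tm_props)
next
  case (Rel i ts)
  have "map (tm_val M e \<circ> rename_tm r) ts = map (tm_val M (\<lambda>x. e (r x))) ts" for M e
    by (simp add: rename_tm_props)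
  then show ?case using Rel
    by (intro exI[of _ "Rel i (map (rename_tm r) ts)"])
      (auto simp: rename_tm_props list_all_iff simp del: map_eq_conv)
next
  case (Neg p)
  then obtain q where "qfree q" "fm_wf L q" "fv q \<subseteq> r ` fv p" "\<forall>M e. sat M e q \<longleftrightarrow> sat M (\<lambda>x. e (r x)) p"
    by auto
  then show ?case by (intro exI[of _ "Neg q"]) auto
next
  case (And p1 p2)
  then obtain q1 q2 where "qfree q1 \<and> fm_wf L q1 \<and> fv q1 \<subseteq> r ` fv p1"
    "\<forall>M e. sat M e q1 \<longleftrightarrow> sat M (\<lambda>x. e (r x)) p1" "qfree q2 \<and> fm_wf L q2 \<and> fv q2 \<subseteq> r ` fv p2"
    "\<forall>M e. sat M e q2 \<longleftrightarrow> sat M (\<lambda>x. e (r x)) p2"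
    by auto
  then show ?case by (intro exI[of _ "And q1 q2"]) auto
next
  case (Or p1 p2)
  then obtain q1 q2 where "qfree q1 \<and> fm_wf L q1 \<and> fv q1 \<subseteq> r ` fv p1"
    "\<forall>M e. sat M e q1 \<longleftrightarrow> sat M (\<lambda>x. e (r x)) p1" "qfree q2 \<and> fm_wf L q2 \<and> fv q2 \<subseteq> r ` fv p2"
    "\<forall>M e. sat M e q2 \<longleftrightarrow> sat M (\<lambda>x. e (r x)) p2"
    by auto
  then show ?case by (intro exI[of _ "Or q1 q2"]) auto
qed auto

text \<open>Capture is the only obstacle; \<open>r\<close> may identify variables. Since
  \<open>V\<close> is finite, all new free variables lie below some \<open>B\<close>.\<close>

lemma sigma_definable_rename:
  "sigma_definable L a V Q \<Longrightarrow> finite V \<Longrightarrow>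
     sigma_definable L a (r ` V) (\<lambda>M e. Q M (\<lambda>x. e (r x)))"
proof (induction a arbitrary: V Q r rule: less_induct)
  case (less a)
  show ?case
  proof (cases "a = 0")
    case True
    from less.prems obtain p where p: "qfree p" "fm_wf L p" "fv p \<subseteq> V" "\<And>M e. sat M e p \<longleftrightarrow> Q M e"
      unfolding sigma_definable_def True Sigma_in_zero by blast
    from rename_qfree[OF p(1,2), of r] p(3,4) show ?thesis
      unfolding sigma_definable_def True Sigma_in_zero by (metis image_mono order_trans)
  next
    case False
    then have pos: "0 < a" using zero_le_omega1 by (metis order_le_less)
    obtain xs b R where R: "\<And>i::nat. b i < a" "\<And>i. pi_definable L (b i) (V \<union> set (xs i)) (R i)"
       "Q = (\<lambda>M e. \<exists>i e'. reassign M (xs i) e e' \<and> R i M e')"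
      by (rule sigma_definable_blocksE[OF less.prems(1) pos]) (rule that, assumption+)
    obtain B where B: "\<And>y. y \<in> r ` V \<Longrightarrow> y < B"
      using less.prems(2) by (meson finite_imageI finite_nat_set_iff_bounded)
    \<comment> \<open>bound variables move above \<open>B\<close>, out of reach of the new free variables\<close>
    define s where "s i x = (if x \<in> set (xs i) then B + x else r x)" for i x
    define ys where "ys i = map ((+) B) (xs i)" for i
    have s_img: "s i ` (V \<union> set (xs i)) \<subseteq> r ` V \<union> set (ys i)" for i
      by (auto simp: s_def ys_def)
    have "pi_definable L (b i) (s i ` (V \<union> set (xs i))) (\<lambda>M e. R i M (\<lambda>x. e (s i x)))" for i
    proof -
      have "sigma_definable L (b i) (V \<union> set (xs i)) (\<lambda>M e. \<not> R i M e)"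
        using R(2) by (simp add: sigma_definable_not_iff)
      from less.IH[OF R(1) this] less.prems(2) show ?thesis
        by (simp add: sigma_definable_not_iff)
    qed
    then have pd: "pi_definable L (b i) (r ` V \<union> set (ys i)) (\<lambda>M e. R i M (\<lambda>x. e (s i x)))" for i
      using pi_definable_vars s_img by blast
    have "(\<exists>e'. reassign M (xs i) (\<lambda>x. e (r x)) e' \<and> R i M e') \<longleftrightarrow>
        (\<exists>e'. reassign M (ys i) e e' \<and> R i M (\<lambda>x. e' (s i x)))" (is "?l = ?r") for M e i
    proof
      assume ?l
      then obtain e' where e': "reassign M (xs i) (\<lambda>x. e (r x)) e'" "R i M e'" by blast
      define d where "d y = (if y \<in> set (ys i) then e' (y - B) else e y)" for y
      have "reassign M (ys i) e d" using e'(1) by (auto simp: reassign_def d_def ys_def)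
      moreover have "R i M (\<lambda>x. d (s i x)) = R i M e'"
      proof (rule pi_definable_cong[OF R(2)])
        fix x assume x: "x \<in> V \<union> set (xs i)"
        show "(\<lambda>x. d (s i x)) x = e' x"
        proof (cases "x \<in> set (xs i)")
          case True
          then show ?thesis by (auto simp: d_def s_def ys_def)
        next
          case False
          with x B have "r x \<notin> set (ys i)" by (fastforce simp: ys_def)
          then show ?thesis using False e'(1) by (auto simp: d_def s_def reassign_def)
        qed
      qed
      ultimately show ?r using e'(2) by blast
    next
      assume ?r
      then obtain d where d: "reassign M (ys i) e d" "R i M (\<lambda>x. d (s i x))" by blast
      define e' where "e' x = (if x \<in> set (xs i) then d (B + x) else e (r x))" for x
      have "reassign M (xs i) (\<lambda>x. e (r x)) e'" using d(1) by (auto simp: reassign_def e'_def ys_def)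
      moreover have "R i M (\<lambda>x. d (s i x)) = R i M e'"
      proof (rule pi_definable_cong[OF R(2)])
        fix x assume x: "x \<in> V \<union> set (xs i)"
        show "(\<lambda>x. d (s i x)) x = e' x"
        proof (cases "x \<in> set (xs i)")
          case True
          then show ?thesis by (auto simp: e'_def s_def)
        next
          case False
          with x B have "r x \<notin> set (ys i)" by (fastforce simp: ys_def)
          then show ?thesis using False d(1) by (auto simp: e'_def s_def reassign_def)
        qed
      qed
      ultimately show ?l using d(2) by blast
    qed
    then show ?thesis
      by (intro sigma_definable_blocksI[OF pos R(1) pd]) (simp add: R(3))
  qed
qed

lemma pi_definable_rename:
  "pi_definable L a V Q \<Longrightarrow> finite V \<Longrightarrow> pi_definable L a (r ` V) (\<lambda>M e. Q M (\<lambda>x. e (r x)))"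
  using sigma_definable_rename[of L a V "\<lambda>M e. \<not> Q M e" r] by (simp add: sigma_definable_not_iff)

lemma qfree_definable:
  assumes "qfree p" "fm_wf L p" "fv p \<subseteq> V"
  shows "sigma_definable L a V (\<lambda>M e. sat M e p)" "pi_definable L a V (\<lambda>M e. sat M e p)"
proof -
  have "sigma_definable L 0 V (\<lambda>M e. sat M e p)" "pi_definable L 0 V (\<lambda>M e. sat M e p)"
    using assms by (auto intro: sigma_definableI pi_definableI Sigma_zero Pi_zero)
  then show "sigma_definable L a V (\<lambda>M e. sat M e p)" "pi_definable L a V (\<lambda>M e. sat M e p)"
    using zero_le_omega1 sigma_definable_mono pi_definable_mono by blast+
qed

text \<open>Finitary steps cost at most two levels, and countable ones use a common bound of
  countably many levels. This is what makes the minimum in \<open>qr\<close> exist.\<close>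

lemma pi_definable_fm: "fm_wf L p \<Longrightarrow> \<exists>a. pi_definable L a (fv p) (\<lambda>M e. sat M e p)"
proof (induction p)
  case (Neg p)
  from Neg.prems have "fm_wf L p" by simp
  from Neg.IH[OF this] obtain a where "pi_definable L a (fv p) (\<lambda>M e. sat M e p)" by (elim exE)
  then have "sigma_definable L a (fv p) (\<lambda>M e. \<not> sat M e p)" by (simp add: sigma_definable_not_iff)
  from pi_definable_if_sigma[OF this less_osuc] show ?case by (intro exI[of _ "osuc a"]) simp
next
  case (And p q)
  from And.prems have "fm_wf L p" "fm_wf L q" by simp_all
  from And.IH(1)[OF this(1)] And.IH(2)[OF this(2)]
  obtain a b where ab: "pi_definable L a (fv p) (\<lambda>M e. sat M e p)"
    "pi_definable L b (fv q) (\<lambda>M e. sat M e q)" by (elim exE)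
  have "pi_definable L (max a b) (fv p \<union> fv q) (\<lambda>M e. sat M e p)"
    by (rule pi_definable_vars[OF pi_definable_mono[OF ab(1)]]) simp_all
  moreover have "pi_definable L (max a b) (fv p \<union> fv q) (\<lambda>M e. sat M e q)"
    by (rule pi_definable_vars[OF pi_definable_mono[OF ab(2)]]) simp_all
  ultimately have "pi_definable L (max a b) (fv p \<union> fv q) (\<lambda>M e. sat M e p \<and> sat M e q)"
    by (rule pi_definable_and)
  then show ?case by (intro exI[of _ "max a b"]) simp
next
  case (Or p q)
  from Or.prems have "fm_wf L p" "fm_wf L q" by simp_all
  from Or.IH(1)[OF this(1)] Or.IH(2)[OF this(2)]
  obtain a b where ab: "pi_definable L a (fv p) (\<lambda>M e. sat M e p)"
    "pi_definable L b (fv q) (\<lambda>M e. sat M e q)" by (elim exE)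
  let ?c = "osuc (max a b)"
  have "sigma_definable L ?c (fv p \<union> fv q) (\<lambda>M e. sat M e p)"
    by (rule sigma_definable_vars[OF sigma_definable_if_pi[OF ab(1)]]) (simp_all add: less_osuc_iff)
  moreover have "sigma_definable L ?c (fv p \<union> fv q) (\<lambda>M e. sat M e q)"
    by (rule sigma_definable_vars[OF sigma_definable_if_pi[OF ab(2)]]) (simp_all add: less_osuc_iff)
  ultimately have "sigma_definable L ?c (fv p \<union> fv q) (\<lambda>M e. sat M e p \<or> sat M e q)"
    by (rule sigma_definable_or)
  from pi_definable_if_sigma[OF this less_osuc] show ?case by (intro exI[of _ "osuc ?c"]) simp
next
  case (Conj P)
  have "\<forall>i. \<exists>a. pi_definable L a (fv (P i)) (\<lambda>M e. sat M e (P i))"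
    using Conj.prems by (intro allI Conj.IH) auto
  then obtain a where a: "\<And>i. pi_definable L (a i) (fv (P i)) (\<lambda>M e. sat M e (P i))"
    using choice[of "\<lambda>i a. pi_definable L a (fv (P i)) (\<lambda>M e. sat M e (P i))"] by auto
  obtain b where b: "\<And>i. a i < b" using countable_bounded_omega1[of "range a"] by auto
  then have "0 < b" using zero_le_omega1 le_less_trans by blast
  moreover have "pi_definable L b (fv (Conj P)) (\<lambda>M e. sat M e (P i))" for i
    by (rule pi_definable_vars[OF pi_definable_mono[OF a less_imp_le[OF b]]]) auto
  ultimately have "pi_definable L b (fv (Conj P)) (\<lambda>M e. \<forall>i. sat M e (P i))"
    by (rule pi_definable_conj)
  then show ?case by (intro exI[of _ b]) simp
next
  case (Disj P)
  have "\<forall>i. \<exists>a. pi_definable L a (fv (P i)) (\<lambda>M e. sat M e (P i))"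
    using Disj.prems by (intro allI Disj.IH) auto
  then obtain a where a: "\<And>i. pi_definable L (a i) (fv (P i)) (\<lambda>M e. sat M e (P i))"
    using choice[of "\<lambda>i a. pi_definable L a (fv (P i)) (\<lambda>M e. sat M e (P i))"] by auto
  obtain b where b: "\<And>i. a i < b" using countable_bounded_omega1[of "range a"] by auto
  then have "0 < b" using zero_le_omega1 le_less_trans by blast
  moreover have "sigma_definable L b (fv (Disj P)) (\<lambda>M e. sat M e (P i))" for i
    by (rule sigma_definable_vars[OF sigma_definable_if_pi[OF a b]]) auto
  ultimately have "sigma_definable L b (fv (Disj P)) (\<lambda>M e. \<exists>i. sat M e (P i))"
    by (rule sigma_definable_disj)
  from pi_definable_if_sigma[OF this less_osuc] show ?case by (intro exI[of _ "osuc b"]) simp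
next
  case (Ex x p)
  from Ex.prems have "fm_wf L p" by simp
  from Ex.IH[OF this] obtain a where a: "pi_definable L a (fv p) (\<lambda>M e. sat M e p)" by (elim exE)
  have "sigma_definable L (osuc a) (fv (Ex x p) \<union> set [x]) (\<lambda>M e. sat M e p)"
    by (rule sigma_definable_vars[OF sigma_definable_if_pi[OF a less_osuc]]) auto
  from pi_definable_if_sigma[OF sigma_definable_ex_block[OF osuc_pos this] less_osuc]
  show ?case unfolding sat_foldr_Ex[symmetric] by (intro exI[of _ "osuc (osuc a)"]) simp
next
  case (All x p)
  from All.prems have "fm_wf L p" by simp
  from All.IH[OF this] obtain a where a: "pi_definable L a (fv p) (\<lambda>M e. sat M e p)" by (elim exE)
  have "pi_definable L (osuc a) (fv (All x p) \<union> set [x]) (\<lambda>M e. sat M e p)"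
    by (rule pi_definable_vars[OF pi_definable_mono[OF a less_imp_le[OF less_osuc]]]) auto
  from pi_definable_all_block[OF osuc_pos this]
  show ?case unfolding sat_foldr_All[symmetric] by (intro exI[of _ "osuc a"]) simp
qed (rule exI, rule qfree_definable(2), simp, assumption, rule order_refl)+

lemma reassign_upt:
  assumes "k \<le> m"
  shows "(\<exists>e'. reassign M [k..<m] e e' \<and> Q (map e' [0..<m])) \<longleftrightarrow>
     (\<exists>ws. length ws = m - k \<and> set ws \<subseteq> univ M \<and> Q (map e [0..<k] @ ws))" (is "?l = ?r")
proof
  assume ?l
  then obtain e' where e': "reassign M [k..<m] e e'" "Q (map e' [0..<m])" by blast
  have "map e' [0..<m] = map e [0..<k] @ map e' [k..<m]"
    using e'(1) assms
    by (intro nth_equalityI) (auto simp: reassign_def nth_append)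
  with e' show ?r by (intro exI[of _ "map e' [k..<m]"]) (auto simp: reassign_def)
next
  assume ?r
  then obtain ws where ws: "length ws = m - k" "set ws \<subseteq> univ M" "Q (map e [0..<k] @ ws)" by blast
  define e' where "e' i = (if i \<in> set [k..<m] then ws ! (i - k) else e i)" for i
  have "map e' [0..<m] = map e [0..<k] @ ws"
    using assms ws(1) by (intro nth_equalityI) (auto simp: e'_def nth_append)
  moreover have "reassign M [k..<m] e e'"
    using ws(1,2) by (auto simp: reassign_def e'_def subset_iff)
  ultimately show ?l using ws(3) by auto
qed

text \<open>Tuples are lists: the variable \<open>i\<close> stands for the entry at position \<open>i\<close>.\<close>

lemma sigma_definable_ex_tuple:
  assumes "0 < a" "sigma_definable L a {..<m} Q" "k \<le> m"
  shows "sigma_definable L a {..<k} (\<lambda>M e. \<exists>ws. length ws = m - k \<and> set ws \<subseteq> univ M \<and>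
      Q M ((!) (map e [0..<k] @ ws)))"
proof -
  have "sigma_definable L a ({..<k} \<union> set [k..<m]) Q"
    using assms(3) by (intro sigma_definable_vars[OF assms(2)]) auto
  from sigma_definable_ex_block[OF assms(1) this]
  have "sigma_definable L a {..<k} (\<lambda>M e. \<exists>e'. reassign M [k..<m] e e' \<and> Q M e')" .
  \<comment> \<open>The first \<open>m\<close> values determine \<open>Q\<close>, so the unspecified
    values of a list beyond its end do no harm.\<close>
  moreover have eq: "Q M e' = Q M ((!) (map e' [0..<m]))" for M e'
    by (rule sigma_definable_cong[OF assms(2)]) auto
  have "(\<exists>e'. reassign M [k..<m] e e' \<and> Q M e') \<longleftrightarrow>
      (\<exists>ws. length ws = m - k \<and> set ws \<subseteq> univ M \<and> Q M ((!) (map e [0..<k] @ ws)))" for M e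
    unfolding reassign_upt[OF assms(3), of M e "\<lambda>bs. Q M ((!) bs)", symmetric]
    by (intro ex_cong1 conj_cong refl eq)
  ultimately show ?thesis by simp
qed

lemma pi_definable_all_tuple:
  assumes "0 < a" "pi_definable L a {..<m} Q"
  shows "pi_definable L a {} (\<lambda>M e. \<forall>ws. length ws = m \<and> set ws \<subseteq> univ M \<longrightarrow> Q M ((!) ws))"
proof -
  have "sigma_definable L a {..<m} (\<lambda>M e. \<not> Q M e)"
    using assms(2) by (simp add: sigma_definable_not_iff)
  from sigma_definable_ex_tuple[OF assms(1) this le0]
  have "sigma_definable L a {} (\<lambda>M e. \<not> (\<forall>ws. length ws = m \<and> set ws \<subseteq> univ M \<longrightarrow> Q M ((!) ws)))"
    by simp
  then show ?thesis unfolding sigma_definable_not_iff .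
qed

lemma sentence_iff_models: "sentence L S \<Longrightarrow> models M S \<longleftrightarrow> sat M e S"
  unfolding sentence_def models_def using sat_cong[of S] by auto

lemma pi_definable_sentence:
  assumes "pi_definable L a {} Q"
  obtains S where "sentence L S" "Pi_in a S" "\<And>M e. models M S \<longleftrightarrow> Q M e"
proof -
  obtain p where p: "Pi_in a p" "fm_wf L p" "fv p \<subseteq> {}" "\<And>M e. sat M e p \<longleftrightarrow> Q M e"
    using assms unfolding pi_definable_def by blast
  then have "sentence L p" by (simp add: sentence_def)
  with that p sentence_iff_models show thesis by metis
qed

lemma sentence_pi_definable:
  assumes "sentence L S" "Pi_in a S"
  shows "pi_definable L a {} (\<lambda>M e. models M S)"
  using pi_definableI[of a S L "{}"] assms sentence_iff_models[OF assms(1)]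
  by (simp add: sentence_def)

section \<open>Isomorphisms\<close>

text \<open>The map is a parameter, because automorphisms that move one given tuple to another are
  needed later.\<close>

definition iso_map :: "vocab \<Rightarrow> (nat \<Rightarrow> nat) \<Rightarrow> struct \<Rightarrow> struct \<Rightarrow> bool" where
  "iso_map L h M N \<longleftrightarrow> bij_betw h (univ M) (univ N) \<and>
        (\<forall>i as. (i, length as) \<in> rels L \<and> set as \<subseteq> univ M \<longrightarrow>
           rel_interp N i (map h as) = rel_interp M i as) \<and>
        (\<forall>i as. (i, length as) \<in> funs L \<and> set as \<subseteq> univ M \<longrightarrow>
           fun_interp N i (map h as) = h (fun_interp M i as))"

lemma isomorphic_iff:
  "isomorphic L M N \<longleftrightarrow> is_structure L M \<and> is_structure L N \<and> (\<exists>h. iso_map L h M N)"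
  by (simp add: isomorphic_def iso_map_def)

section \<open>Isomorphisms preserve truth\<close>

lemma iso_map_tm_val:
  assumes "is_structure L M" "iso_map L h M N" "\<And>x. e x \<in> univ M"
  shows "tm_wf L t \<Longrightarrow> tm_val M e t \<in> univ M \<and> tm_val N (\<lambda>x. h (e x)) t = h (tm_val M e t)"
proof (induction t)
  case (App i ts)
  from App.prems have wf: "(i, length ts) \<in> funs L" "\<And>t. t \<in> set ts \<Longrightarrow> tm_wf L t"
    by (auto simp: list_all_iff)
  with App.IH have IH: "\<And>t. t \<in> set ts \<Longrightarrow> tm_val M e t \<in> univ M"
     "\<And>t. t \<in> set ts \<Longrightarrow> tm_val N (\<lambda>x. h (e x)) t = h (tm_val M e t)" by blast+
  then have "map (tm_val N (\<lambda>x. h (e x))) ts = map h (map (tm_val M e) ts)" by simp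
  moreover have "set (map (tm_val M e) ts) \<subseteq> univ M" using IH(1) by auto
  moreover have "(i, length (map (tm_val M e) ts)) \<in> funs L" using wf(1) by simp
  ultimately show ?case
    using assms(1,2) unfolding is_structure_def iso_map_def tm_val.simps by metis
qed (use assms(3) in simp)

lemma iso_map_sat:
  assumes "is_structure L M" "iso_map L h M N"
  shows "fm_wf L p \<Longrightarrow> (\<And>x. e x \<in> univ M) \<Longrightarrow> sat N (\<lambda>x. h (e x)) p = sat M e p"
proof (induction p arbitrary: e)
  case (Eq s t)
  have "inj_on h (univ M)" using assms(2) by (auto simp: iso_map_def bij_betw_def)
  moreover have "tm_val M e s \<in> univ M \<and> tm_val N (\<lambda>x. h (e x)) s = h (tm_val M e s)"
    "tm_val M e t \<in> univ M \<and> tm_val N (\<lambda>x. h (e x)) t = h (tm_val M e t)"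
    using Eq.prems(1) by (auto intro!: iso_map_tm_val[of L M h N e, OF assms Eq.prems(2)])
  ultimately show ?case by (auto dest: inj_onD)
next
  case (Rel i ts)
  from Rel.prems(1) have wf: "(i, length ts) \<in> rels L" "\<And>t. t \<in> set ts \<Longrightarrow> tm_wf L t"
    by (auto simp: list_all_iff)
  have IH: "\<And>t. t \<in> set ts \<Longrightarrow> tm_val M e t \<in> univ M"
     "\<And>t. t \<in> set ts \<Longrightarrow> tm_val N (\<lambda>x. h (e x)) t = h (tm_val M e t)"
    using iso_map_tm_val[of L M h N e, OF assms Rel.prems(2)] wf(2) by blast+
  then have "map (tm_val N (\<lambda>x. h (e x))) ts = map h (map (tm_val M e) ts)" by simp
  moreover have "set (map (tm_val M e) ts) \<subseteq> univ M" using IH(1) by auto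
  moreover have "(i, length (map (tm_val M e) ts)) \<in> rels L" using wf(1) by simp
  ultimately show ?case using assms(2) unfolding iso_map_def sat.simps by metis
next
  case (Neg p)
  from Neg.IH[of e] Neg.prems show ?case by simp
next
  case (And p q)
  from And.IH(1)[of e] And.IH(2)[of e] And.prems show ?case by simp
next
  case (Or p q)
  from Or.IH(1)[of e] Or.IH(2)[of e] Or.prems show ?case by simp
next
  case (Conj P)
  have "sat N (\<lambda>x. h (e x)) (P i) = sat M e (P i)" for i
    by (rule Conj.IH) (use Conj.prems in auto)
  then show ?case by simp
next
  case (Disj P)
  have "sat N (\<lambda>x. h (e x)) (P i) = sat M e (P i)" for i
    by (rule Disj.IH) (use Disj.prems in auto)
  then show ?case by simp
next
  case (Ex x p)
  have "sat N ((\<lambda>y. h (e y))(x := h a)) p = sat M (e(x := a)) p" if "a \<in> univ M" for a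
  proof -
    have "(\<lambda>y. h ((e(x := a)) y)) = (\<lambda>y. h (e y))(x := h a)" by auto
    moreover have "sat N (\<lambda>y. h ((e(x := a)) y)) p = sat M (e(x := a)) p"
      by (rule Ex.IH) (use Ex.prems that in auto)
    ultimately show ?thesis by (simp only:)
  qed
  moreover have img: "univ N = h ` univ M" using assms(2) by (simp add: iso_map_def bij_betw_def)
  ultimately show ?case unfolding sat.simps img by simp
next
  case (All x p)
  have "sat N ((\<lambda>y. h (e y))(x := h a)) p = sat M (e(x := a)) p" if "a \<in> univ M" for a
  proof -
    have "(\<lambda>y. h ((e(x := a)) y)) = (\<lambda>y. h (e y))(x := h a)" by auto
    moreover have "sat N (\<lambda>y. h ((e(x := a)) y)) p = sat M (e(x := a)) p"
      by (rule All.IH) (use All.prems that in auto)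
    ultimately show ?thesis by (simp only:)
  qed
  moreover have img: "univ N = h ` univ M" using assms(2) by (simp add: iso_map_def bij_betw_def)
  ultimately show ?case unfolding sat.simps img by simp
qed auto

lemma isomorphic_refl: "is_structure L M \<Longrightarrow> isomorphic L M M"
  unfolding isomorphic_iff iso_map_def by (auto intro!: exI[of _ id])

lemma isomorphic_sym:
  assumes "isomorphic L M N"
  shows "isomorphic L N M"
proof -
  from assms obtain h where h: "is_structure L M" "is_structure L N" "bij_betw h (univ M) (univ N)"
     "\<And>i as. (i, length as) \<in> rels L \<Longrightarrow> set as \<subseteq> univ M \<Longrightarrow>
        rel_interp N i (map h as) = rel_interp M i as"
     "\<And>i as. (i, length as) \<in> funs L \<Longrightarrow> set as \<subseteq> univ M \<Longrightarrow>
        fun_interp N i (map h as) = h (fun_interp M i as)"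
    unfolding isomorphic_iff iso_map_def by blast
  let ?g = "inv_into (univ M) h"
  have g: "bij_betw ?g (univ N) (univ M)" using h(3) by (rule bij_betw_inv_into)
  have img: "set (map ?g as) \<subseteq> univ M" and hg: "map h (map ?g as) = as" if "set as \<subseteq> univ N" for as
  proof -
    show "set (map ?g as) \<subseteq> univ M" using that g by (auto simp: bij_betw_def)
    have "map (h \<circ> ?g) as = map id as"
      using that bij_betw_inv_into_right[OF h(3)] by (intro map_cong) auto
    then show "map h (map ?g as) = as" by simp
  qed
  have "rel_interp M i (map ?g as) = rel_interp N i as"
    if "(i, length as) \<in> rels L" "set as \<subseteq> univ N" for i as
    using h(4)[of i "map ?g as"] img[OF that(2)] hg[OF that(2)] that(1) by simp
  moreover have "fun_interp M i (map ?g as) = ?g (fun_interp N i as)"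
    if "(i, length as) \<in> funs L" "set as \<subseteq> univ N" for i as
  proof -
    have "fun_interp N i as = h (fun_interp M i (map ?g as))"
      using h(5)[of i "map ?g as"] img[OF that(2)] hg[OF that(2)] that(1) by simp
    moreover have "fun_interp M i (map ?g as) \<in> univ M"
      using h(1) img[OF that(2)] that(1) unfolding is_structure_def by (metis length_map)
    ultimately show ?thesis using bij_betw_inv_into_left[OF h(3)] by simp
  qed
  ultimately show ?thesis using h(1,2) g unfolding isomorphic_iff iso_map_def by blast
qed

lemma isomorphic_trans:
  assumes "isomorphic L M N" "isomorphic L N K"
  shows "isomorphic L M K"
proof -
  from assms obtain g h where st: "is_structure L M" "is_structure L N" "is_structure L K"
    and g: "iso_map L g M N" and h: "iso_map L h N K"
    unfolding isomorphic_iff by blast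
  have "set (map g as) \<subseteq> univ N" if "set as \<subseteq> univ M" for as
    using that g by (auto simp: iso_map_def bij_betw_def)
  then have "iso_map L (h \<circ> g) M K"
    using g h st unfolding iso_map_def is_structure_def
    by (auto intro: bij_betw_trans simp flip: map_map)
  then show ?thesis using st unfolding isomorphic_iff by blast
qed

lemma isomorphic_structure: "isomorphic L M N \<Longrightarrow> is_structure L M \<and> is_structure L N"
  by (simp add: isomorphic_def)

lemma isomorphic_models:
  assumes "isomorphic L M N" "sentence L S"
  shows "models M S \<longleftrightarrow> models N S"
proof -
  from assms(1) obtain h where h: "is_structure L M" "is_structure L N" "iso_map L h M N"
    unfolding isomorphic_iff by blast
  obtain a where "a \<in> univ M" using h(1) unfolding is_structure_def by blast
  then have "sat N (\<lambda>x. h a) S = sat M (\<lambda>x. a) S"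
    using iso_map_sat[OF h(1,3), of S "\<lambda>_. a"] assms(2) by (simp add: sentence_def)
  then show ?thesis using sentence_iff_models[OF assms(2)] by metis
qed

lemma Mod_isomorphic:
  "isomorphic L M N \<Longrightarrow> sentence L S \<Longrightarrow> M \<in> Mod L S \<longleftrightarrow> N \<in> Mod L S"
  using isomorphic_models isomorphic_structure unfolding Mod_def by blast

text \<open>Two enumerations, possibly with repetitions, define the map from \<open>x i\<close> to
  \<open>y i\<close>; the equality pattern makes it well defined and injective. One implication is
  enough for functions, since every value in \<open>M\<close> is some \<open>x j\<close>. Both the
  back-and-forth argument and the infinite paths of the tree of attempts end here.\<close>

lemma iso_map_from_sequences:
  fixes x y :: "nat \<Rightarrow> nat"
  assumes "is_structure L M" "range x = univ M" "range y = univ N"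
    and eq: "\<And>i j. x i = x j \<longleftrightarrow> y i = y j"
    and rel: "\<And>i js. (i, length js) \<in> rels L \<Longrightarrow>
      rel_interp N i (map y js) = rel_interp M i (map x js)"
    and func: "\<And>i js j. (i, length js) \<in> funs L \<Longrightarrow>
      fun_interp M i (map x js) = x j \<Longrightarrow> fun_interp N i (map y js) = y j"
  shows "\<exists>h. iso_map L h M N \<and> (\<forall>i. h (x i) = y i)"
proof -
  define h where "h v = y (inv x v)" for v
  have hx: "h (x i) = y i" for i
    unfolding h_def using eq[of "inv x (x i)" i] by (simp add: f_inv_into_f)
  have "bij_betw h (univ M) (univ N)"
    unfolding bij_betw_def assms(2,3)[symmetric] using eq by (auto simp: inj_on_def hx image_image)
  moreover have *: "\<exists>js. as = map x js" if "set as \<subseteq> univ M" for as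
    using that assms(2) by (intro exI[of _ "map (inv x) as"] nth_equalityI)
      (auto simp: f_inv_into_f subset_iff)
  moreover have hmap: "map h (map x js) = map y js" for js by (simp add: hx)
  moreover have "rel_interp N i (map h as) = rel_interp M i as"
    if "(i, length as) \<in> rels L" "set as \<subseteq> univ M" for i as
  proof -
    from *[OF that(2)] obtain js where js: "as = map x js" by blast
    then show ?thesis using rel[of i js] that(1) unfolding js hmap by simp
  qed
  moreover have "fun_interp N i (map h as) = h (fun_interp M i as)"
    if "(i, length as) \<in> funs L" "set as \<subseteq> univ M" for i as
  proof -
    from *[OF that(2)] obtain js where js: "as = map x js" by blast
    have "fun_interp M i as \<in> univ M" using assms(1) that unfolding is_structure_def by blast
    then obtain j where j: "fun_interp M i as = x j" using assms(2) by auto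
    then have "fun_interp N i (map y js) = y j" using func that(1) js by simp
    then show ?thesis using j unfolding js hmap by (simp add: hx)
  qed
  ultimately show ?thesis using hx unfolding iso_map_def by blast
qed

text \<open>Unnested atomic formulas: agreement on equality, relations and graphs of functions
  already extends to an isomorphism. The bound \<open>n\<close> matches them with tuples of length
  \<open>n\<close>.\<close>

inductive_set atoms :: "vocab \<Rightarrow> nat \<Rightarrow> fm set" for L n where
  "i < n \<Longrightarrow> j < n \<Longrightarrow> Eq (Var i) (Var j) \<in> atoms L n"
| "(i, length js) \<in> rels L \<Longrightarrow> set js \<subseteq> {..<n} \<Longrightarrow> Rel i (map Var js) \<in> atoms L n"
| "(i, length js) \<in> funs L \<Longrightarrow> set js \<subseteq> {..<n} \<Longrightarrow> j < n \<Longrightarrow>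
     Eq (App i (map Var js)) (Var j) \<in> atoms L n"

lemma atoms_props: "A \<in> atoms L n \<Longrightarrow> qfree A \<and> fm_wf L A \<and> fv A \<subseteq> {..<n}"
  by (induction rule: atoms.induct) (auto simp: list_all_iff)

lemma countable_atoms: "countable (atoms L n)"
proof -
  have "atoms L n \<subseteq> (\<lambda>(i, j). Eq (Var i) (Var j)) ` UNIV \<union> (\<lambda>(i, js). Rel i (map Var js)) ` UNIV \<union>
      (\<lambda>(i, js, j). Eq (App i (map Var js)) (Var j)) ` UNIV"
    by (auto simp: image_iff elim!: atoms.cases)
  then show ?thesis by (rule countable_subset) simp
qed

lemma atoms_agree_iso:
  fixes x y :: "nat \<Rightarrow> nat"
  assumes "is_structure L M" "range x = univ M" "range y = univ N"
    and agree: "\<And>n A. A \<in> atoms L n \<Longrightarrow> sat N ((!) (map y [0..<n])) A = sat M ((!) (map x [0..<n])) A"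
  shows "\<exists>h. iso_map L h M N \<and> (\<forall>i. h (x i) = y i)"
proof (rule iso_map_from_sequences[OF assms(1-3)])
  have agree': "sat N y A = sat M x A" if "A \<in> atoms L n" for A n
  proof -
    have "sat N y A = sat N ((!) (map y [0..<n])) A" "sat M x A = sat M ((!) (map x [0..<n])) A"
      using atoms_props[OF that] by (auto intro!: sat_cong)
    with agree[OF that] show ?thesis by simp
  qed
  show "x i = x j \<longleftrightarrow> y i = y j" for i j
    using agree'[OF atoms.intros(1)[of i "Suc (max i j)" j L]] by (simp add: less_Suc_eq_le)
  have bd: "set js \<subseteq> {..<Suc (Max (set (j # js)))} \<and> j < Suc (Max (set (j # js)))" for js and j :: nat
    by (auto simp: less_Suc_eq_le)
  have mapV: "map (tm_val K e) (map Var js) = map e js" for K e js by simp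
  show "rel_interp N i (map y js) = rel_interp M i (map x js)" if "(i, length js) \<in> rels L" for i js
    using agree'[OF atoms.intros(2)[OF that bd[of js 0, THEN conjunct1]]] unfolding sat.simps mapV .
  show "fun_interp N i (map y js) = y j"
    if "(i, length js) \<in> funs L" "fun_interp M i (map x js) = x j" for i js j
    using agree'[OF atoms.intros(3)[OF that(1) bd[of js j, THEN conjunct1] bd[of js j, THEN conjunct2]]]
      that(2) unfolding sat.simps tm_val.simps mapV by simp
qed

lemma back_and_forth_isomorphic:
  fixes R :: "nat list \<Rightarrow> nat list \<Rightarrow> bool"
  assumes M: "is_structure L M" and N: "is_structure L N" and "R [] []"
    and forw: "\<And>as bs a. R as bs \<Longrightarrow> a \<in> univ M \<Longrightarrow> \<exists>b\<in>univ N. R (as @ [a]) (bs @ [b])"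
    and backw: "\<And>as bs b. R as bs \<Longrightarrow> b \<in> univ N \<Longrightarrow> \<exists>a\<in>univ M. R (as @ [a]) (bs @ [b])"
    and agree: "\<And>as bs A. R as bs \<Longrightarrow> length as = length bs \<Longrightarrow> A \<in> atoms L (length as) \<Longrightarrow>
      sat N ((!) bs) A = sat M ((!) as) A"
  shows "isomorphic L M N"
proof -
  have ne: "univ M \<noteq> {}" "univ N \<noteq> {}" using M N by (auto simp: is_structure_def)
  let ?u = "from_nat_into (univ M)" and ?v = "from_nat_into (univ N)"
  \<comment> \<open>Even stages treat the next element of \<open>M\<close>, odd stages the next
    element of \<open>N\<close>; \<open>from_nat_into\<close> repeats elements when the universe is
    finite.\<close>
  define good where "good n as bs a b \<longleftrightarrow> a \<in> univ M \<and> b \<in> univ N \<and> R (as @ [a]) (bs @ [b]) \<and>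
      (if even n then a = ?u (n div 2) else b = ?v (n div 2))" for n :: nat and as bs a b
  have ex: "\<exists>ab. good n as bs (fst ab) (snd ab)" if "R as bs" for n as bs
  proof (cases "even n")
    case True
    from forw[OF that from_nat_into[OF ne(1)], of "n div 2"] True from_nat_into[OF ne(1), of "n div 2"]
    show ?thesis by (auto simp: good_def)
  next
    case False
    from backw[OF that from_nat_into[OF ne(2)], of "n div 2"] False from_nat_into[OF ne(2), of "n div 2"]
    show ?thesis by (auto simp: good_def)
  qed
  define st where "st = rec_nat ([], []) (\<lambda>n (as, bs).
     case SOME ab. good n as bs (fst ab) (snd ab) of (a, b) \<Rightarrow> (as @ [a], bs @ [b]))"
  have st0: "st 0 = ([], [])" by (simp add: st_def)
  have stS: "\<exists>a b. st (Suc n) = (fst (st n) @ [a], snd (st n) @ [b]) \<and> good n (fst (st n)) (snd (st n)) a b"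
    if "R (fst (st n)) (snd (st n))" for n
  proof -
    obtain a b where ab: "(SOME ab. good n (fst (st n)) (snd (st n)) (fst ab) (snd ab)) = (a, b)"
      by (cases "SOME ab. good n (fst (st n)) (snd (st n)) (fst ab) (snd ab)")
    from someI_ex[OF ex[OF that, of n]] have "good n (fst (st n)) (snd (st n)) a b"
      unfolding ab by simp
    moreover have "st (Suc n) = (fst (st n) @ [a], snd (st n) @ [b])"
    proof -
      have "st (Suc n) = (case st n of (as, bs) \<Rightarrow>
          case SOME ab. good n as bs (fst ab) (snd ab) of (a, b) \<Rightarrow> (as @ [a], bs @ [b]))"
        by (simp add: st_def)
      then show ?thesis unfolding case_prod_beta ab by simp
    qed
    ultimately show ?thesis by blast
  qed
  have R: "R (fst (st n)) (snd (st n))" for n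
  proof (induction n)
    case (Suc n)
    from stS[OF this] show ?case by (auto simp: good_def)
  qed (simp add: st0 assms(3))
  from stS[OF R] have "\<forall>n. \<exists>ab. st (Suc n) = (fst (st n) @ [fst ab], snd (st n) @ [snd ab]) \<and>
      good n (fst (st n)) (snd (st n)) (fst ab) (snd ab)" by simp
  then obtain f where f: "\<And>n. st (Suc n) = (fst (st n) @ [fst (f n)], snd (st n) @ [snd (f n)])"
     "\<And>n. good n (fst (st n)) (snd (st n)) (fst (f n)) (snd (f n))" by metis
  define x where "x n = fst (f n)" for n
  define y where "y n = snd (f n)" for n
  have st: "st n = (map x [0..<n], map y [0..<n])" for n
    by (induction n) (auto simp: st0 f(1) x_def y_def)
  have good: "good n (map x [0..<n]) (map y [0..<n]) (x n) (y n)" for n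
    using f(2)[of n] unfolding st x_def y_def by simp
  have "range x = univ M"
  proof
    show "univ M \<subseteq> range x"
    proof
      fix a assume "a \<in> univ M"
      then obtain i where "a = ?u i" using from_nat_into_surj[of "univ M" a] by auto
      then have "a = x (2 * i)" using good[of "2 * i"] by (simp add: good_def)
      then show "a \<in> range x" by blast
    qed
  qed (use good in \<open>auto simp: good_def\<close>)
  moreover have "range y = univ N"
  proof
    show "univ N \<subseteq> range y"
    proof
      fix a assume "a \<in> univ N"
      then obtain i where "a = ?v i" using from_nat_into_surj[of "univ N" a] by auto
      then have "a = y (2 * i + 1)" using good[of "2 * i + 1"] by (simp add: good_def)
      then show "a \<in> range y" by blast
    qed
  qed (use good in \<open>auto simp: good_def\<close>)
  moreover have "sat N ((!) (map y [0..<n])) A = sat M ((!) (map x [0..<n])) A"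
    if "A \<in> atoms L n" for n A
    using agree[of "map x [0..<n]" "map y [0..<n]" A] R[of n] that by (simp add: st)
  ultimately have "\<exists>h. iso_map L h M N \<and> (\<forall>i. h (x i) = y i)"
    by (rule atoms_agree_iso[OF M])
  then show ?thesis using M N unfolding isomorphic_iff by blast
qed


section \<open>Scott sentences\<close>

lemma definable_True: "sigma_definable L a V (\<lambda>M e. True)" "pi_definable L a V (\<lambda>M e. True)"
  using qfree_definable[of "Neg Bot" L V a] by simp_all

text \<open>Conjunctions of the hierarchy are indexed by all natural numbers, so the empty index set
  is treated apart.\<close>

lemma pi_definable_Ball:
  assumes "0 < a" "countable I" "\<And>i. i \<in> I \<Longrightarrow> pi_definable L a V (Q i)"
  shows "pi_definable L a V (\<lambda>M e. \<forall>i\<in>I. Q i M e)"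
proof (cases "I = {}")
  case True
  then show ?thesis using definable_True by simp
next
  case False
  have "pi_definable L a V (\<lambda>M e. \<forall>n. Q (from_nat_into I n) M e)"
    using assms(3) from_nat_into[OF False] by (intro pi_definable_conj assms(1)) blast
  moreover have "(\<lambda>M e. \<forall>n. Q (from_nat_into I n) M e) = (\<lambda>M e. \<forall>i\<in>I. Q i M e)"
    using range_from_nat_into[OF False assms(2)] by (intro ext) (metis rangeE rangeI)
  ultimately show ?thesis by simp
qed

lemma sigma_definable_Bex:
  assumes "0 < a" "countable I" "\<And>i. i \<in> I \<Longrightarrow> sigma_definable L a V (Q i)"
  shows "sigma_definable L a V (\<lambda>M e. \<exists>i\<in>I. Q i M e)"
proof -
  have "pi_definable L a V (\<lambda>M e. \<forall>i\<in>I. \<not> Q i M e)"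
    using assms(3) by (intro pi_definable_Ball[OF assms(1,2)]) (simp add: pi_definable_not_iff)
  then have "pi_definable L a V (\<lambda>M e. \<not> (\<exists>i\<in>I. Q i M e))" by simp
  then show ?thesis unfolding pi_definable_not_iff .
qed

lemma Sigma_type_transfer:
  assumes "Sigma_type L b N cs \<subseteq> Sigma_type L b M as" "length cs = length as"
    "sigma_definable L b {..<length as} P" "P N ((!) cs)"
  shows "P M ((!) as)"
proof -
  obtain p where p: "Sigma_in b p" "fm_wf L p" "fv p \<subseteq> {..<length as}" "\<And>M e. sat M e p \<longleftrightarrow> P M e"
    using assms(3) unfolding sigma_definable_def by (elim exE conjE) simp
  then have "p \<in> Sigma_type L b N cs" using assms(2,4) by (simp add: Sigma_type_def)
  with assms(1) have "p \<in> Sigma_type L b M as" by blast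
  then show ?thesis using p(4) by (simp add: Sigma_type_def)
qed

text \<open>The \<open>\<Sigma>\<^sub>b\<close> formula \<open>\<exists>ws. Q\<close> holds of the tuple and, in the structures of \<open>K\<close>, implies its
  \<open>\<Pi>\<^sub>b\<close> type; equivalently, it bounds the \<open>\<Sigma>\<^sub>b\<close> type from above.\<close>

definition supports ::
    "vocab \<Rightarrow> omega1 \<Rightarrow> struct set \<Rightarrow> struct \<Rightarrow> nat list \<Rightarrow> nat list \<Rightarrow>
      (struct \<Rightarrow> (nat \<Rightarrow> nat) \<Rightarrow> bool) \<Rightarrow> bool" where
  "supports L b K M as ws Q \<longleftrightarrow> (\<exists>c<b. pi_definable L c {..<length (as @ ws)} Q) \<and>
     set ws \<subseteq> univ M \<and> Q M ((!) (as @ ws)) \<and>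
     (\<forall>N\<in>K. \<forall>cs ds. length cs = length as \<longrightarrow> length ds = length ws \<longrightarrow> set (cs @ ds) \<subseteq> univ N \<longrightarrow>
        Q N ((!) (cs @ ds)) \<longrightarrow> Sigma_type L b N cs \<subseteq> Sigma_type L b M as)"

definition atomic_model :: "vocab \<Rightarrow> omega1 \<Rightarrow> struct set \<Rightarrow> struct \<Rightarrow> bool" where
  "atomic_model L b K M \<longleftrightarrow> (\<forall>as. set as \<subseteq> univ M \<longrightarrow> (\<exists>ws Q. supports L b K M as ws Q))"

lemma atomic_model_subset: "atomic_model L b K M \<Longrightarrow> K' \<subseteq> K \<Longrightarrow> atomic_model L b K' M"
  unfolding atomic_model_def supports_def by fast

text \<open>Within \<open>M\<close> the supporting formula of a tuple determines its Sigma_b type,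
  so satisfying the same supporting formula is a back-and-forth relation. The sentence states the
  back-and-forth property for all tuples. It quantifies over the witnesses together with the tuple:
  then the premise is the Pi_c matrix \<open>Q\<close>, c < b, its negation is Sigma_b like the
  conclusion, and the universal closure is Pi_(b+1).\<close>

lemma atomic_model_Scott_sentence:
  assumes b: "0 < b" and M: "is_structure L M" and at: "atomic_model L b {M} M"
  shows "\<exists>S. Scott_sentence L M S \<and> Pi_in (osuc b) S"
proof -
  obtain W Q where WQ: "\<And>as. set as \<subseteq> univ M \<Longrightarrow> supports L b {M} M as (W as) (Q as)"
    using at unfolding atomic_model_def by metis
  define \<phi> where "\<phi> as N e \<longleftrightarrow> (\<exists>ws. length ws = length (W as) \<and> set ws \<subseteq> univ N \<and>
      Q as N ((!) (map e [0..<length as] @ ws)))" for as N and e :: "nat \<Rightarrow> nat"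
  have \<phi>_list: "\<phi> as N ((!) cs) \<longleftrightarrow> (\<exists>ws. length ws = length (W as) \<and> set ws \<subseteq> univ N \<and>
      Q as N ((!) (cs @ ws)))" if "length cs = length as" for as cs N
    using that map_nth[of cs] by (simp add: \<phi>_def)
  have defQ: "sigma_definable L b {..<length as + length (W as)} (Q as)"
     "sigma_definable L b {..<length as + length (W as)} (\<lambda>N e. \<not> Q as N e)"
    if as: "set as \<subseteq> univ M" for as
  proof -
    obtain c where "c < b" "pi_definable L c {..<length as + length (W as)} (Q as)"
      using WQ[OF as] by (auto simp: supports_def)
    then show "sigma_definable L b {..<length as + length (W as)} (Q as)"
       "sigma_definable L b {..<length as + length (W as)} (\<lambda>N e. \<not> Q as N e)"
      by (auto simp: sigma_definable_not_iff intro: sigma_definable_if_pi pi_definable_mono)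
  qed
  have def\<phi>: "sigma_definable L b {..<length as} (\<phi> as)" if "set as \<subseteq> univ M" for as
    using sigma_definable_ex_tuple[OF b defQ(1)[OF that], of "length as"]
    unfolding \<phi>_def by simp
  have self: "\<phi> as M ((!) as)" if "set as \<subseteq> univ M" for as
    using WQ[OF that] by (auto simp: \<phi>_list supports_def)
  have sub: "Sigma_type L b M cs \<subseteq> Sigma_type L b M as"
    if "set as \<subseteq> univ M" "set cs \<subseteq> univ M" "length cs = length as" "\<phi> as M ((!) cs)" for as cs
  proof -
    have *: "\<forall>ds. length ds = length (W as) \<longrightarrow> set (cs @ ds) \<subseteq> univ M \<longrightarrow> Q as M ((!) (cs @ ds)) \<longrightarrow>
        Sigma_type L b M cs \<subseteq> Sigma_type L b M as"
      using WQ[OF that(1)] that(3) unfolding supports_def by blast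
    from that(4)[unfolded \<phi>_list[OF that(3)]]
    obtain ws where "length ws = length (W as)" "set ws \<subseteq> univ M" "Q as M ((!) (cs @ ws))" by blast
    with *[rule_format, of ws] that(2) show ?thesis by simp
  qed
  \<comment> \<open>The inclusion is symmetric: \<open>cs\<close> satisfies its own supporting
    formula, which is Sigma_b, so by \<open>sub\<close> the tuple \<open>as\<close> does too, and
    \<open>sub\<close> applies with the roles exchanged.\<close>
  have sup: "Sigma_type L b M as \<subseteq> Sigma_type L b M cs"
    if "set as \<subseteq> univ M" "set cs \<subseteq> univ M" "length cs = length as" "\<phi> as M ((!) cs)" for as cs
  proof -
    have "\<phi> cs M ((!) as)"
      using Sigma_type_transfer[OF sub[OF that] that(3), of "\<phi> cs"] def\<phi>[OF that(2)] self[OF that(2)] that(3)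
      by simp
    with sub[of cs as] that show ?thesis by simp
  qed
  define ext where "ext as P N e \<longleftrightarrow> (\<exists>y\<in>univ N. P N ((!) (map e [0..<length as] @ [y])))"
    for as :: "nat list" and P :: "struct \<Rightarrow> (nat \<Rightarrow> nat) \<Rightarrow> bool" and N and e :: "nat \<Rightarrow> nat"
  have ext_list: "ext as P N ((!) cs) \<longleftrightarrow> (\<exists>y\<in>univ N. P N ((!) (cs @ [y])))"
    if "length cs = length as" for as P N cs
    using that map_nth[of cs] by (simp add: ext_def)
  have def_ext: "sigma_definable L b {..<length as} (ext as P)"
    if "sigma_definable L b {..<Suc (length as)} P" for as P
  proof -
    have "(\<exists>ws. length ws = Suc (length as) - length as \<and> set ws \<subseteq> univ N \<and>
        P N ((!) (map e [0..<length as] @ ws))) \<longleftrightarrow> ext as P N e" for N e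
      unfolding ext_def by (auto simp: length_Suc_conv)
    then show ?thesis
      using sigma_definable_ex_tuple[OF b that, of "length as"] by simp
  qed
  define T where "T = {as. set as \<subseteq> univ M}"
  have cT: "countable T" by simp
  define m where "m as = length as + length (W as)" for as
  \<comment> \<open>Clauses for atomic facts, for an element added in \<open>M\<close>, and for an
    element added in \<open>N\<close>.\<close>
  define S1 where "S1 as A N e \<longleftrightarrow> \<not> Q as N e \<or> sat N e A = sat M ((!) as) A"
    for as A N e
  define S2 where "S2 as a N e \<longleftrightarrow> \<not> Q as N e \<or> ext as (\<phi> (as @ [a])) N e" for as a N e
  \<comment> \<open>The new element stands after the witnesses, at position \<open>m as\<close>,
    whereas the supporting formula of the longer tuple reads it at position
    \<open>length as\<close>; hence the renaming.\<close>
  define S3 where "S3 as N e \<longleftrightarrow> \<not> Q as N e \<or> (\<exists>a\<in>univ M. \<phi> (as @ [a]) N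
      (\<lambda>x. e (if x = length as then m as else x)))" for as N and e :: "nat \<Rightarrow> nat"
  have "sigma_definable L b {..<m as} (S1 as A)" if "as \<in> T" "A \<in> atoms L (length as)" for as A
  proof -
    have "sigma_definable L b {..<m as} (\<lambda>N e. sat N e A = sat M ((!) as) A)"
    proof -
      have "fv A \<subseteq> {..<m as}" using atoms_props[OF that(2)] by (auto simp: m_def)
      then show ?thesis
        using qfree_definable(1)[of A L "{..<m as}" b] qfree_definable(1)[of "Neg A" L "{..<m as}" b]
          atoms_props[OF that(2)] by (cases "sat M ((!) as) A") auto
    qed
    then show ?thesis
      using sigma_definable_or defQ(2)[of as] that(1) unfolding S1_def T_def m_def by blast
  qed
  moreover have "sigma_definable L b {..<m as} (S2 as a)" if "as \<in> T" "a \<in> univ M" for as a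
  proof -
    have "sigma_definable L b {..<length as} (ext as (\<phi> (as @ [a])))"
      using def\<phi>[of "as @ [a]"] that by (intro def_ext) (simp add: T_def)
    then have "sigma_definable L b {..<m as} (ext as (\<phi> (as @ [a])))"
      by (rule sigma_definable_vars) (simp add: m_def)
    then show ?thesis
      using sigma_definable_or defQ(2)[of as] that(1) unfolding S2_def T_def m_def by blast
  qed
  moreover have "sigma_definable L b {..<Suc (m as)} (S3 as)" if "as \<in> T" for as
  proof -
    let ?r = "\<lambda>x. if x = length as then m as else x"
    have "sigma_definable L b {..<Suc (m as)} (\<lambda>N e. \<phi> (as @ [a]) N (\<lambda>x. e (?r x)))"
      if "a \<in> univ M" for a
    proof -
      have "sigma_definable L b (?r ` {..<length (as @ [a])}) (\<lambda>N e. \<phi> (as @ [a]) N (\<lambda>x. e (?r x)))"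
        using \<open>as \<in> T\<close> that by (intro sigma_definable_rename def\<phi>) (auto simp: T_def)
      then show ?thesis by (rule sigma_definable_vars) (auto simp: m_def)
    qed
    then have "sigma_definable L b {..<Suc (m as)} (\<lambda>N e. \<exists>a\<in>univ M. \<phi> (as @ [a]) N (\<lambda>x. e (?r x)))"
      by (intro sigma_definable_Bex b) auto
    moreover have "sigma_definable L b {..<Suc (m as)} (\<lambda>N e. \<not> Q as N e)"
      using defQ(2)[of as] that by (rule_tac sigma_definable_vars) (auto simp: T_def m_def)
    ultimately show ?thesis
      unfolding S3_def by (rule_tac sigma_definable_or)
  qed
  moreover have all: "pi_definable L (osuc b) {} (\<lambda>N e. \<forall>cs. length cs = n \<and> set cs \<subseteq> univ N \<longrightarrow> P N ((!) cs))"
    if "sigma_definable L b {..<n} P" for n P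
    by (rule pi_definable_all_tuple[OF osuc_pos pi_definable_if_sigma[OF that less_osuc]])
  moreover have "pi_definable L (osuc b) {} (\<phi> [])"
    using pi_definable_if_sigma[OF def\<phi>[of "[]"] less_osuc] by simp
  ultimately have "pi_definable L (osuc b) {} (\<lambda>N e.
      (\<forall>as\<in>T. (\<forall>A\<in>atoms L (length as). \<forall>cs. length cs = m as \<and> set cs \<subseteq> univ N \<longrightarrow> S1 as A N ((!) cs)) \<and>
      (\<forall>a\<in>univ M. \<forall>cs. length cs = m as \<and> set cs \<subseteq> univ N \<longrightarrow> S2 as a N ((!) cs)) \<and>
      (\<forall>cs. length cs = Suc (m as) \<and> set cs \<subseteq> univ N \<longrightarrow> S3 as N ((!) cs))) \<and> \<phi> [] N e)"
    by (intro pi_definable_and pi_definable_Ball osuc_pos cT countable_atoms all) auto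
  then obtain S where S: "sentence L S" "Pi_in (osuc b) S" and
    S_iff: "\<And>N e. models N S \<longleftrightarrow> 
      (\<forall>as\<in>T. (\<forall>A\<in>atoms L (length as). \<forall>cs. length cs = m as \<and> set cs \<subseteq> univ N \<longrightarrow> S1 as A N ((!) cs)) \<and>
      (\<forall>a\<in>univ M. \<forall>cs. length cs = m as \<and> set cs \<subseteq> univ N \<longrightarrow> S2 as a N ((!) cs)) \<and>
      (\<forall>cs. length cs = Suc (m as) \<and> set cs \<subseteq> univ N \<longrightarrow> S3 as N ((!) cs))) \<and> \<phi> [] N e"
    by (rule pi_definable_sentence) (rule that, assumption+)
  \<comment> \<open>\<open>cs\<close> lists the tuple, its witnesses and possibly one more element,
    as in \<open>S3\<close>; only the tuple is kept.\<close>
  have Q_take: "\<phi> as N ((!) (take (length as) cs))"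
    if "m as \<le> length cs" "set cs \<subseteq> univ N" "Q as N ((!) cs)" "as \<in> T" for as cs N
  proof -
    have "Q as N ((!) cs) = Q as N ((!) (take (m as) cs))"
      using defQ(1)[of as] that(1,4) by (intro sigma_definable_cong[OF defQ(1)]) (auto simp: T_def m_def)
    moreover have "take (m as) cs = take (length as) cs @ take (length (W as)) (drop (length as) cs)"
      by (simp add: m_def take_add)
    moreover have "length (take (length (W as)) (drop (length as) cs)) = length (W as)"
      using that(1) by (simp add: m_def)
    moreover have "set (take (length (W as)) (drop (length as) cs)) \<subseteq> univ N"
      using that(2) by (meson set_take_subset set_drop_subset order_trans)
    ultimately have "length (take (length (W as)) (drop (length as) cs)) = length (W as) \<and>
        set (take (length (W as)) (drop (length as) cs)) \<subseteq> univ N \<and>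
        Q as N ((!) (take (length as) cs @ take (length (W as)) (drop (length as) cs)))"
      using that(3) by simp
    moreover have "length (take (length as) cs) = length as" using that(1) by (simp add: m_def)
    ultimately show ?thesis unfolding \<phi>_list[OF \<open>length (take (length as) cs) = length as\<close>] by blast
  qed
  have "models M S"
    unfolding S_iff[of M "\<lambda>_. undefined"]
  proof (intro conjI ballI allI impI)
    fix as A cs
    assume *: "as \<in> T" "A \<in> atoms L (length as)" "length cs = m as \<and> set cs \<subseteq> univ M"
    show "S1 as A M ((!) cs)" unfolding S1_def
    proof (cases "Q as M ((!) cs)")
      case True
      let ?cs = "take (length as) cs"
      have l: "length ?cs = length as" using * by (simp add: m_def)
      have sc: "set ?cs \<subseteq> univ M" using * by (meson set_take_subset order_trans)
      have \<phi>: "\<phi> as M ((!) ?cs)" using Q_take[of as cs M] * True by simp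
      have "Sigma_type L b M ?cs = Sigma_type L b M as"
        using sub[OF _ sc l \<phi>] sup[OF _ sc l \<phi>] * by (auto simp: T_def)
      moreover have d: "sigma_definable L b {..<length as} (\<lambda>N e. sat N e A)"
        using atoms_props[OF *(2)] by (intro qfree_definable) auto
      ultimately have "sat M ((!) ?cs) A = sat M ((!) as) A"
        using Sigma_type_transfer[of L b M ?cs M as "\<lambda>N e. sat N e A"]
          Sigma_type_transfer[of L b M as M ?cs "\<lambda>N e. sat N e A"] l by auto
      moreover have "sat M ((!) cs) A = sat M ((!) ?cs) A"
        using l by (intro sigma_definable_cong[OF d]) auto
      ultimately show "\<not> Q as M ((!) cs) \<or> sat M ((!) cs) A = sat M ((!) as) A" by simp
    qed simp
  next
    fix as a cs
    assume *: "as \<in> T" "a \<in> univ M" "length cs = m as \<and> set cs \<subseteq> univ M"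
    show "S2 as a M ((!) cs)" unfolding S2_def
    proof (cases "Q as M ((!) cs)")
      case True
      let ?cs = "take (length as) cs"
      have l: "length ?cs = length as" using * by (simp add: m_def)
      have sc: "set ?cs \<subseteq> univ M" using * by (meson set_take_subset order_trans)
      have \<phi>: "\<phi> as M ((!) ?cs)" using Q_take[of as cs M] * True by simp
      have d: "sigma_definable L b {..<length as} (ext as (\<phi> (as @ [a])))"
        using def\<phi>[of "as @ [a]"] * by (intro def_ext) (simp add: T_def)
      have "ext as (\<phi> (as @ [a])) M ((!) as)"
        using self[of "as @ [a]"] * by (auto simp: ext_list T_def)
      then have "ext as (\<phi> (as @ [a])) M ((!) ?cs)"
        using Sigma_type_transfer[OF sup[OF _ sc l \<phi>], of "ext as (\<phi> (as @ [a]))"] d l *(1)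
        by (simp add: T_def)
      moreover have "ext as (\<phi> (as @ [a])) M ((!) cs) = ext as (\<phi> (as @ [a])) M ((!) ?cs)"
        using l by (intro sigma_definable_cong[OF d]) auto
      ultimately show "\<not> Q as M ((!) cs) \<or> ext as (\<phi> (as @ [a])) M ((!) cs)" by simp
    qed simp
  next
    fix as cs
    assume *: "as \<in> T" "length cs = Suc (m as) \<and> set cs \<subseteq> univ M"
    show "S3 as M ((!) cs)" unfolding S3_def
    proof (cases "Q as M ((!) cs)")
      case True
      let ?cs = "take (length as) cs" and ?y = "cs ! m as"
      have l: "length ?cs = length as" using * by (simp add: m_def)
      have sc: "set ?cs \<subseteq> univ M" using * by (meson set_take_subset order_trans)
      have y: "?y \<in> univ M" using * by (metis lessI nth_mem subsetD)
      have \<phi>: "\<phi> as M ((!) ?cs)" using Q_take[of as cs M] * True by simp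
      have d: "sigma_definable L b {..<length as} (ext as (\<phi> (?cs @ [?y])))"
        using def\<phi>[of "?cs @ [?y]"] sc y l by (intro def_ext) simp
      \<comment> \<open>\<open>?y\<close> shows that some extension of \<open>?cs\<close> satisfies
        the supporting formula of \<open>?cs @ [?y]\<close>. As a Sigma_b property this passes to
        \<open>as\<close> and yields \<open>a\<close>. Comparing the types of the two longer tuples
        then gives the supporting formula of \<open>as @ [a]\<close> for
        \<open>?cs @ [?y]\<close>.\<close>
      have "ext as (\<phi> (?cs @ [?y])) M ((!) ?cs)"
        using self[of "?cs @ [?y]"] sc y l by (auto simp: ext_list)
      then have "ext as (\<phi> (?cs @ [?y])) M ((!) as)"
        using Sigma_type_transfer[OF sub[OF _ sc l \<phi>] l, of "ext as (\<phi> (?cs @ [?y]))"] d *(1)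
        by (simp add: T_def)
      then obtain a where a: "a \<in> univ M" "\<phi> (?cs @ [?y]) M ((!) (as @ [a]))" by (auto simp: ext_list)
      have asa: "set (as @ [a]) \<subseteq> univ M" using * a(1) by (auto simp: T_def)
      have "Sigma_type L b M (as @ [a]) \<subseteq> Sigma_type L b M (?cs @ [?y])"
        using sc y l a(2) asa by (intro sub) auto
      then have "\<phi> (as @ [a]) M ((!) (?cs @ [?y]))"
        by (rule Sigma_type_transfer) (use def\<phi>[OF asa] self[OF asa] l in simp_all)
      moreover have "\<phi> (as @ [a]) M ((!) (?cs @ [?y])) =
          \<phi> (as @ [a]) M (\<lambda>x. cs ! (if x = length as then m as else x))"
        using l by (intro sigma_definable_cong[OF def\<phi>[OF asa]]) (auto simp: nth_append)
      ultimately show "\<not> Q as M ((!) cs) \<or>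
          (\<exists>a\<in>univ M. \<phi> (as @ [a]) M (\<lambda>x. cs ! (if x = length as then m as else x)))"
        using a(1) by blast
    qed simp
  next
    show "\<phi> [] M (\<lambda>_. undefined)" using self[of "[]"] by (simp add: \<phi>_def)
  qed
  moreover have "isomorphic L M N" if N: "is_structure L N" "models N S" for N
  proof -
    define R where "R as cs \<longleftrightarrow> as \<in> T \<and> set cs \<subseteq> univ N \<and> length cs = length as \<and> \<phi> as N ((!) cs)"
      for as cs
    have R_D: "\<exists>ws. length ws = length (W as) \<and> set ws \<subseteq> univ N \<and> Q as N ((!) (cs @ ws)) \<and>
        length (cs @ ws) = m as \<and> set (cs @ ws) \<subseteq> univ N" if "R as cs" for as cs
      using that by (auto simp: R_def \<phi>_list m_def)
    show ?thesis
    proof (rule back_and_forth_isomorphic[OF M N(1), where R = R])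
      show "R [] []" using N(2) unfolding S_iff[of N "(!) []"] by (simp add: R_def T_def)
    next
      fix as cs a assume R: "R as cs" and a: "a \<in> univ M"
      obtain ws where ws: "length ws = length (W as)" "set ws \<subseteq> univ N" "Q as N ((!) (cs @ ws))"
         "length (cs @ ws) = m as" "set (cs @ ws) \<subseteq> univ N" using R_D[OF R] by blast
      have asT: "as \<in> T" and l: "length cs = length as" using R by (simp_all add: R_def)
      have "S2 as a N ((!) (cs @ ws))" using N(2) ws(4,5) asT a unfolding S_iff[of N undefined] by blast
      then have "ext as (\<phi> (as @ [a])) N ((!) (cs @ ws))" using ws(3) by (simp add: S2_def)
      moreover have "map ((!) (cs @ ws)) [0..<length as] = cs"
        using l by (intro nth_equalityI) (auto simp: nth_append)
      ultimately obtain y where "y \<in> univ N" "\<phi> (as @ [a]) N ((!) (cs @ [y]))"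
        by (auto simp: ext_def)
      then show "\<exists>y\<in>univ N. R (as @ [a]) (cs @ [y])"
        using R a by (auto simp: R_def T_def)
    next
      fix as cs y assume R: "R as cs" and y: "y \<in> univ N"
      obtain ws where ws: "length ws = length (W as)" "set ws \<subseteq> univ N" "Q as N ((!) (cs @ ws))"
         "length (cs @ ws) = m as" "set (cs @ ws) \<subseteq> univ N" using R_D[OF R] by blast
      have asT: "as \<in> T" and l: "length cs = length as" using R by (simp_all add: R_def)
      have "length ((cs @ ws) @ [y]) = Suc (m as)" "set ((cs @ ws) @ [y]) \<subseteq> univ N"
        using ws(4,5) y by auto
      then have "S3 as N ((!) ((cs @ ws) @ [y]))" using N(2) asT unfolding S_iff[of N undefined] by blast
      moreover have "Q as N ((!) ((cs @ ws) @ [y])) = Q as N ((!) (cs @ ws))"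
        using asT ws(4) by (intro sigma_definable_cong[OF defQ(1)]) (auto simp: T_def nth_append m_def)
      ultimately obtain a where a: "a \<in> univ M"
        "\<phi> (as @ [a]) N (\<lambda>x. ((cs @ ws) @ [y]) ! (if x = length as then m as else x))"
        using ws(3) unfolding S3_def by blast
      have asa: "set (as @ [a]) \<subseteq> univ M" using asT a(1) by (auto simp: T_def)
      have "\<phi> (as @ [a]) N (\<lambda>x. ((cs @ ws) @ [y]) ! (if x = length as then m as else x)) =
          \<phi> (as @ [a]) N ((!) (cs @ [y]))"
        using l ws(1,4) by (intro sigma_definable_cong[OF def\<phi>[OF asa]]) (auto simp: nth_append)
      then have "R (as @ [a]) (cs @ [y])" using a(2) asa R y by (auto simp: R_def T_def)
      then show "\<exists>a\<in>univ M. R (as @ [a]) (cs @ [y])" using a(1) by blast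
    next
      fix as cs A assume R: "R as cs" and "length as = length cs" and A: "A \<in> atoms L (length as)"
      obtain ws where ws: "length ws = length (W as)" "set ws \<subseteq> univ N" "Q as N ((!) (cs @ ws))"
         "length (cs @ ws) = m as" "set (cs @ ws) \<subseteq> univ N" using R_D[OF R] by blast
      have asT: "as \<in> T" and l: "length cs = length as" using R by (simp_all add: R_def)
      have "S1 as A N ((!) (cs @ ws))" using N(2) ws(4,5) asT A unfolding S_iff[of N undefined] by blast
      then have "sat N ((!) (cs @ ws)) A = sat M ((!) as) A" using ws(3) by (simp add: S1_def)
      moreover have "sat N ((!) (cs @ ws)) A = sat N ((!) cs) A"
        using atoms_props[OF A] l by (intro sat_cong) (auto simp: nth_append)
      ultimately show "sat N ((!) cs) A = sat M ((!) as) A" by simp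
    qed
  qed
  ultimately have "Mod L S = {N. isomorphic L N M}"
    using isomorphic_models[OF _ S(1)] isomorphic_sym isomorphic_structure unfolding Mod_def by blast
  then show ?thesis using S unfolding Scott_sentence_def by blast
qed

section \<open>Omitting types\<close>

text \<open>The Rasiowa-Sikorski argument: meet countably many dense sets one after the
  other.\<close>

lemma generic_sequence:
  fixes P :: "'s \<Rightarrow> bool" and le :: "'s \<Rightarrow> 's \<Rightarrow> bool"
  assumes "countable \<D>" "P s0"
    and dense: "\<And>D s. D \<in> \<D> \<Longrightarrow> P s \<Longrightarrow> \<exists>s'. P s' \<and> le s s' \<and> s' \<in> D"
    and refl: "\<And>s. le s s"
  shows "\<exists>\<sigma>. (\<forall>n::nat. P (\<sigma> n) \<and> le (\<sigma> n) (\<sigma> (Suc n))) \<and> (\<forall>D\<in>\<D>. \<exists>n. \<sigma> n \<in> D)"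
proof (cases "\<D> = {}")
  case True
  then show ?thesis using assms(2) refl by (intro exI[of _ "\<lambda>_. s0"]) simp
next
  case False
  let ?D = "from_nat_into \<D>"
  have "\<exists>\<sigma>. \<forall>n. P (\<sigma> n) \<and> (le (\<sigma> n) (\<sigma> (Suc n)) \<and> \<sigma> (Suc n) \<in> ?D n)"
  proof (rule dependent_nat_choice)
    show "\<exists>s. P s" using assms(2) by blast
    show "\<exists>s'. P s' \<and> (le s s' \<and> s' \<in> ?D n)" if "P s" for s n
      using dense[OF from_nat_into[OF False] that] by blast
  qed
  then obtain \<sigma> where \<sigma>: "\<And>n. P (\<sigma> n) \<and> le (\<sigma> n) (\<sigma> (Suc n)) \<and> \<sigma> (Suc n) \<in> ?D n" by auto
  have "\<exists>n. \<sigma> n \<in> D" if "D \<in> \<D>" for D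
    using \<sigma> from_nat_into_surj[OF assms(1) that] by metis
  with \<sigma> show ?thesis by blast
qed

text \<open>In the next lemma, \<open>S n\<close> are shrinking sets of structures with named elements; the limit
  structure consists of the names, and what it satisfies is what is eventually true in all members
  of \<open>S n\<close>.\<close>

lemma limit_structure:
  fixes S :: "nat \<Rightarrow> (struct \<times> (nat \<Rightarrow> nat)) set"
  assumes decr: "\<And>n. S (Suc n) \<subseteq> S n" and ne: "\<And>n. S n \<noteq> {}"
    and deceq: "\<And>u v. \<exists>n. (\<forall>(N, e)\<in>S n. e u = e v) \<or> (\<forall>(N, e)\<in>S n. e u \<noteq> e v)"
    and decrel: "\<And>i us. (i, length us) \<in> rels L \<Longrightarrow> \<exists>n. (\<forall>(N, e)\<in>S n. rel_interp N i (map e us)) \<or>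
      (\<forall>(N, e)\<in>S n. \<not> rel_interp N i (map e us))"
    and funex: "\<And>i us. (i, length us) \<in> funs L \<Longrightarrow> \<exists>n v. \<forall>(N, e)\<in>S n. fun_interp N i (map e us) = e v"
  shows "\<exists>M rep. is_structure L M \<and> univ M = range rep \<and>
    (\<forall>A \<rho>. qfree A \<longrightarrow> fm_wf L A \<longrightarrow>
      (\<exists>n. \<forall>(N, e)\<in>S n. sat N (\<lambda>x. e (\<rho> x)) A = sat M (\<lambda>x. rep (\<rho> x)) A))"
proof -
  have mono: "S n \<subseteq> S m" if "m \<le> n" for m n
    using lift_Suc_antimono_le[of S, OF decr that] .
  define ev where "ev P \<longleftrightarrow> (\<exists>n. \<forall>(N, e)\<in>S n. P N e)" for P
  have evI: "ev P" if "\<forall>(N, e)\<in>S n. P N e" for P n using that unfolding ev_def by blast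
  have ev_and: "ev (\<lambda>N e. P N e \<and> Q N e)" if PQ: "ev P" "ev Q" for P Q
  proof -
    obtain m n where "\<forall>(N, e)\<in>S m. P N e" "\<forall>(N, e)\<in>S n. Q N e" using PQ unfolding ev_def by blast
    then have "\<forall>(N, e)\<in>S (max m n). P N e \<and> Q N e" using mono[of m "max m n"] mono[of n "max m n"] by auto
    then show ?thesis by (rule evI)
  qed
  have ev_mono: "ev Q" if "ev P" "\<And>N e. P N e \<Longrightarrow> Q N e" for P Q
    using that unfolding ev_def by fast
  have ev_notF: "\<not> ev (\<lambda>N e. False)" using ne unfolding ev_def by fast
  have ev_contr: False if "ev P" "ev (\<lambda>N e. \<not> P N e)" for P
    using ev_mono[OF ev_and[OF that], of "\<lambda>N e. False"] ev_notF by blast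
  have ev_list: "ev (\<lambda>N e. \<forall>x\<in>set xs. P x N e)" if "\<And>x. x \<in> set xs \<Longrightarrow> ev (P x)"
    for xs :: "'c list" and P
    using that
  proof (induction xs)
    case Nil
    show ?case by (rule evI[of 0]) simp
  next
    case (Cons x xs)
    then have "ev (\<lambda>N e. P x N e \<and> (\<forall>x\<in>set xs. P x N e))" by (intro ev_and) auto
    then show ?case by (rule ev_mono) auto
  qed
  \<comment> \<open>The universe has to be a set of numbers, so a class of eventually equal names is
    represented by its least member.\<close>
  define rep where "rep v = (LEAST u. ev (\<lambda>N e. e u = e v))" for v
  have rep: "ev (\<lambda>N e. e (rep v) = e v)" for v
    unfolding rep_def by (rule LeastI[of _ v]) (rule evI[of 0], simp)
  have rep_eq: "rep u = rep v" if "ev (\<lambda>N e. e u = e v)" for u v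
  proof -
    have "ev (\<lambda>N e. e w = e u) \<longleftrightarrow> ev (\<lambda>N e. e w = e v)" for w
    proof
      assume "ev (\<lambda>N e. e w = e u)"
      from ev_and[OF this that] show "ev (\<lambda>N e. e w = e v)" by (rule ev_mono) simp
    next
      assume "ev (\<lambda>N e. e w = e v)"
      from ev_and[OF this that] show "ev (\<lambda>N e. e w = e u)" by (rule ev_mono) simp
    qed
    then show ?thesis unfolding rep_def by simp
  qed
  have eq_rep: "ev (\<lambda>N e. e u = e v)" if "rep u = rep v" for u v
    using ev_mono[OF ev_and[OF rep[of u] rep[of v]], of "\<lambda>N e. e u = e v"] that by simp
  define M where "M = \<lparr>univ = range rep, rel_interp = (\<lambda>i as. ev (\<lambda>N e. rel_interp N i (map e as))),
     fun_interp = (\<lambda>i as. rep (LEAST v. ev (\<lambda>N e. fun_interp N i (map e as) = e v)))\<rparr>"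
  have rep_map: "ev (\<lambda>N e. map e (map rep us) = map e us)" for us
    using ev_list[of us "\<lambda>u N e. e (rep u) = e u"] rep by (rule_tac ev_mono) auto
  have M_rel: "rel_interp M i (map rep us) \<longleftrightarrow> ev (\<lambda>N e. rel_interp N i (map e us))" for i us
  proof
    assume "rel_interp M i (map rep us)"
    then have "ev (\<lambda>N e. rel_interp N i (map e (map rep us)))" by (simp add: M_def)
    from ev_and[OF this rep_map[of us]] show "ev (\<lambda>N e. rel_interp N i (map e us))"
      by (rule ev_mono) (elim conjE, simp only:)
  next
    assume "ev (\<lambda>N e. rel_interp N i (map e us))"
    from ev_and[OF this rep_map[of us]] have "ev (\<lambda>N e. rel_interp N i (map e (map rep us)))"
      by (rule ev_mono) (elim conjE, simp only:)
    then show "rel_interp M i (map rep us)" by (simp add: M_def)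
  qed
  have M_fun: "\<exists>v. fun_interp M i (map rep us) = rep v \<and> ev (\<lambda>N e. fun_interp N i (map e us) = e v)"
    if "(i, length us) \<in> funs L" for i us
  proof -
    obtain v where "ev (\<lambda>N e. fun_interp N i (map e us) = e v)"
      using funex[of i us] \<open>(i, length us) \<in> funs L\<close> unfolding ev_def by blast
    from ev_and[OF this rep_map[of us]] have "ev (\<lambda>N e. fun_interp N i (map e (map rep us)) = e v)"
      by (rule ev_mono) (elim conjE, simp only:)
    then have "ev (\<lambda>N e. fun_interp N i (map e (map rep us)) =
        e (LEAST v. ev (\<lambda>N e. fun_interp N i (map e (map rep us)) = e v)))" by (rule LeastI)
    from ev_and[OF this rep_map[of us]] have "ev (\<lambda>N e. fun_interp N i (map e us) =
        e (LEAST v. ev (\<lambda>N e. fun_interp N i (map e (map rep us)) = e v)))"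
      by (rule ev_mono) (elim conjE, simp only:)
    moreover have "fun_interp M i (map rep us) =
        rep (LEAST v. ev (\<lambda>N e. fun_interp N i (map e (map rep us)) = e v))"
      by (simp add: M_def)
    ultimately show ?thesis by blast
  qed
  have str: "is_structure L M" by (auto simp: is_structure_def M_def)
  have tm: "tm_wf L t \<Longrightarrow> \<exists>v. tm_val M (\<lambda>x. rep (\<rho> x)) t = rep v \<and>
      ev (\<lambda>N e. tm_val N (\<lambda>x. e (\<rho> x)) t = e v)" for t \<rho>
  proof (induction t)
    case (Var x)
    show ?case by (rule exI[of _ "\<rho> x"]) (auto intro: evI[of 0])
  next
    case (App i ts)
    have ex: "\<exists>v. tm_val M (\<lambda>x. rep (\<rho> x)) t = rep v \<and>
      ev (\<lambda>N e. tm_val N (\<lambda>x. e (\<rho> x)) t = e v)" if "t \<in> set ts" for t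
      by (rule App.IH[OF that]) (use App.prems that in \<open>simp add: list_all_iff\<close>)
    define f where "f t = (SOME v. tm_val M (\<lambda>x. rep (\<rho> x)) t = rep v \<and>
      ev (\<lambda>N e. tm_val N (\<lambda>x. e (\<rho> x)) t = e v))" for t
    have f: "tm_val M (\<lambda>x. rep (\<rho> x)) t = rep (f t)"
       "ev (\<lambda>N e. tm_val N (\<lambda>x. e (\<rho> x)) t = e (f t))" if "t \<in> set ts" for t
      using someI_ex[OF ex[OF that]] unfolding f_def by - (erule conjunct1, erule conjunct2)
    have "map (tm_val M (\<lambda>x. rep (\<rho> x))) ts = map rep (map f ts)" using f(1) by simp
    moreover have evm: "ev (\<lambda>N e. map (tm_val N (\<lambda>x. e (\<rho> x))) ts = map e (map f ts))"
      using ev_list[of ts "\<lambda>t N e. tm_val N (\<lambda>x. e (\<rho> x)) t = e (f t)"] f(2)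
      by (rule_tac ev_mono) auto
    moreover obtain v where v: "fun_interp M i (map rep (map f ts)) = rep v"
      "ev (\<lambda>N e. fun_interp N i (map e (map f ts)) = e v)"
      using M_fun[of i "map f ts"] App.prems by auto
    moreover from ev_and[OF evm v(2)] have "ev (\<lambda>N e. tm_val N (\<lambda>x. e (\<rho> x)) (App i ts) = e v)"
      by (rule ev_mono) (simp only: tm_val.simps)
    ultimately show ?case by (intro exI[of _ v]) (simp only: tm_val.simps)
  qed
  have dec: "ev (\<lambda>N e. sat N (\<lambda>x. e (\<rho> x)) A = sat M (\<lambda>x. rep (\<rho> x)) A)" if "qfree A" "fm_wf L A"
    for A \<rho> using that
  proof (induction A)
    case Bot
    show ?case by (rule evI[of 0]) simp
  next
    case (Eq s t)
    obtain u v where u: "tm_val M (\<lambda>x. rep (\<rho> x)) s = rep u" "ev (\<lambda>N e. tm_val N (\<lambda>x. e (\<rho> x)) s = e u)"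
      and v: "tm_val M (\<lambda>x. rep (\<rho> x)) t = rep v" "ev (\<lambda>N e. tm_val N (\<lambda>x. e (\<rho> x)) t = e v)"
      using tm[of s \<rho>] tm[of t \<rho>] Eq.prems by auto
    \<comment> \<open>Failing to be eventually equal is not yet being eventually different;
      \<open>deceq\<close> closes the gap.\<close>
    have "ev (\<lambda>N e. (e u = e v) = (rep u = rep v))"
    proof (cases "rep u = rep v")
      case True
      then show ?thesis using eq_rep[OF True] by simp
    next
      case False
      then have "\<not> ev (\<lambda>N e. e u = e v)" using rep_eq by blast
      then have "ev (\<lambda>N e. e u \<noteq> e v)" using deceq[of u v] unfolding ev_def by blast
      then show ?thesis using False by simp
    qed
    from ev_and[OF this ev_and[OF u(2) v(2)]] show ?case
      by (rule ev_mono) (simp add: u(1) v(1))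
  next
    case (Rel i ts)
    have ex: "\<exists>v. tm_val M (\<lambda>x. rep (\<rho> x)) t = rep v \<and>
      ev (\<lambda>N e. tm_val N (\<lambda>x. e (\<rho> x)) t = e v)" if "t \<in> set ts" for t
      by (rule tm) (use Rel.prems that in \<open>simp add: list_all_iff\<close>)
    define f where "f t = (SOME v. tm_val M (\<lambda>x. rep (\<rho> x)) t = rep v \<and>
      ev (\<lambda>N e. tm_val N (\<lambda>x. e (\<rho> x)) t = e v))" for t
    have f: "tm_val M (\<lambda>x. rep (\<rho> x)) t = rep (f t)"
       "ev (\<lambda>N e. tm_val N (\<lambda>x. e (\<rho> x)) t = e (f t))" if "t \<in> set ts" for t
      using someI_ex[OF ex[OF that]] unfolding f_def by - (erule conjunct1, erule conjunct2)
    have mapM: "map (tm_val M (\<lambda>x. rep (\<rho> x))) ts = map rep (map f ts)" using f(1) by simp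
    have evm: "ev (\<lambda>N e. map (tm_val N (\<lambda>x. e (\<rho> x))) ts = map e (map f ts))"
      using ev_list[of ts "\<lambda>t N e. tm_val N (\<lambda>x. e (\<rho> x)) t = e (f t)"] f(2)
      by (rule_tac ev_mono) auto
    have "ev (\<lambda>N e. rel_interp N i (map e (map f ts)) = ev (\<lambda>N e. rel_interp N i (map e (map f ts))))"
    proof (cases "ev (\<lambda>N e. rel_interp N i (map e (map f ts)))")
      case True
      then show ?thesis by (rule ev_mono) (use True in blast)
    next
      case False
      have "ev (\<lambda>N e. \<not> rel_interp N i (map e (map f ts)))"
        using decrel[of i "map f ts"] Rel.prems False unfolding ev_def by auto
      then show ?thesis by (rule ev_mono) (use False in blast)
    qed
    from ev_and[OF evm this] show ?case
      unfolding sat.simps mapM M_rel by (rule ev_mono) (elim conjE, simp only:)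
  next
    case (Neg A)
    then have "ev (\<lambda>N e. sat N (\<lambda>x. e (\<rho> x)) A = sat M (\<lambda>x. rep (\<rho> x)) A)" by simp
    then show ?case by (rule ev_mono) simp
  next
    case (And A B)
    then have "ev (\<lambda>N e. sat N (\<lambda>x. e (\<rho> x)) A = sat M (\<lambda>x. rep (\<rho> x)) A)"
      "ev (\<lambda>N e. sat N (\<lambda>x. e (\<rho> x)) B = sat M (\<lambda>x. rep (\<rho> x)) B)" by simp_all
    from ev_and[OF this] show ?case by (rule ev_mono) simp
  next
    case (Or A B)
    then have "ev (\<lambda>N e. sat N (\<lambda>x. e (\<rho> x)) A = sat M (\<lambda>x. rep (\<rho> x)) A)"
      "ev (\<lambda>N e. sat N (\<lambda>x. e (\<rho> x)) B = sat M (\<lambda>x. rep (\<rho> x)) B)" by simp_all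
    from ev_and[OF this] show ?case by (rule ev_mono) simp
  qed simp_all
  show ?thesis
    by (intro exI[of _ M] exI[of _ rep] conjI str allI impI) (use dec in \<open>auto simp: M_def ev_def\<close>)
qed

section \<open>Finite conditions and their extensions\<close>

primrec subformulas :: "fm \<Rightarrow> fm set" where
  "subformulas Bot = {Bot}"
| "subformulas (Eq s t) = {Eq s t}"
| "subformulas (Rel i ts) = {Rel i ts}"
| "subformulas (Neg p) = insert (Neg p) (subformulas p)"
| "subformulas (And p q) = insert (And p q) (subformulas p \<union> subformulas q)"
| "subformulas (Or p q) = insert (Or p q) (subformulas p \<union> subformulas q)"
| "subformulas (Conj P) = insert (Conj P) (\<Union>i. subformulas (P i))"
| "subformulas (Disj P) = insert (Disj P) (\<Union>i. subformulas (P i))"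
| "subformulas (Ex x p) = insert (Ex x p) (subformulas p)"
| "subformulas (All x p) = insert (All x p) (subformulas p)"

lemma subformulas_self: "p \<in> subformulas p"
  by (cases p) auto

lemma subformulas_trans: "q \<in> subformulas p \<Longrightarrow> subformulas q \<subseteq> subformulas p"
  by (induction p) auto

lemma countable_subformulas: "countable (subformulas p)"
  by (induction p) auto

lemma subformulas_foldr_Ex: "q \<in> subformulas (foldr Ex xs q)"
  by (induction xs) (auto simp: subformulas_self)

lemma subformulas_foldr_All: "q \<in> subformulas (foldr All xs q)"
  by (induction xs) (auto simp: subformulas_self)

text \<open>A fact \<open>(q, rs)\<close> asserts \<open>q\<close> of the named elements \<open>rs\<close>.\<close>

definition satisfiers :: "struct set \<Rightarrow> (fm \<times> nat list) list \<Rightarrow> (struct \<times> (nat \<Rightarrow> nat)) set" where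
  "satisfiers K st = {(N, e). N \<in> K \<and> range e \<subseteq> univ N \<and>
     (\<forall>(q, rs) \<in> set st. sat N (\<lambda>x. e (rs ! x)) q)}"

text \<open>Consistency means being satisfied in an actual member of \<open>K\<close>. All facts are
  Pi_c with c < b, the complexity allowed for the matrix of a support. Formulas come from the set
  \<open>F\<close>, chosen countable later, apart from the quantifier-free ones that decide the
  atomic diagram.\<close>

definition condition ::
    "vocab \<Rightarrow> omega1 \<Rightarrow> fm set \<Rightarrow> struct set \<Rightarrow> (fm \<times> nat list) list \<Rightarrow> bool" where
  "condition L b F K st \<longleftrightarrow> satisfiers K st \<noteq> {} \<and>
     (\<forall>(q, rs) \<in> set st. fm_wf L q \<and> (\<exists>c<b. Pi_in c q) \<and> fv q \<subseteq> {..<length rs} \<and> (q \<in> F \<or> qfree q))"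

lemma satisfiers_Cons:
  "(N, e) \<in> satisfiers K ((q, rs) # st) \<longleftrightarrow> (N, e) \<in> satisfiers K st \<and> sat N (\<lambda>x. e (rs ! x)) q"
  by (auto simp: satisfiers_def)

lemma satisfiers_mono: "set st \<subseteq> set st' \<Longrightarrow> satisfiers K st' \<subseteq> satisfiers K st"
  by (auto simp: satisfiers_def)

text \<open>Only finitely many names occur in a condition, so the names from \<open>B\<close> on may
  be given any values: this is the source of witnesses.\<close>

lemma condition_fresh:
  assumes "condition L b F K st"
  shows "\<exists>B. (\<forall>c\<in>set rs. c < B) \<and>
    (\<forall>N e e'. (N, e) \<in> satisfiers K st \<longrightarrow> (\<forall>c<B. e' c = e c) \<longrightarrow> range e' \<subseteq> univ N \<longrightarrow>
       (N, e') \<in> satisfiers K st)"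
proof -
  have "finite (set rs \<union> (\<Union>(q, rs)\<in>set st. set rs))" by auto
  then obtain B where B: "\<forall>c \<in> set rs \<union> (\<Union>(q, rs)\<in>set st. set rs). c < B"
    unfolding finite_nat_set_iff_bounded by (elim exE)
  show ?thesis
  proof (intro exI[of _ B] conjI ballI allI impI)
    show "c < B" if "c \<in> set rs" for c using B that by blast
    fix N e e' assume *: "(N, e) \<in> satisfiers K st" "\<forall>c<B. e' c = e c" "range e' \<subseteq> univ N"
    have "sat N (\<lambda>x. e' (us ! x)) q" if us: "(q, us) \<in> set st" for q us
    proof -
      have "fv q \<subseteq> {..<length us}" using assms us by (auto simp: condition_def)
      moreover have "us ! x < B" if "x < length us" for x
      proof -
        have "us ! x \<in> (\<Union>(q, rs)\<in>set st. set rs)" using us that by (intro UN_I[OF us]) simp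
        with B show ?thesis by blast
      qed
      ultimately have "sat N (\<lambda>x. e' (us ! x)) q = sat N (\<lambda>x. e (us ! x)) q"
        using *(2) by (intro sat_cong) blast
      then show ?thesis using *(1) us by (auto simp: satisfiers_def)
    qed
    then show "(N, e') \<in> satisfiers K st" using *(1,3) by (auto simp: satisfiers_def)
  qed
qed

text \<open>A member of \<open>K\<close> that satisfies the disjunction satisfies one block, and
  fresh names are given to its witnesses. The matrix has a level c < a \<le> b, so adding it gives a
  condition again.\<close>

lemma condition_witness:
  assumes cond: "condition L b F K st" and P: "Sigma_in a (Disj P)" "0 < a" "a \<le> b" "fm_wf L (Disj P)"
    "fv (Disj P) \<subseteq> {..<length rs}" "Disj P \<in> F" and F: "\<And>p. p \<in> F \<Longrightarrow> subformulas p \<subseteq> F"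
    and real: "(N, e) \<in> satisfiers K st" "sat N (\<lambda>x. e (rs ! x)) (Disj P)"
  shows "\<exists>i xs q rs'. P i = foldr Ex xs q \<and> (\<forall>x. x < length rs \<longrightarrow> x \<notin> set xs \<longrightarrow> rs' ! x = rs ! x) \<and>
     condition L b F K ((q, rs') # st)"
proof -
  from P(1,2) have PE: "\<exists>xs q c. P i = foldr Ex xs q \<and> c < a \<and> Pi_in c q" for i
    by (auto elim: Sigma_in.cases)
  from real(2) obtain i where "sat N (\<lambda>x. e (rs ! x)) (P i)" by auto
  moreover obtain xs q c where q: "P i = foldr Ex xs q" "c < a" "Pi_in c q" using PE by blast
  ultimately obtain e' where e': "reassign N xs (\<lambda>x. e (rs ! x)) e'" "sat N e' q"
    by (auto simp: sat_foldr_Ex)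
  have "fv (P i) \<subseteq> {..<length rs}" using P(5) by (auto simp: UN_subset_iff)
  then have fvq: "fv q \<subseteq> {..<length rs} \<union> set xs" unfolding q(1) fv_foldr_Ex by auto
  from condition_fresh[OF cond, of rs] obtain B where B: "\<forall>c\<in>set rs. c < B"
    "\<forall>N e e'. (N, e) \<in> satisfiers K st \<longrightarrow> (\<forall>c<B. e' c = e c) \<longrightarrow> range e' \<subseteq> univ N \<longrightarrow>
       (N, e') \<in> satisfiers K st" by (elim exE conjE)
  obtain m0 where m0: "\<And>x. x \<in> set xs \<Longrightarrow> x < m0" using finite_nat_set_iff_bounded[of "set xs"] by auto
  define m where "m = max m0 (length rs)"
  \<comment> \<open>A bound variable \<open>x\<close> receives the fresh name \<open>B + x\<close>,
    and the other free variables keep their names; 0 only fills positions that \<open>q\<close> does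
    not read.\<close>
  define rs' where "rs' = map (\<lambda>x. if x \<in> set xs then B + x else if x < length rs then rs ! x else 0) [0..<m]"
  define e2 where "e2 c = (if B \<le> c \<and> c - B \<in> set xs then e' (c - B) else e c)" for c
  have rng: "range e2 \<subseteq> univ N"
    using e'(1) real(1) by (auto simp: e2_def satisfiers_def reassign_def)
  have "(N, e2) \<in> satisfiers K st" using rng by (intro B(2)[rule_format, OF real(1)]) (auto simp: e2_def)
  moreover have "sat N (\<lambda>x. e2 (rs' ! x)) q = sat N e' q"
  proof (rule sat_cong)
    fix x assume "x \<in> fv q"
    then consider "x \<in> set xs" | "x \<notin> set xs" "x < length rs" using fvq by auto
    then show "e2 (rs' ! x) = e' x"
    proof cases
      case 1
      then show ?thesis using m0 by (simp add: rs'_def e2_def m_def less_max_iff_disj)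
    next
      case 2
      then have "rs' ! x = rs ! x" by (simp add: rs'_def m_def less_max_iff_disj)
      moreover have "rs ! x < B" using B(1) 2(2) by simp
      ultimately show ?thesis using e'(1) 2 by (simp add: e2_def reassign_def)
    qed
  qed
  ultimately have "(N, e2) \<in> satisfiers K ((q, rs') # st)" using e'(2) by (simp add: satisfiers_Cons)
  moreover have "fm_wf L q" using P(4) q(1) by (metis fm_wf.simps(8) fm_wf_foldr_Ex)
  moreover have "fv q \<subseteq> {..<length rs'}" using fvq m0 by (auto simp: rs'_def m_def less_max_iff_disj)
  moreover have "q \<in> F"
    using F[OF P(6)] subformulas_foldr_Ex[of q xs] by (auto simp flip: q(1))
  ultimately have "condition L b F K ((q, rs') # st)"
    using cond q(3) less_le_trans[OF q(2) P(3)] unfolding condition_def by auto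
  moreover have "rs' ! x = rs ! x" if "x < length rs" "x \<notin> set xs" for x
    using that by (simp add: rs'_def m_def less_max_iff_disj)
  ultimately show ?thesis using q(1) by blast
qed

text \<open>Finite conjunctions exist at level 0 too, where the matrix of a support may lie.\<close>

lemma pi_definable_finite_Ball:
  assumes "finite I" "\<And>i. i \<in> I \<Longrightarrow> pi_definable L a V (Q i)"
  shows "pi_definable L a V (\<lambda>M e. \<forall>i\<in>I. Q i M e)"
  using assms
proof (induction I)
  case empty
  then show ?case using definable_True by simp
next
  case (insert i I)
  then have "pi_definable L a V (\<lambda>M e. Q i M e \<and> (\<forall>i\<in>I. Q i M e))"
    by (intro pi_definable_and) simp_all
  then show ?case by simp
qed

lemma condition_decide:
  assumes cond: "condition L b F K st" and "0 < b" "qfree A" "fm_wf L A" "fv A \<subseteq> {..<length rs}"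
  shows "condition L b F K ((A, rs) # st) \<or> condition L b F K ((Neg A, rs) # st)"
proof -
  obtain N e where Ne: "(N, e) \<in> satisfiers K st" using cond by (auto simp: condition_def)
  then have "(N, e) \<in> satisfiers K ((A, rs) # st) \<or> (N, e) \<in> satisfiers K ((Neg A, rs) # st)"
    by (simp add: satisfiers_Cons)
  moreover have "Pi_in 0 A" "Pi_in 0 (Neg A)" using assms(3) by (simp_all add: Pi_in_zero)
  ultimately show ?thesis
    using cond assms(2-5) unfolding condition_def by auto
qed

lemma condition_function_value:
  assumes cond: "condition L b F K st" and "0 < b" and func: "(i, length us) \<in> funs L"
    and K: "\<And>N. N \<in> K \<Longrightarrow> is_structure L N"
  shows "\<exists>v. condition L b F K ((Eq (App i (map Var [0..<length us])) (Var (length us)), us @ [v]) # st)"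
proof -
  obtain N e where Ne: "(N, e) \<in> satisfiers K st" using cond by (auto simp: condition_def)
  from condition_fresh[OF cond, of us] obtain B where B: "\<forall>c\<in>set us. c < B"
    "\<forall>N e e'. (N, e) \<in> satisfiers K st \<longrightarrow> (\<forall>c<B. e' c = e c) \<longrightarrow> range e' \<subseteq> univ N \<longrightarrow>
       (N, e') \<in> satisfiers K st" by (elim exE conjE)
  define e2 where "e2 = e(B := fun_interp N i (map e us))"
  have N: "is_structure L N" "range e \<subseteq> univ N" using Ne K by (auto simp: satisfiers_def)
  then have "set (map e us) \<subseteq> univ N" by auto
  then have "fun_interp N i (map e us) \<in> univ N"
    using N(1) func unfolding is_structure_def by (metis length_map)
  then have "range e2 \<subseteq> univ N" using N(2) by (auto simp: e2_def)
  then have "(N, e2) \<in> satisfiers K st" by (intro B(2)[rule_format, OF Ne]) (auto simp: e2_def)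
  moreover have "map e2 us = map e us" using B(1) by (auto simp: e2_def)
  moreover have "map (\<lambda>x. e2 ((us @ [B]) ! x)) [0..<length us] = map e2 us"
    by (intro nth_equalityI) (auto simp: nth_append)
  moreover have "e2 B = fun_interp N i (map e us)" by (simp add: e2_def)
  moreover have "(us @ [B]) ! length us = B" by simp
  ultimately have "(N, e2) \<in> satisfiers K st"
    "sat N (\<lambda>x. e2 ((us @ [B]) ! x)) (Eq (App i (map Var [0..<length us])) (Var (length us)))"
    by (simp_all add: o_def del: map_eq_conv nth_append_length)
  then have "(N, e2) \<in> satisfiers K ((Eq (App i (map Var [0..<length us])) (Var (length us)), us @ [B]) # st)"
    unfolding satisfiers_Cons by blast
  then show ?thesis
    using cond assms(2) func unfolding condition_def
    by (intro exI[of _ B]) (auto simp: Pi_in_zero list_all_iff intro!: exI[of _ 0])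
qed

lemma Pi_in_not_Ex: "Pi_in c q \<Longrightarrow> q \<noteq> Ex x r"
  by (auto elim: Pi_in.cases)

text \<open>A Pi formula never begins with \<open>Ex\<close>, so block and matrix can be read off
  the formula. The truth proof uses this to identify the matrix in a condition with the one in the
  hierarchy rule.\<close>

lemma foldr_Ex_unique:
  "(\<And>x p. q \<noteq> Ex x p) \<Longrightarrow> (\<And>x p. r \<noteq> Ex x p) \<Longrightarrow> foldr Ex xs q = foldr Ex ys r \<Longrightarrow>
     xs = ys \<and> q = r"
proof (induction xs arbitrary: ys)
  case Nil
  then show ?case by (cases ys) auto
next
  case (Cons x xs)
  show ?case
  proof (cases ys)
    case Nil
    then show ?thesis using Cons.prems(2)[of x "foldr Ex xs q"] Cons.prems(3) by simp
  next
    case (Cons y zs)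
    then show ?thesis using Cons.IH[OF Cons.prems(1,2), of zs] Cons.prems(3) by simp
  qed
qed

text \<open>Omitting types by finite conditions. For each tuple of names and each realized type t,
  some condition bounds the type of the tuple by t or forces a formula outside t. If t is the type
  of the tuple in the limit model, the second case would make that formula true there; so the first
  holds, and the finite condition is the support. Countably many realized types give countably many
  requirements.\<close>

theorem atomic_model_exists:
  assumes b: "0 < b" and T: "sentence L T" "Pi_in (osuc b) T" and ne: "Mod L T \<noteq> {}"
    and cnt: "countable {Sigma_type L b M as | M as. M \<in> Mod L T \<and> set as \<subseteq> univ M}"
  shows "\<exists>M \<in> Mod L T. atomic_model L b (Mod L T) M"
proof -
  let ?K = "Mod L T"
  define Types where "Types = {Sigma_type L b M as | M as. M \<in> ?K \<and> set as \<subseteq> univ M}"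
  \<comment> \<open>One formula for each pair of types with \<open>t'\<close> not included in
    \<open>t\<close>: so a countable \<open>F\<close> contains enough formulas to leave every type
    that can be left.\<close>
  define \<theta> where "\<theta> t' t = (SOME p. p \<in> t' - t)" for t' t :: "fm set"
  define F where "F = (\<Union>p \<in> insert T {\<theta> t' t | t' t. t' \<in> Types \<and> t \<in> Types}. subformulas p)"
  have "countable {\<theta> t' t | t' t. t' \<in> Types \<and> t \<in> Types}"
  proof -
    have "{\<theta> t' t | t' t. t' \<in> Types \<and> t \<in> Types} = (\<lambda>(t', t). \<theta> t' t) ` (Types \<times> Types)" by auto
    then show ?thesis using cnt by (simp add: Types_def)
  qed
  then have cF: "countable F" unfolding F_def using countable_subformulas by auto
  have F_sub: "subformulas p \<subseteq> F" if "p \<in> F" for p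
    using that subformulas_trans unfolding F_def by blast
  have TF: "T \<in> F" unfolding F_def using subformulas_self by blast
  have \<theta>F: "\<theta> t' t \<in> F" if "t' \<in> Types" "t \<in> Types" for t' t
    unfolding F_def using subformulas_self that by blast
  define P where "P = condition L b F ?K"
  let ?S = "satisfiers ?K"
  define E where "E = {(p, rs :: nat list). p \<in> F \<and> (\<exists>a. 0 < a \<and> a \<le> b \<and> Sigma_in a p) \<and> fm_wf L p \<and>
     fv p \<subseteq> {..<length rs}}"
  \<comment> \<open>\<open>D1\<close> to \<open>D3\<close> decide equality and relations and name
    function values, \<open>D4\<close> provides witnesses, and \<open>D5\<close> bounds or avoids
    types.\<close>
  define D1 where "D1 = (\<lambda>(u, v). {st. (\<forall>(N, e)\<in>?S st. e u = e v) \<or> (\<forall>(N, e)\<in>?S st. e u \<noteq> e v)})"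
  define D2 where "D2 = (\<lambda>(i, us). {st. (\<forall>(N, e)\<in>?S st. rel_interp N i (map e us)) \<or>
      (\<forall>(N, e)\<in>?S st. \<not> rel_interp N i (map e us))})"
  define D3 where "D3 = (\<lambda>(i, us). {st. \<exists>v. \<forall>(N, e)\<in>?S st. fun_interp N i (map e us) = e v})"
  define D4 where "D4 = (\<lambda>(p, rs). {st. (\<forall>(N, e)\<in>?S st. \<not> sat N (\<lambda>x. e (rs ! x)) p) \<or>
      (\<exists>Q i xs q rs'. p = Disj Q \<and> Q i = foldr Ex xs q \<and>
        (\<forall>x. x < length rs \<longrightarrow> x \<notin> set xs \<longrightarrow> rs' ! x = rs ! x) \<and> (q, rs') \<in> set st)})"
  define D5 where "D5 = (\<lambda>(rs, t). {st. (\<forall>(N, e)\<in>?S st. Sigma_type L b N (map e rs) \<subseteq> t) \<or>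
      (\<exists>p\<in>F. Sigma_in b p \<and> fm_wf L p \<and> fv p \<subseteq> {..<length rs} \<and> p \<notin> t \<and>
        (\<forall>(N, e)\<in>?S st. sat N (\<lambda>x. e (rs ! x)) p))})"
  define \<D> where "\<D> = range D1 \<union> D2 ` {(i, us). (i, length us) \<in> rels L} \<union>
     D3 ` {(i, us). (i, length us) \<in> funs L} \<union> D4 ` E \<union> D5 ` (UNIV \<times> Types)"
  have "countable E"
    by (rule countable_subset[of _ "F \<times> UNIV"]) (use cF in \<open>auto simp: E_def\<close>)
  then have cD: "countable \<D>" using cnt unfolding \<D>_def by (simp add: Types_def)
  have P_Nil: "P []"
  proof -
    from ne obtain N where N: "N \<in> ?K" by blast
    then obtain a where "a \<in> univ N" by (auto simp: Mod_def is_structure_def)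
    then have "(N, \<lambda>_. a) \<in> ?S []" using N by (auto simp: satisfiers_def)
    then show ?thesis by (auto simp: P_def condition_def)
  qed
  have struct: "is_structure L N" if "N \<in> ?K" for N using that by (simp add: Mod_def)
  have witness: "\<exists>st'. P st' \<and> set st \<subseteq> set st' \<and> st' \<in> D4 (p, rs) \<and> (\<forall>(N, e)\<in>?S st'. sat N (\<lambda>x. e (rs ! x)) p)"
    if st: "P st" "(p, rs) \<in> E" "(N, e) \<in> ?S st" "sat N (\<lambda>x. e (rs ! x)) p" for st p rs N e
  proof -
    from st(2) obtain a where a: "p \<in> F" "0 < a" "a \<le> b" "Sigma_in a p" "fm_wf L p" "fv p \<subseteq> {..<length rs}"
      by (auto simp: E_def)
    from a(2,4) obtain Q where Q: "p = Disj Q" by (auto elim: Sigma_in.cases)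
    obtain i xs q rs' where q: "Q i = foldr Ex xs q" "\<And>x. x < length rs \<Longrightarrow> x \<notin> set xs \<Longrightarrow> rs' ! x = rs ! x"
       "condition L b F ?K ((q, rs') # st)"
      using condition_witness[OF st(1)[unfolded P_def], of a Q rs N e] a st(3,4) F_sub unfolding Q by blast
    have "sat N (\<lambda>x. e (rs ! x)) p" if Ne: "(N, e) \<in> ?S ((q, rs') # st)" for N e
    proof -
      from Ne have s: "sat N (\<lambda>x. e (rs' ! x)) q" by (simp add: satisfiers_Cons)
      have rng: "range e \<subseteq> univ N" using Ne by (simp add: satisfiers_def)
      define e' where "e' x = (if x \<in> set xs \<or> x < length rs then e (rs' ! x) else e (rs ! x))" for x
      have "fv (Q i) \<subseteq> {..<length rs}" using a(6) unfolding Q by auto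
      then have "fv q \<subseteq> {..<length rs} \<union> set xs" unfolding q(1) fv_foldr_Ex by auto
      then have "sat N e' q" using s by (subst sat_cong[where e' = "\<lambda>x. e (rs' ! x)"]) (auto simp: e'_def)
      moreover have "reassign N xs (\<lambda>x. e (rs ! x)) e'"
        using rng q(2) by (auto simp: reassign_def e'_def)
      ultimately have "sat N (\<lambda>x. e (rs ! x)) (Q i)" unfolding q(1) sat_foldr_Ex by blast
      then show ?thesis unfolding Q by auto
    qed
    then have "\<forall>(N, e)\<in>?S ((q, rs') # st). sat N (\<lambda>x. e (rs ! x)) p" by blast
    moreover have "(q, rs') # st \<in> D4 (p, rs)"
      using q(1,2) Q unfolding D4_def prod.case mem_Collect_eq
      by (intro disjI2 exI[of _ Q] exI[of _ i] exI[of _ xs] exI[of _ q] exI[of _ rs']) simp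
    moreover have "P ((q, rs') # st)" using q(3) by (simp add: P_def)
    ultimately show ?thesis by (intro exI[of _ "(q, rs') # st"]) auto
  qed
  have dense: "\<exists>st'. P st' \<and> set st \<subseteq> set st' \<and> st' \<in> D" if D: "D \<in> \<D>" and st: "P st" for D st
    using D unfolding \<D>_def
  proof (elim UnE imageE)
    fix uv assume "D = D1 uv"
    then obtain u v where D: "D = D1 (u, v)" by (cases uv) simp
    let ?A = "Eq (Var 0) (Var 1)"
    have "condition L b F ?K ((?A, [u, v]) # st) \<or> condition L b F ?K ((Neg ?A, [u, v]) # st)"
      by (rule condition_decide[OF st[unfolded P_def] b]) auto
    then show ?thesis
    proof
      assume "condition L b F ?K ((?A, [u, v]) # st)"
      then show ?thesis unfolding D D1_def P_def
        by (intro exI[of _ "(?A, [u, v]) # st"]) (auto simp: satisfiers_Cons)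
    next
      assume "condition L b F ?K ((Neg ?A, [u, v]) # st)"
      then show ?thesis unfolding D D1_def P_def
        by (intro exI[of _ "(Neg ?A, [u, v]) # st"]) (auto simp: satisfiers_Cons)
    qed
  next
    fix z assume "D = D2 z" "z \<in> {(i, us). (i, length us) \<in> rels L}"
    then obtain i us where D: "D = D2 (i, us)" and i: "(i, length us) \<in> rels L" by (cases z) simp
    let ?A = "Rel i (map Var [0..<length us])"
    have eq: "map (tm_val N (\<lambda>x. e (us ! x))) (map Var [0..<length us]) = map e us" for N e
      by (intro nth_equalityI) auto
    have "condition L b F ?K ((?A, us) # st) \<or> condition L b F ?K ((Neg ?A, us) # st)"
      by (rule condition_decide[OF st[unfolded P_def] b]) (use i in \<open>auto simp: list_all_iff\<close>)
    then show ?thesis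
    proof
      assume "condition L b F ?K ((?A, us) # st)"
      then show ?thesis unfolding D D2_def P_def
        by (intro exI[of _ "(?A, us) # st"]) (auto simp: satisfiers_Cons eq simp del: map_map)
    next
      assume "condition L b F ?K ((Neg ?A, us) # st)"
      then show ?thesis unfolding D D2_def P_def
        by (intro exI[of _ "(Neg ?A, us) # st"]) (auto simp: satisfiers_Cons eq simp del: map_map)
    qed
  next
    fix z assume "D = D3 z" "z \<in> {(i, us). (i, length us) \<in> funs L}"
    then obtain i us where D: "D = D3 (i, us)" and i: "(i, length us) \<in> funs L" by (cases z) simp
    obtain v where v: "condition L b F ?K
        ((Eq (App i (map Var [0..<length us])) (Var (length us)), us @ [v]) # st)"
      using condition_function_value[OF st[unfolded P_def] b i struct] by blast
    have eq: "map (tm_val N (\<lambda>x. e ((us @ [v]) ! x))) (map Var [0..<length us]) = map e us" for N e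
      by (intro nth_equalityI) (auto simp: nth_append)
    have "fun_interp N i (map e us) = e v"
      if "(N, e) \<in> ?S ((Eq (App i (map Var [0..<length us])) (Var (length us)), us @ [v]) # st)" for N e
      using that unfolding satisfiers_Cons sat.simps tm_val.simps eq by simp
    then show ?thesis unfolding D D3_def P_def
      using v by (intro exI[of _ "(Eq (App i (map Var [0..<length us])) (Var (length us)), us @ [v]) # st"])
        auto
  next
    fix z assume z: "D = D4 z" "z \<in> E"
    obtain p rs where [simp]: "z = (p, rs)" by (cases z)
    show ?thesis
    proof (cases "\<exists>(N, e)\<in>?S st. sat N (\<lambda>x. e (rs ! x)) p")
      case True
      then obtain N e where Ne: "(N, e) \<in> ?S st" "sat N (\<lambda>x. e (rs ! x)) p" by blast
      have "D = D4 (p, rs)" "(p, rs) \<in> E" using z by simp_all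
      with witness[OF st _ Ne] show ?thesis by blast
    next
      case False
      then have "st \<in> D4 (p, rs)" by (auto simp: D4_def)
      then show ?thesis using st z(1) by auto
    qed
  next
    fix z assume z: "D = D5 z" "z \<in> UNIV \<times> Types"
    then obtain rs t where D: "D = D5 (rs, t)" and t: "t \<in> Types" by (cases z) auto
    show ?thesis
    proof (cases "\<exists>(N, e)\<in>?S st. \<not> Sigma_type L b N (map e rs) \<subseteq> t")
      case True
      then obtain N e where Ne: "(N, e) \<in> ?S st" "\<not> Sigma_type L b N (map e rs) \<subseteq> t" by blast
      \<comment> \<open>A satisfier whose type is not included in \<open>t\<close> realizes a type
        of its own, so \<open>\<theta>\<close> has a formula in \<open>F\<close> for this pair, and
        it can be forced by adding one of its blocks.\<close>
      let ?t' = "Sigma_type L b N (map e rs)"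
      have "set (map e rs) \<subseteq> univ N" "N \<in> ?K" using Ne(1) by (auto simp: satisfiers_def)
      then have t': "?t' \<in> Types" unfolding Types_def by blast
      have p: "\<theta> ?t' t \<in> ?t' - t" unfolding \<theta>_def by (rule someI_ex) (use Ne(2) in blast)
      let ?p = "\<theta> ?t' t"
      from p have p': "Sigma_in b ?p" "fm_wf L ?p" "fv ?p \<subseteq> {..<length rs}" "sat N ((!) (map e rs)) ?p" "?p \<notin> t"
        by (auto simp: Sigma_type_def)
      have "sat N (\<lambda>x. e (rs ! x)) ?p = sat N ((!) (map e rs)) ?p"
        using p'(3) by (intro sat_cong) auto
      moreover have "(?p, rs) \<in> E" using p' \<theta>F[OF t' t] b by (auto simp: E_def)
      ultimately obtain st' where st': "P st'" "set st \<subseteq> set st'" "\<forall>(N, e)\<in>?S st'. sat N (\<lambda>x. e (rs ! x)) ?p"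
        using witness[OF st _ Ne(1), of ?p rs] p'(4) by blast
      moreover have "st' \<in> D5 (rs, t)" using p' \<theta>F[OF t' t] st'(3) by (auto simp: D5_def)
      ultimately show ?thesis unfolding D by blast
    next
      case False
      then have "st \<in> D5 (rs, t)" by (auto simp: D5_def)
      then show ?thesis using st D by blast
    qed
  qed
  have "\<exists>\<sigma>. (\<forall>n::nat. P (\<sigma> n) \<and> set (\<sigma> n) \<subseteq> set (\<sigma> (Suc n))) \<and> (\<forall>D\<in>\<D>. \<exists>n. \<sigma> n \<in> D)"
    by (rule generic_sequence[where le = "\<lambda>st st'. set st \<subseteq> set st'", OF cD P_Nil dense order_refl])
  then obtain \<sigma> where \<sigma>0: "\<forall>n::nat. P (\<sigma> n) \<and> set (\<sigma> n) \<subseteq> set (\<sigma> (Suc n))"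
      "\<forall>D\<in>\<D>. \<exists>n. \<sigma> n \<in> D" by (elim exE conjE)
  note \<sigma> = \<sigma>0(1)[THEN spec, THEN conjunct1] \<sigma>0(1)[THEN spec, THEN conjunct2] \<sigma>0(2)[THEN bspec]
  define S where "S n = ?S (\<sigma> n)" for n
  have S_decr: "S (Suc n) \<subseteq> S n" for n unfolding S_def by (rule satisfiers_mono[OF \<sigma>(2)])
  have S_ne: "S n \<noteq> {}" for n using \<sigma>(1)[of n] by (simp add: S_def P_def condition_def)
  have S_mono: "S n \<subseteq> S m" if "m \<le> n" for m n
    using lift_Suc_antimono_le[of S, OF S_decr that] .
  have "\<exists>n. (\<forall>(N, e)\<in>S n. e u = e v) \<or> (\<forall>(N, e)\<in>S n. e u \<noteq> e v)" for u v
  proof -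
    have "D1 (u, v) \<in> \<D>" unfolding \<D>_def by blast
    from \<sigma>(3)[OF this] show ?thesis unfolding D1_def S_def prod.case mem_Collect_eq .
  qed
  moreover have "\<exists>n. (\<forall>(N, e)\<in>S n. rel_interp N i (map e us)) \<or> (\<forall>(N, e)\<in>S n. \<not> rel_interp N i (map e us))"
    if "(i, length us) \<in> rels L" for i us
  proof -
    have "D2 (i, us) \<in> \<D>" using that unfolding \<D>_def by blast
    from \<sigma>(3)[OF this] show ?thesis unfolding D2_def S_def prod.case mem_Collect_eq .
  qed
  moreover have "\<exists>n v. \<forall>(N, e)\<in>S n. fun_interp N i (map e us) = e v" if "(i, length us) \<in> funs L" for i us
  proof -
    have "D3 (i, us) \<in> \<D>" using that unfolding \<D>_def by blast
    from \<sigma>(3)[OF this] show ?thesis unfolding D3_def S_def prod.case mem_Collect_eq .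
  qed
  ultimately have "\<exists>M rep. is_structure L M \<and> univ M = range rep \<and>
    (\<forall>A \<rho>. qfree A \<longrightarrow> fm_wf L A \<longrightarrow>
      (\<exists>n. \<forall>(N, e)\<in>S n. sat N (\<lambda>x. e (\<rho> x)) A = sat M (\<lambda>x. rep (\<rho> x)) A))"
    by (rule limit_structure[where S = S, OF S_decr S_ne])
  then obtain M rep where M: "is_structure L M" "univ M = range rep" and
    qf: "\<And>A \<rho>. qfree A \<Longrightarrow> fm_wf L A \<Longrightarrow>
      \<exists>n. \<forall>(N, e)\<in>S n. sat N (\<lambda>x. e (\<rho> x)) A = sat M (\<lambda>x. rep (\<rho> x)) A" by blast
  have qf_truth: "sat M (\<lambda>x. rep (\<rho> x)) A"
    if A: "qfree A" "fm_wf L A" "\<forall>(N, e)\<in>S n. sat N (\<lambda>x. e (\<rho> x)) A" for A \<rho> n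
  proof -
    obtain n' where n': "\<forall>(N, e)\<in>S n'. sat N (\<lambda>x. e (\<rho> x)) A = sat M (\<lambda>x. rep (\<rho> x)) A"
      using qf[OF A(1,2)] by blast
    obtain N e where "(N, e) \<in> S (max n n')" using S_ne[of "max n n'"] by auto
    then have "(N, e) \<in> S n" "(N, e) \<in> S n'" using S_mono[of n "max n n'"] S_mono[of n' "max n n'"] by auto
    then show ?thesis using n' A(3) by blast
  qed
  \<comment> \<open>One direction suffices: what a condition forces is true in the limit.
    Existential formulas need witnesses from \<open>D4\<close>, which serves levels up to b; a
    universal formula only passes its instances to the named elements, which gains one level and
    reaches \<open>T\<close>. Finiteness of the free variables allows listing their names as
    \<open>rs\<close>.\<close>
  have truth:
    "Sigma_in a p \<Longrightarrow> a \<le> b \<longrightarrow> fm_wf L p \<longrightarrow> finite (fv p) \<longrightarrow> p \<in> F \<or> qfree p \<longrightarrow>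
       (\<forall>n \<rho>. (\<forall>(N, e)\<in>S n. sat N (\<lambda>x. e (\<rho> x)) p) \<longrightarrow> sat M (\<lambda>x. rep (\<rho> x)) p)"
    "Pi_in a p \<Longrightarrow> a \<le> osuc b \<longrightarrow> fm_wf L p \<longrightarrow> finite (fv p) \<longrightarrow> p \<in> F \<or> qfree p \<longrightarrow>
       (\<forall>n \<rho>. (\<forall>(N, e)\<in>S n. sat N (\<lambda>x. e (\<rho> x)) p) \<longrightarrow> sat M (\<lambda>x. rep (\<rho> x)) p)" for a p
  proof (induction rule: Sigma_in_Pi_in.inducts)
    case (Sigma_zero p)
    then show ?case using qf_truth by blast
  next
    case (Pi_zero p)
    then show ?case using qf_truth by blast
  next
    case (Sigma_pos a Q)
    show ?case
    proof (intro impI allI)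
      fix n \<rho>
      assume a: "a \<le> b" and wf: "fm_wf L (Disj Q)" and fin: "finite (fv (Disj Q))"
        and F: "Disj Q \<in> F \<or> qfree (Disj Q)" and n: "\<forall>(N, e)\<in>S n. sat N (\<lambda>x. e (\<rho> x)) (Disj Q)"
      from F have F: "Disj Q \<in> F" by simp
      from fin obtain k where k: "\<forall>x\<in>fv (Disj Q). x < k" unfolding finite_nat_set_iff_bounded by (elim exE)
      define rs where "rs = map \<rho> [0..<k]"
      have rs: "sat N (\<lambda>x. e (rs ! x)) (Disj Q) = sat N (\<lambda>x. e (\<rho> x)) (Disj Q)" for N e
        by (rule sat_cong) (use k in \<open>simp add: rs_def del: fv.simps\<close>)
      have "Sigma_in a (Disj Q)"
        by (rule Sigma_in_Pi_in.Sigma_pos[OF Sigma_pos(1)]) (use Sigma_pos(2) in blast)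
      then have "(Disj Q, rs) \<in> E"
        using F a wf k Sigma_pos(1) by (auto simp: E_def rs_def simp del: fv.simps)
      then have "D4 (Disj Q, rs) \<in> \<D>" unfolding \<D>_def by blast
      from \<sigma>(3)[OF this] obtain n' where n': "\<sigma> n' \<in> D4 (Disj Q, rs)" by blast
      \<comment> \<open>A satisfier at a common later stage refutes the first alternative of
        \<open>D4\<close>.\<close>
      have "\<not> (\<forall>(N, e)\<in>S n'. \<not> sat N (\<lambda>x. e (rs ! x)) (Disj Q))"
      proof -
        obtain N e where "(N, e) \<in> S (max n n')" using S_ne[of "max n n'"] by auto
        then have "(N, e) \<in> S n" "(N, e) \<in> S n'" using S_mono[of n "max n n'"] S_mono[of n' "max n n'"] by auto
        then show ?thesis using n unfolding rs by blast
      qed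
      with n' obtain i xs q rs' where q: "Q i = foldr Ex xs q"
         "\<And>x. x < length rs \<Longrightarrow> x \<notin> set xs \<Longrightarrow> rs' ! x = rs ! x" "(q, rs') \<in> set (\<sigma> n')"
        unfolding D4_def S_def by auto
      have "condition L b F ?K (\<sigma> n')" using \<sigma>(1) by (simp add: P_def)
      with q(3) obtain c where c: "fm_wf L q" "c < b" "Pi_in c q" "fv q \<subseteq> {..<length rs'}" "q \<in> F \<or> qfree q"
        unfolding condition_def by blast
      obtain xs0 p0 c0 where p0: "Q i = foldr Ex xs0 p0" "c0 < a" "Pi_in c0 p0"
        and IH: "c0 \<le> osuc b \<longrightarrow> fm_wf L p0 \<longrightarrow> finite (fv p0) \<longrightarrow> p0 \<in> F \<or> qfree p0 \<longrightarrow>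
          (\<forall>n \<rho>. (\<forall>(N, e)\<in>S n. sat N (\<lambda>x. e (\<rho> x)) p0) \<longrightarrow> sat M (\<lambda>x. rep (\<rho> x)) p0)"
        using Sigma_pos(2)[of i] by (elim exE conjE)
      have "xs0 = xs \<and> p0 = q"
        using p0(1,3) c(3) unfolding q(1) by (intro foldr_Ex_unique Pi_in_not_Ex) auto
      then have eqs: "xs0 = xs" "p0 = q" by simp_all
      have "c0 \<le> osuc b" using p0(2) a less_osuc[of b] by auto
      moreover have "finite (fv q)" using c(4) finite_subset by blast
      moreover have "\<forall>(N, e)\<in>S n'. sat N (\<lambda>x. e (rs' ! x)) q"
        using q(3) by (auto simp: S_def satisfiers_def)
      ultimately have satq: "sat M (\<lambda>x. rep (rs' ! x)) q"
        using IH c(1,5) unfolding eqs by blast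
      define e' where "e' x = (if x \<in> set xs \<or> x < k then rep (rs' ! x) else rep (\<rho> x))" for x
      have "fv (Q i) \<subseteq> {..<k}" using k by auto
      then have "fv q \<subseteq> {..<k} \<union> set xs" unfolding q(1) fv_foldr_Ex by auto
      then have "sat M e' q = sat M (\<lambda>x. rep (rs' ! x)) q" by (intro sat_cong) (auto simp: e'_def)
      moreover have "reassign M xs (\<lambda>x. rep (\<rho> x)) e'"
        using q(2) by (auto simp: reassign_def e'_def M(2) rs_def)
      ultimately have "sat M (\<lambda>x. rep (\<rho> x)) (Q i)" using satq unfolding q(1) sat_foldr_Ex by blast
      then show "sat M (\<lambda>x. rep (\<rho> x)) (Disj Q)" by auto
    qed
  next
    case (Pi_pos a Q)
    show ?case
    proof (intro impI allI)
      fix n \<rho>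
      assume a: "a \<le> osuc b" and wf: "fm_wf L (Conj Q)" and fin: "finite (fv (Conj Q))"
        and F: "Conj Q \<in> F \<or> qfree (Conj Q)" and n: "\<forall>(N, e)\<in>S n. sat N (\<lambda>x. e (\<rho> x)) (Conj Q)"
      have "sat M (\<lambda>x. rep (\<rho> x)) (Q i)" for i
      proof -
        obtain xs q c where q: "Q i = foldr All xs q" "c < a"
          and IH: "c \<le> b \<longrightarrow> fm_wf L q \<longrightarrow> finite (fv q) \<longrightarrow> q \<in> F \<or> qfree q \<longrightarrow>
            (\<forall>n \<rho>. (\<forall>(N, e)\<in>S n. sat N (\<lambda>x. e (\<rho> x)) q) \<longrightarrow> sat M (\<lambda>x. rep (\<rho> x)) q)"
          using Pi_pos(2)[of i] by (elim exE conjE)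
        have "c \<le> b" using q(2) a less_osuc_iff less_le_trans by blast
        moreover have "fm_wf L (Q i)" using wf by simp
        then have "fm_wf L q" unfolding q(1) by simp
        moreover have "fv (Q i) \<subseteq> fv (Conj Q)" by auto
        then have "fv q \<subseteq> fv (Conj Q) \<union> set xs" unfolding q(1) fv_foldr_All by auto
        then have "finite (fv q)" using fin by (meson finite_subset finite_Un finite_set)
        moreover have "Q i \<in> subformulas (Conj Q)" using subformulas_self by auto
        then have "Q i \<in> F" using F F_sub[of "Conj Q"] by (simp del: subformulas.simps) blast
        then have "q \<in> F" using F_sub subformulas_foldr_All[of q xs] unfolding q(1) by blast
        ultimately have IH': "sat M (\<lambda>x. rep (\<rho> x)) q" if "\<forall>(N, e)\<in>S n. sat N (\<lambda>x. e (\<rho> x)) q" for \<rho>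
          using IH that by blast
        show ?thesis unfolding q(1) sat_foldr_All
        proof (intro allI impI)
          fix e' assume e': "reassign M xs (\<lambda>x. rep (\<rho> x)) e'"
          \<comment> \<open>Every element of \<open>M\<close> has a name, so quantification over
            elements becomes quantification over names.\<close>
          define \<rho>' where "\<rho>' x = (if x \<in> set xs then inv rep (e' x) else \<rho> x)" for x
          have "e' = (\<lambda>x. rep (\<rho>' x))"
            using e' by (auto simp: \<rho>'_def reassign_def M(2) f_inv_into_f)
          moreover have "sat M (\<lambda>x. rep (\<rho>' x)) q"
          proof (rule IH', clarify)
            fix N e assume Ne: "(N, e) \<in> S n"
            then have "sat N (\<lambda>x. e (\<rho> x)) (Q i)" using n by auto
            moreover have "reassign N xs (\<lambda>x. e (\<rho> x)) (\<lambda>x. e (\<rho>' x))"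
              using Ne by (auto simp: reassign_def \<rho>'_def S_def satisfiers_def)
            ultimately show "sat N (\<lambda>x. e (\<rho>' x)) q" unfolding q(1) sat_foldr_All by blast
          qed
          ultimately show "sat M e' q" by simp
        qed
      qed
      then show "sat M (\<lambda>x. rep (\<rho> x)) (Conj Q)" by simp
    qed
  qed
  note truthS = truth(1)[THEN mp, THEN mp, THEN mp, THEN mp, THEN spec, THEN spec, THEN mp]
  note truthP = truth(2)[THEN mp, THEN mp, THEN mp, THEN mp, THEN spec, THEN spec, THEN mp]
  have "\<forall>(N, e)\<in>S 0. sat N (\<lambda>x. e x) T"
    by (auto simp: S_def satisfiers_def Mod_def models_def)
  then have "sat M (\<lambda>x. rep x) T"
    using truthP[OF T(2), of 0 "\<lambda>x. x"] T(1) TF by (simp add: sentence_def)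
  then have MK: "M \<in> ?K" using M(1) sentence_iff_models[OF T(1)] by (auto simp: Mod_def)
  have "\<exists>ws Q. supports L b ?K M as ws Q" if as: "set as \<subseteq> univ M" for as
  proof -
    define rs where "rs = map (inv rep) as"
    have as_rs: "as = map rep rs"
      using as unfolding rs_def M(2) by (intro nth_equalityI) (auto simp: f_inv_into_f subset_iff)
    let ?t = "Sigma_type L b M as"
    have "?t \<in> Types" using MK as unfolding Types_def by blast
    then have "D5 (rs, ?t) \<in> \<D>" unfolding \<D>_def by blast
    from \<sigma>(3)[OF this] obtain n where n: "\<sigma> n \<in> D5 (rs, ?t)" by blast
    \<comment> \<open>Such a formula would be true of the tuple in \<open>M\<close> and hence belong
      to its type.\<close>
    have "\<not> (p \<in> F \<and> Sigma_in b p \<and> fm_wf L p \<and> fv p \<subseteq> {..<length rs} \<and> p \<notin> ?t \<and>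
        (\<forall>(N, e)\<in>S n. sat N (\<lambda>x. e (rs ! x)) p))" for p
    proof
      assume p: "p \<in> F \<and> Sigma_in b p \<and> fm_wf L p \<and> fv p \<subseteq> {..<length rs} \<and> p \<notin> ?t \<and>
        (\<forall>(N, e)\<in>S n. sat N (\<lambda>x. e (rs ! x)) p)"
      have "finite (fv p)" using p finite_subset by blast
      then have "sat M (\<lambda>x. rep (rs ! x)) p"
        using p by (intro truthS[of b p n "(!) rs"] order_refl) blast+
      moreover have "sat M (\<lambda>x. rep (rs ! x)) p = sat M ((!) as) p"
        using p by (intro sat_cong) (auto simp: as_rs)
      ultimately show False using p by (auto simp: Sigma_type_def as_rs)
    qed
    with n have below: "\<forall>(N, e)\<in>S n. Sigma_type L b N (map e rs) \<subseteq> ?t"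
      unfolding D5_def S_def by blast
    have cond: "condition L b F ?K (\<sigma> n)" using \<sigma>(1) by (simp add: P_def)
    \<comment> \<open>\<open>B\<close> bounds all names in use. Including 0 makes it positive, so
      that a list of \<open>B\<close> elements has a first entry, which later serves as the value of
      all names from \<open>B\<close> on.\<close>
    have "finite (insert 0 (set rs \<union> (\<Union>(q, us)\<in>set (\<sigma> n). set us)))" by auto
    then obtain B where B: "\<forall>c \<in> insert 0 (set rs \<union> (\<Union>(q, us)\<in>set (\<sigma> n). set us)). c < B"
      unfolding finite_nat_set_iff_bounded by (elim exE)
    have B_fact: "us ! x < B" if "(q, us) \<in> set (\<sigma> n)" "x < length us" for q us x
    proof -
      have "us ! x \<in> (\<Union>(q, us)\<in>set (\<sigma> n). set us)" using that by (intro UN_I[OF that(1)]) simp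
      with B show ?thesis by blast
    qed
    let ?k = "length as"
    have k: "length rs = ?k" by (simp add: as_rs)
    have B_rs: "rs ! i < B" if "i < ?k" for i using B that k nth_mem[of i rs] by auto
    \<comment> \<open>The facts of the condition with the name c read at position
      \<open>?k + c\<close>: the tuple comes first, then the values of all names below
      \<open>B\<close>.\<close>
    define A where "A st N e \<longleftrightarrow> (\<forall>(q, us)\<in>set st. sat N (\<lambda>x. e (?k + us ! x)) q)"
      for st :: "(fm \<times> nat list) list" and N and e :: "nat \<Rightarrow> nat"
    have A_def': "\<exists>c<b. pi_definable L c {..<?k + B} (A st)" if "set st \<subseteq> set (\<sigma> n)" for st
      using that
    proof (induction st)
      case Nil
      then show ?case using b definable_True by (auto simp: A_def)
    next
      case (Cons f st)
      obtain q us where f: "f = (q, us)" by (cases f)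
      from Cons obtain c where c: "c < b" "pi_definable L c {..<?k + B} (A st)" by auto
      have mem: "(q, us) \<in> set (\<sigma> n)" using Cons.prems f by simp
      then obtain d where d: "fm_wf L q" "d < b" "Pi_in d q" "fv q \<subseteq> {..<length us}"
        using cond unfolding condition_def by blast
      have "pi_definable L d ((\<lambda>x. ?k + us ! x) ` {..<length us}) (\<lambda>N e. sat N (\<lambda>x. e (?k + us ! x)) q)"
        using pi_definable_rename[OF pi_definableI[OF d(3,1,4)], of "\<lambda>x. ?k + us ! x"] by simp
      then have "pi_definable L d {..<?k + B} (\<lambda>N e. sat N (\<lambda>x. e (?k + us ! x)) q)"
        by (rule pi_definable_vars) (use B_fact[OF mem] in auto)
      then have "pi_definable L (max c d) {..<?k + B} (\<lambda>N e. sat N (\<lambda>x. e (?k + us ! x)) q)"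
        by (rule pi_definable_mono) simp
      moreover have "pi_definable L (max c d) {..<?k + B} (A st)"
        by (rule pi_definable_mono[OF c(2)]) simp
      ultimately have "pi_definable L (max c d) {..<?k + B}
          (\<lambda>N e. sat N (\<lambda>x. e (?k + us ! x)) q \<and> A st N e)" by (rule pi_definable_and)
      moreover have "(\<lambda>N e. sat N (\<lambda>x. e (?k + us ! x)) q \<and> A st N e) = A (f # st)"
        by (intro ext) (simp add: A_def f)
      ultimately show ?case using c(1) d(2) by (intro exI[of _ "max c d"]) simp
    qed
    obtain c where c: "c < b" "pi_definable L c {..<?k + B} (A (\<sigma> n))" using A_def' by blast
    have "pi_definable L c {..<?k + B} (\<lambda>N e. e i = e (?k + rs ! i))" if "i < ?k" for i
      using qfree_definable(2)[of "Eq (Var i) (Var (?k + rs ! i))" L "{..<?k + B}" c] that B_rs[OF that]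
      by simp
    then have "pi_definable L c {..<?k + B} (\<lambda>N e. \<forall>i\<in>{..<?k}. e i = e (?k + rs ! i))"
      by (intro pi_definable_finite_Ball) auto
    from pi_definable_and[OF this c(2)]
    have defQ: "pi_definable L c {..<?k + B} (\<lambda>N e. (\<forall>i\<in>{..<?k}. e i = e (?k + rs ! i)) \<and> A (\<sigma> n) N e)" .
    \<comment> \<open>The equations tie the tuple to the values of its own names.\<close>
    let ?Q = "\<lambda>N e. (\<forall>i\<in>{..<?k}. e i = e (?k + rs ! i)) \<and> A (\<sigma> n) N e"
    let ?ws = "map rep [0..<B]"
    have "supports L b ?K M as ?ws ?Q"
      unfolding supports_def
    proof (intro conjI ballI allI impI)
      show "\<exists>c<b. pi_definable L c {..<length (as @ ?ws)} ?Q" using c(1) defQ by auto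
      show "set ?ws \<subseteq> univ M" by (auto simp: M(2))
      fix i assume "i \<in> {..<?k}"
      then show "(as @ ?ws) ! i = (as @ ?ws) ! (?k + rs ! i)"
        using B_rs[of i] by (simp add: nth_append) (simp add: as_rs)
    next
      show "A (\<sigma> n) M ((!) (as @ ?ws))" unfolding A_def
      proof (clarify)
        fix q us assume mem: "(q, us) \<in> set (\<sigma> n)"
        then obtain d where d: "fm_wf L q" "d < b" "Pi_in d q" "fv q \<subseteq> {..<length us}" "q \<in> F \<or> qfree q"
          using cond unfolding condition_def by blast
        have "\<forall>(N, e)\<in>S n. sat N (\<lambda>x. e (us ! x)) q"
          using mem by (auto simp: S_def satisfiers_def)
        moreover have "finite (fv q)" using d(4) finite_subset by blast
        moreover have "d \<le> osuc b" using d(2) less_osuc[of b] by auto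
        ultimately have "sat M (\<lambda>x. rep (us ! x)) q"
          using d(1,3,5) by (intro truthP[of d q n "(!) us"])
        moreover have "sat M (\<lambda>x. (as @ ?ws) ! (?k + us ! x)) q = sat M (\<lambda>x. rep (us ! x)) q"
        proof (rule sat_cong)
          fix x assume "x \<in> fv q"
          then have "us ! x < B" using B_fact[OF mem] d(4) by auto
          then show "(as @ ?ws) ! (?k + us ! x) = rep (us ! x)" by (simp add: nth_append)
        qed
        ultimately show "sat M (\<lambda>x. (as @ ?ws) ! (?k + us ! x)) q" by simp
      qed
    next
      fix N cs ds
      assume N: "N \<in> ?K" and l: "length cs = ?k" "length ds = length ?ws" and s: "set (cs @ ds) \<subseteq> univ N"
        and Q: "?Q N ((!) (cs @ ds))"
      have "0 < B" using B by blast
      then have d0: "ds ! 0 \<in> univ N" using l(2) s by auto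
      define e where "e c = (if c < B then ds ! c else ds ! 0)" for c
      have dsc: "(cs @ ds) ! (?k + j) = ds ! j" for j using l(1) by (simp add: nth_append)
      have "range e \<subseteq> univ N" using d0 s l(2) by (auto simp: e_def)
      moreover have "sat N (\<lambda>x. e (us ! x)) q" if mem: "(q, us) \<in> set (\<sigma> n)" for q us
      proof -
        have fvq: "fv q \<subseteq> {..<length us}" using cond mem unfolding condition_def by blast
        have "sat N (\<lambda>x. (cs @ ds) ! (?k + us ! x)) q" using Q mem unfolding A_def by blast
        moreover have "sat N (\<lambda>x. e (us ! x)) q = sat N (\<lambda>x. (cs @ ds) ! (?k + us ! x)) q"
        proof (rule sat_cong)
          fix x assume "x \<in> fv q"
          then have "us ! x < B" using B_fact[OF mem] fvq by auto
          then show "e (us ! x) = (cs @ ds) ! (?k + us ! x)" by (simp add: e_def dsc)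
        qed
        ultimately show ?thesis by simp
      qed
      ultimately have "(N, e) \<in> S n" using N by (auto simp: S_def satisfiers_def)
      then have "Sigma_type L b N (map e rs) \<subseteq> ?t" using below by blast
      moreover have "map e rs = cs"
      proof (rule nth_equalityI)
        fix i assume "i < length (map e rs)"
        then have i: "i < ?k" by (simp add: k)
        then have "(cs @ ds) ! i = (cs @ ds) ! (?k + rs ! i)" using Q by blast
        then show "map e rs ! i = cs ! i" using i k l(1) B_rs[OF i] by (simp add: e_def dsc nth_append)
      qed (simp add: k l(1))
      ultimately show "Sigma_type L b N cs \<subseteq> ?t" by simp
    qed
    then show ?thesis by blast
  qed
  then show ?thesis using MK unfolding atomic_model_def by blast
qed

section \<open>Relative computability\<close>

lemma recursive_in_id: "recursive_in X (\<lambda>n. n)"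
  using recursive_in.pair[OF recursive_in.left recursive_in.right, of X] by simp

lemma recursive_in_const: "recursive_in X (\<lambda>n. c)"
proof (induction c)
  case 0
  show ?case by (rule recursive_in.zero)
next
  case (Suc c)
  show ?case using recursive_in.comp[OF recursive_in.suc Suc] by simp
qed

lemma recursive_in_Suc: "recursive_in X f \<Longrightarrow> recursive_in X (\<lambda>n. Suc (f n))"
  by (rule recursive_in.comp[OF recursive_in.suc])

lemma recursive_in_fst: "recursive_in X f \<Longrightarrow> recursive_in X (\<lambda>n. fst (prod_decode (f n)))"
  by (rule recursive_in.comp[OF recursive_in.left])

lemma recursive_in_snd: "recursive_in X f \<Longrightarrow> recursive_in X (\<lambda>n. snd (prod_decode (f n)))"
  by (rule recursive_in.comp[OF recursive_in.right])

text \<open>The rule \<open>prec\<close> packs parameter, counter and previous value into one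
  number. Here the input itself is the parameter, which suits backward reasoning.\<close>

lemma recursive_in_rec_nat:
  assumes "recursive_in X f" "recursive_in X h"
    and g: "recursive_in X (\<lambda>z. g (fst (prod_decode z)) (fst (prod_decode (snd (prod_decode z))))
      (snd (prod_decode (snd (prod_decode z)))))"
  shows "recursive_in X (\<lambda>n. rec_nat (f n) (g n) (h n))"
  using recursive_in.comp[OF recursive_in.prec[OF assms(1) g]
    recursive_in.pair[OF recursive_in_id assms(2)]] by simp

definition decidable_in :: "nat set \<Rightarrow> (nat \<Rightarrow> bool) \<Rightarrow> bool" where
  "decidable_in X P \<longleftrightarrow> recursive_in X (\<lambda>n. if P n then 1 else 0)"

lemma recursive_in_pred: "recursive_in X f \<Longrightarrow> recursive_in X (\<lambda>n. f n - 1)"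
proof -
  assume f: "recursive_in X f"
  have "recursive_in X (\<lambda>n. rec_nat 0 (\<lambda>y r. y) (f n))"
    by (intro recursive_in_rec_nat f recursive_in_const recursive_in_fst recursive_in_snd recursive_in_id)
  moreover have "rec_nat 0 (\<lambda>y r. y) m = m - 1" for m :: nat by (cases m) auto
  ultimately show ?thesis by simp
qed

lemma recursive_in_add:
  assumes "recursive_in X f" "recursive_in X g"
  shows "recursive_in X (\<lambda>n. f n + g n)"
proof -
  have "recursive_in X (\<lambda>n. rec_nat (f n) (\<lambda>y r. Suc r) (g n))"
    by (intro recursive_in_rec_nat assms recursive_in_Suc recursive_in_snd recursive_in_id)
  moreover have "rec_nat a (\<lambda>y r. Suc r) m = a + m" for a m :: nat by (induction m) auto
  ultimately show ?thesis by simp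
qed

lemma recursive_in_diff:
  assumes "recursive_in X f" "recursive_in X g"
  shows "recursive_in X (\<lambda>n. f n - g n)"
proof -
  have "recursive_in X (\<lambda>n. rec_nat (f n) (\<lambda>y r. r - 1) (g n))"
    by (intro recursive_in_rec_nat assms recursive_in_pred recursive_in_snd recursive_in_id)
  moreover have "rec_nat a (\<lambda>y r. r - 1) m = a - m" for a m :: nat by (induction m) auto
  ultimately show ?thesis by simp
qed

text \<open>Definition by cases is a recursion of length 0 or 1.\<close>

lemma recursive_in_if:
  assumes "decidable_in X P" "recursive_in X f" "recursive_in X g"
  shows "recursive_in X (\<lambda>n. if P n then f n else g n)"
proof -
  have "recursive_in X (\<lambda>n. rec_nat (g n) (\<lambda>y r. f n) (if P n then 1 else 0))"
    using assms(1) unfolding decidable_in_def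
    by (intro recursive_in_rec_nat assms(3) recursive_in.comp[OF assms(2)] recursive_in_fst recursive_in_id)
  moreover have "rec_nat a (\<lambda>y r. b) (if Q then 1 else 0) = (if Q then b else a)" for a b :: nat and Q
    by simp
  ultimately show ?thesis by simp
qed

lemma decidable_in_not:
  assumes "decidable_in X P"
  shows "decidable_in X (\<lambda>n. \<not> P n)"
proof -
  have "recursive_in X (\<lambda>n. if P n then 0 else 1)"
    by (intro recursive_in_if assms recursive_in_const)
  moreover have "(\<lambda>n. if P n then 0 else 1) = (\<lambda>n. if \<not> P n then 1 else (0::nat))" by auto
  ultimately show ?thesis by (simp add: decidable_in_def)
qed

lemma decidable_in_and:
  assumes "decidable_in X P" "decidable_in X Q"
  shows "decidable_in X (\<lambda>n. P n \<and> Q n)"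
proof -
  have "recursive_in X (\<lambda>n. if P n then (if Q n then 1 else 0) else 0)"
    using assms(2) by (intro recursive_in_if[OF assms(1)] recursive_in_const) (simp add: decidable_in_def)
  moreover have "(\<lambda>n. if P n then (if Q n then 1 else 0) else 0) = (\<lambda>n. if P n \<and> Q n then 1 else (0::nat))"
    by auto
  ultimately show ?thesis by (simp add: decidable_in_def)
qed

lemma decidable_in_or:
  assumes "decidable_in X P" "decidable_in X Q"
  shows "decidable_in X (\<lambda>n. P n \<or> Q n)"
  using decidable_in_not[OF decidable_in_and[OF decidable_in_not[OF assms(1)] decidable_in_not[OF assms(2)]]]
  by simp

lemma decidable_in_imp:
  assumes "decidable_in X P" "decidable_in X Q"
  shows "decidable_in X (\<lambda>n. P n \<longrightarrow> Q n)"
  unfolding imp_conv_disj by (rule decidable_in_or[OF decidable_in_not[OF assms(1)] assms(2)])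

lemma decidable_in_iff:
  assumes "decidable_in X P" "decidable_in X Q"
  shows "decidable_in X (\<lambda>n. P n \<longleftrightarrow> Q n)"
  unfolding iff_conv_conj_imp
  by (rule decidable_in_and[OF decidable_in_imp[OF assms] decidable_in_imp[OF assms(2,1)]])

lemma decidable_in_zero: "recursive_in X f \<Longrightarrow> decidable_in X (\<lambda>n. f n = 0)"
proof -
  assume f: "recursive_in X f"
  have "recursive_in X (\<lambda>n. rec_nat 1 (\<lambda>y r. 0) (f n))"
    by (intro recursive_in_rec_nat f recursive_in_const)
  moreover have "rec_nat 1 (\<lambda>y r. 0) m = (if m = 0 then 1 else 0 :: nat)" for m by (cases m) auto
  ultimately show ?thesis by (simp add: decidable_in_def)
qed

lemma decidable_in_le:
  "recursive_in X f \<Longrightarrow> recursive_in X g \<Longrightarrow> decidable_in X (\<lambda>n. f n \<le> g n)"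
  using decidable_in_zero[OF recursive_in_diff, of X f g] by simp

lemma decidable_in_less:
  "recursive_in X f \<Longrightarrow> recursive_in X g \<Longrightarrow> decidable_in X (\<lambda>n. f n < g n)"
  using decidable_in_le[OF recursive_in_Suc, of X f g] by (simp add: Suc_le_eq)

lemma decidable_in_eq:
  "recursive_in X f \<Longrightarrow> recursive_in X g \<Longrightarrow> decidable_in X (\<lambda>n. f n = g n)"
  using decidable_in_and[OF decidable_in_le[of X f g] decidable_in_le[of X g f]]
  by (simp add: order_eq_iff)

text \<open>A bounded search is a recursion on the bound that remembers whether a witness was
  met.\<close>

lemma decidable_in_bex:
  assumes "recursive_in X b"
    and P: "decidable_in X (\<lambda>z. P (fst (prod_decode z)) (snd (prod_decode z)))"
  shows "decidable_in X (\<lambda>n. \<exists>m<b n. P n m)"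
proof -
  have "recursive_in X (\<lambda>z. (\<lambda>z. if P (fst (prod_decode z)) (snd (prod_decode z)) then 1 else 0)
      (prod_encode (fst (prod_decode z), fst (prod_decode (snd (prod_decode z))))))"
    using P unfolding decidable_in_def
    by (rule recursive_in.comp) (intro recursive_in.pair recursive_in_fst recursive_in_snd recursive_in_id)
  then have P': "decidable_in X (\<lambda>z. P (fst (prod_decode z)) (fst (prod_decode (snd (prod_decode z)))))"
    by (simp add: decidable_in_def)
  have "recursive_in X (\<lambda>n. rec_nat 0 (\<lambda>y r. if P n y then 1 else r) (b n))"
    by (intro recursive_in_rec_nat assms(1) recursive_in_const recursive_in_if P' recursive_in_snd recursive_in_id)
  moreover have "rec_nat 0 (\<lambda>y r. if Q y then 1 else r) m = (if \<exists>y<m. Q y then 1 else 0 :: nat)" for Q m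
    by (induction m) (auto simp: less_Suc_eq)
  ultimately show ?thesis by (simp add: decidable_in_def)
qed

lemma decidable_in_ball:
  assumes "recursive_in X b"
    and "decidable_in X (\<lambda>z. P (fst (prod_decode z)) (snd (prod_decode z)))"
  shows "decidable_in X (\<lambda>n. \<forall>m<b n. P n m)"
  using decidable_in_not[OF decidable_in_bex[OF assms(1) decidable_in_not[OF assms(2)]]] by simp

lemma decidable_in_mem:
  "computes_set X D \<Longrightarrow> recursive_in X f \<Longrightarrow> decidable_in X (\<lambda>n. f n \<in> D)"
  using recursive_in.comp[of X "\<lambda>n. if n \<in> D then 1 else 0" f]
  by (simp add: computes_set_def decidable_in_def)

lemma computes_set_iff: "computes_set X D \<longleftrightarrow> decidable_in X (\<lambda>n. n \<in> D)"
  by (simp add: computes_set_def decidable_in_def)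

lemma computes_set_self: "computes_set X X"
  unfolding computes_set_def by (rule recursive_in.query)

section \<open>Decoding of lists\<close>

definition drop_code :: "nat \<Rightarrow> nat \<Rightarrow> nat" where
  "drop_code c i = rec_nat c (\<lambda>_ r. snd (prod_decode (r - 1))) i"

definition nth_code :: "nat \<Rightarrow> nat \<Rightarrow> nat" where
  "nth_code c i = fst (prod_decode (drop_code c i - 1))"

text \<open>The number of nonempty tails; \<open>c\<close> steps suffice because a list is not
  longer than its code.\<close>

definition length_code :: "nat \<Rightarrow> nat" where
  "length_code c = rec_nat 0 (\<lambda>i r. if drop_code c i = 0 then r else Suc r) c"

lemma recursive_in_drop_code:
  "recursive_in X f \<Longrightarrow> recursive_in X g \<Longrightarrow> recursive_in X (\<lambda>n. drop_code (f n) (g n))"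
  unfolding drop_code_def
  by (intro recursive_in_rec_nat recursive_in_snd recursive_in_pred recursive_in_id)

lemma recursive_in_nth_code:
  "recursive_in X f \<Longrightarrow> recursive_in X g \<Longrightarrow> recursive_in X (\<lambda>n. nth_code (f n) (g n))"
  unfolding nth_code_def by (intro recursive_in_fst recursive_in_pred recursive_in_drop_code)

lemma recursive_in_length_code:
  assumes "recursive_in X f"
  shows "recursive_in X (\<lambda>n. length_code (f n))"
  unfolding length_code_def
  by (intro recursive_in_rec_nat recursive_in_if decidable_in_zero recursive_in_drop_code assms
    recursive_in_const recursive_in_Suc recursive_in_fst recursive_in_snd recursive_in_id
    recursive_in.comp[OF assms])

lemma drop_code: "drop_code (list_encode xs) i = list_encode (drop i xs)"
proof (induction i)
  case (Suc i)
  have "drop_code (list_encode xs) (Suc i) = snd (prod_decode (list_encode (drop i xs) - 1))"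
    using Suc by (simp add: drop_code_def)
  also have "\<dots> = list_encode (tl (drop i xs))"
  proof (cases "drop i xs")
    case Nil
    \<comment> \<open>The code 0 of the empty list is a fixed point of the step, since truncated
      subtraction keeps it at 0 and both components of 0 are 0.\<close>
    have "prod_encode (0, 0) = 0" by (simp add: prod_encode_def)
    then have "prod_decode 0 = (0, 0)" using prod_encode_inverse[of "(0, 0)"] by (simp only:)
    then show ?thesis using Nil by simp
  qed simp
  also have "tl (drop i xs) = drop (Suc i) xs" by (simp add: drop_Suc tl_drop)
  finally show ?case .
qed (simp add: drop_code_def)

lemma nth_code: "i < length xs \<Longrightarrow> nth_code (list_encode xs) i = xs ! i"
  unfolding nth_code_def drop_code by (simp flip: Cons_nth_drop_Suc)

lemma list_encode_zero_iff: "list_encode xs = 0 \<longleftrightarrow> xs = []"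
  by (cases xs) auto

lemma length_le_list_encode: "length xs \<le> list_encode xs"
proof (induction xs)
  case (Cons x xs)
  then show ?case using le_prod_encode_2[of "list_encode xs" x] by simp
qed simp

lemma length_code: "length_code (list_encode xs) = length xs"
proof -
  have "rec_nat 0 (\<lambda>i r. if drop_code (list_encode xs) i = 0 then r else Suc r) m = min m (length xs)" for m
    by (induction m) (auto simp: drop_code list_encode_zero_iff min_def)
  then show ?thesis using length_le_list_encode[of xs] by (simp add: length_code_def)
qed

text \<open>A countable syntax for the closure rules, made for counting the recursive functions.
  \<open>run\<close> is total: where a minimization finds no zero its value is arbitrary, which is
  harmless because the recursive functions only have to be contained in the range.\<close>

datatype program = Query | Zero | Successor | Left | Right | Pair program program
  | Comp program program | Prec program program | Mu program

instance program :: countable by countable_datatype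

primrec run :: "nat set \<Rightarrow> program \<Rightarrow> nat \<Rightarrow> nat" where
  "run X Query = (\<lambda>n. if n \<in> X then 1 else 0)"
| "run X Zero = (\<lambda>n. 0)"
| "run X Successor = Suc"
| "run X Left = (\<lambda>n. fst (prod_decode n))"
| "run X Right = (\<lambda>n. snd (prod_decode n))"
| "run X (Pair p q) = (\<lambda>n. prod_encode (run X p n, run X q n))"
| "run X (Comp p q) = (\<lambda>n. run X p (run X q n))"
| "run X (Prec p q) = (\<lambda>n. case prod_decode n of (a, m) \<Rightarrow>
      rec_nat (run X p a) (\<lambda>y r. run X q (prod_encode (a, prod_encode (y, r)))) m)"
| "run X (Mu p) = (\<lambda>a. LEAST m. run X p (prod_encode (a, m)) = 0)"

lemma recursive_in_run: "recursive_in X f \<Longrightarrow> f \<in> range (run X)"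
proof (induction rule: recursive_in.induct)
  case query
  show ?case by (rule range_eqI[of _ _ Query]) simp
next
  case zero
  show ?case by (rule range_eqI[of _ _ Zero]) simp
next
  case suc
  show ?case by (rule range_eqI[of _ _ Successor]) simp
next
  case left
  show ?case by (rule range_eqI[of _ _ Left]) simp
next
  case right
  show ?case by (rule range_eqI[of _ _ Right]) simp
next
  case (pair f g)
  then obtain p q where "f = run X p" "g = run X q" by blast
  then show ?case by (intro range_eqI[of _ _ "Pair p q"]) simp
next
  case (comp f g)
  then obtain p q where "f = run X p" "g = run X q" by blast
  then show ?case by (intro range_eqI[of _ _ "Comp p q"]) simp
next
  case (prec f g)
  then obtain p q where "f = run X p" "g = run X q" by blast
  then show ?case by (intro range_eqI[of _ _ "Prec p q"]) simp
next
  case (mu f)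
  then obtain p where "f = run X p" by blast
  then show ?case by (intro range_eqI[of _ _ "Mu p"]) simp
qed

lemma countable_recursive_in: "countable {f. recursive_in X f}"
  by (rule countable_subset[of _ "range (run X)"]) (use recursive_in_run in auto)


section \<open>The least ordinal that is not computable\<close>

abbreviation segment :: "omega1 \<Rightarrow> omega1 rel" where
  "segment a \<equiv> {(b, c). b \<le> c \<and> c < a}"

lemma Field_segment: "Field (segment a) = {..<a}"
  by (auto simp: Field_def)

lemma Well_order_segment: "Well_order (segment a)"
proof -
  have "wf (segment a - Id)"
    by (rule wf_subset[OF wf]) auto
  then show ?thesis
    unfolding well_order_on_def linear_order_on_def partial_order_on_def preorder_on_def Field_segment
    by (auto simp: refl_on_def trans_def antisym_def total_on_def)
qed

lemma segment_less: "a < b \<Longrightarrow> segment a <o segment b"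
proof -
  assume ab: "a < b"
  have "Restr (segment b) (underS (segment b) a) = segment a"
    using ab by (auto simp: underS_def)
  then have "segment a =o Restr (segment b) (underS (segment b) a)"
    using ordIso_reflexive[OF Well_order_segment] by simp
  moreover have "a \<in> Field (segment b)" using ab by (simp add: Field_segment)
  ultimately show ?thesis
    using ordLess_iff_ordIso_Restr[OF Well_order_segment Well_order_segment] by blast
qed

lemma segment_ordIso: "segment a =o segment b \<Longrightarrow> a = b"
  using not_ordLess_ordIso[OF segment_less, of a b] not_ordLess_ordIso[OF segment_less, of b a]
    ordIso_symmetric[of "segment a" "segment b"]
  by (cases a b rule: linorder_cases) blast+

text \<open>The content is that the minimum exists. Otherwise each of the uncountably many ordinals
  would be the type of an order computable in \<open>X\<close>; different types have different
  characteristic functions, and only countably many functions are recursive in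
  \<open>X\<close>.\<close>

lemma omega1_rel_not_computable:
  "\<not> (\<exists>r :: nat rel. Well_order r \<and> computes_set X (prod_encode ` r) \<and> r =o segment (omega1_rel X))"
  unfolding omega1_rel_def
proof (rule LeastI_ex, rule ccontr)
  assume "\<not> (\<exists>a. \<not> (\<exists>r :: nat rel. Well_order r \<and> computes_set X (prod_encode ` r) \<and> r =o segment a))"
  then have "\<forall>a. \<exists>r :: nat rel. computes_set X (prod_encode ` r) \<and> r =o segment a" by blast
  from choice[OF this] obtain r :: "omega1 \<Rightarrow> nat rel" where
    r: "\<forall>a. computes_set X (prod_encode ` r a) \<and> r a =o segment a" by (elim exE)
  define f where "f a = (\<lambda>n. if n \<in> prod_encode ` r a then 1 else 0 :: nat)" for a
  have "inj f"
  proof (rule injI)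
    fix a b assume "f a = f b"
    then have "f a n = f b n" for n by simp
    moreover have "n \<in> prod_encode ` r c \<longleftrightarrow> f c n = 1" for c n by (simp add: f_def)
    ultimately have "n \<in> prod_encode ` r a \<longleftrightarrow> n \<in> prod_encode ` r b" for n by simp
    then have "prod_encode ` r a = prod_encode ` r b" by blast
    then have "r a = r b" by (simp add: inj_image_eq_iff inj_prod_encode)
    moreover have "r a =o segment a" "r b =o segment b" using r by blast+
    ultimately have ra: "r a =o segment a" "r a =o segment b" by simp_all
    show "a = b"
      by (rule segment_ordIso[OF ordIso_transitive[OF ordIso_symmetric[OF ra(1)] ra(2)]])
  qed
  moreover have "range f \<subseteq> {f. recursive_in X f}"
    using r by (auto simp: f_def computes_set_def)
  ultimately show False
    using countable_recursive_in uncountable_omega1 by (metis countable_image_inj_on countable_subset)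
qed

text \<open>If \<open>omega1_rel X\<close> were at most the type of \<open>r\<close>, it would be
  the type of \<open>r\<close> itself or of the part of \<open>r\<close> below some a, and this part
  is computable with a as a constant. So \<open>r\<close> embeds into the segment of
  \<open>omega1_rel X\<close>, and the embedding is the rank.\<close>

lemma computable_well_order_rank:
  fixes r :: "nat rel"
  assumes wo: "Well_order r" and comp: "computes_set X (prod_encode ` r)"
  shows "\<exists>e. (\<forall>c\<in>Field r. e c < omega1_rel X) \<and> (\<forall>c d. (c, d) \<in> r \<longrightarrow> c \<noteq> d \<longrightarrow> e c < (e d :: omega1))"
proof -
  let ?k = "omega1_rel X"
  have "\<not> segment ?k \<le>o r"
  proof
    assume le: "segment ?k \<le>o r"
    show False
    proof (cases "segment ?k =o r")
      case True
      then show False using omega1_rel_not_computable[of X] wo comp ordIso_symmetric by blast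
    next
      case False
      with le have "segment ?k <o r" by (simp add: ordLeq_iff_ordLess_or_ordIso)
      then obtain a where a: "a \<in> Field r" "segment ?k =o Restr r (underS r a)"
        using ordLess_iff_ordIso_Restr[OF wo Well_order_segment] by blast
      let ?r = "Restr r (underS r a)"
      have "n \<in> prod_encode ` ?r \<longleftrightarrow> n \<in> prod_encode ` r \<and>
          fst (prod_decode n) \<noteq> a \<and> prod_encode (fst (prod_decode n), a) \<in> prod_encode ` r \<and>
          snd (prod_decode n) \<noteq> a \<and> prod_encode (snd (prod_decode n), a) \<in> prod_encode ` r" for n
      proof -
        obtain u v where n: "n = prod_encode (u, v)" by (metis prod_decode_inverse surj_pair)
        show ?thesis unfolding n by (auto simp: underS_def inj_image_mem_iff[OF inj_prod_encode])
      qed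
      moreover have "decidable_in X (\<lambda>n. n \<in> prod_encode ` r \<and>
          fst (prod_decode n) \<noteq> a \<and> prod_encode (fst (prod_decode n), a) \<in> prod_encode ` r \<and>
          snd (prod_decode n) \<noteq> a \<and> prod_encode (snd (prod_decode n), a) \<in> prod_encode ` r)"
        by (intro decidable_in_and decidable_in_mem[OF comp] decidable_in_not decidable_in_eq
          recursive_in.pair recursive_in_fst recursive_in_snd recursive_in_id recursive_in_const)
      ultimately have "computes_set X (prod_encode ` ?r)"
        unfolding computes_set_iff by presburger
      moreover have "Well_order ?r" by (rule Well_order_Restr[OF wo])
      ultimately show False using omega1_rel_not_computable[of X] ordIso_symmetric[OF a(2)] by blast
    qed
  qed
  then have "r \<le>o segment ?k" using ordLeq_total[OF wo Well_order_segment] by blast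
  then obtain f where f: "embed r (segment ?k) f" unfolding ordLeq_def by blast
  have "compat r (segment ?k) f" "inj_on f (Field r)"
    using embed_iff_compat_inj_on_ofilter[OF wo Well_order_segment] f by blast+
  then have "f c < f d" if "(c, d) \<in> r" "c \<noteq> d" for c d
    using that by (force simp: compat_def inj_on_def Field_def order_less_le)
  moreover have "f c < ?k" if "c \<in> Field r" for c
    using embed_in_Field[OF f that] by (simp add: Field_segment)
  ultimately show ?thesis by blast
qed


section \<open>The Kleene--Brouwer order\<close>

fun kb_le :: "nat list \<Rightarrow> nat list \<Rightarrow> bool" where
  "kb_le xs [] \<longleftrightarrow> True"
| "kb_le [] (y # ys) \<longleftrightarrow> False"
| "kb_le (x # xs) (y # ys) \<longleftrightarrow> x < y \<or> x = y \<and> kb_le xs ys"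

lemma kb_le_refl: "kb_le xs xs"
  by (induction xs) auto

lemma kb_le_antisym: "kb_le xs ys \<Longrightarrow> kb_le ys xs \<Longrightarrow> xs = ys"
proof (induction xs ys rule: kb_le.induct)
  case (1 xs)
  then show ?case by (cases xs) auto
qed auto

lemma kb_le_trans: "kb_le xs ys \<Longrightarrow> kb_le ys zs \<Longrightarrow> kb_le xs zs"
proof (induction xs zs arbitrary: ys rule: kb_le.induct)
  case (2 z zs)
  then show ?case by (cases ys) auto
next
  case (3 x xs z zs)
  then show ?case by (cases ys) auto
qed auto

lemma kb_le_total: "kb_le xs ys \<or> kb_le ys xs"
  by (induction xs ys rule: kb_le.induct) auto

lemma kb_le_append: "kb_le (xs @ ys) xs"
  by (induction xs) auto

lemma kb_le_same_prefix: "kb_le (ps @ xs) (ps @ ys) \<longleftrightarrow> kb_le xs ys"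
  by (induction ps) auto

lemma ex_nat_split: "(\<exists>i. P i) \<longleftrightarrow> P 0 \<or> (\<exists>i. P (Suc i))"
proof
  assume "\<exists>i. P i"
  then obtain i where "P i" by blast
  then show "P 0 \<or> (\<exists>i. P (Suc i))" by (cases i) auto
qed auto

text \<open>A bounded search for the first difference, the form in which the order is seen to be
  computable. The value \<open>i = length ys\<close> covers the case that \<open>ys\<close> is an
  initial segment of \<open>xs\<close>.\<close>

lemma kb_le_iff:
  "kb_le xs ys \<longleftrightarrow> (\<exists>i<Suc (length ys). i \<le> length xs \<and> (\<forall>j<i. xs ! j = ys ! j) \<and>
     (i = length ys \<or> i < length xs \<and> i < length ys \<and> xs ! i < ys ! i))"
proof (induction xs ys rule: kb_le.induct)
  case (1 xs)
  show ?case by simp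
next
  case (2 y ys)
  show ?case by simp
next
  case (3 x xs y ys)
  show ?case
  proof (cases "x = y")
    case True
    then have IH: "kb_le xs ys \<longleftrightarrow> (\<exists>i<Suc (length ys). i \<le> length xs \<and> (\<forall>j<i. xs ! j = ys ! j) \<and>
       (i = length ys \<or> i < length xs \<and> i < length ys \<and> xs ! i < ys ! i))"
      by (intro 3)
    show ?thesis
      unfolding kb_le.simps IH by (subst ex_nat_split) (simp add: True All_less_Suc2)
  next
    case False
    then show ?thesis
      unfolding kb_le.simps by (subst ex_nat_split) (simp add: All_less_Suc2)
  qed
qed

text \<open>Without infinite paths, extension by one entry is well-founded, and a least element of a
  set is found by recursion on it: among the sequences with a common stem, choose the least next
  entry and continue with the longer stem.\<close>

lemma kb_well_order:
  fixes T :: "nat list set"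
  assumes pref: "\<And>xs x. xs @ [x] \<in> T \<Longrightarrow> xs \<in> T"
    and nopath: "\<not> (\<exists>f. \<forall>n. map f [0..<n] \<in> T)"
  defines "r \<equiv> {(list_encode xs, list_encode ys) | xs ys. xs \<in> T \<and> ys \<in> T \<and> kb_le xs ys}"
  shows "Well_order r" "Field r = list_encode ` T"
proof -
  have pref': "xs \<in> T" if "xs @ ys \<in> T" for xs ys
    using that
  proof (induction ys rule: rev_induct)
    case (snoc y ys)
    then show ?case using pref[of "xs @ ys" y] by simp
  qed simp
  show F: "Field r = list_encode ` T" unfolding r_def Field_def using kb_le_refl by auto
  have "wf {(xs @ [x], xs) | xs x. xs @ [x] \<in> T}" (is "wf ?E")
    unfolding wf_iff_no_infinite_down_chain
  proof
    assume "\<exists>s. \<forall>i. (s (Suc i), s i) \<in> ?E"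
    then obtain s where "\<forall>i. (s (Suc i), s i) \<in> ?E" by (elim exE)
    then have sE: "(s (Suc i), s i) \<in> ?E" for i by (rule spec)
    have "\<forall>i. \<exists>x. s (Suc i) = s i @ [x] \<and> s (Suc i) \<in> T"
    proof
      fix i
      from sE[of i] obtain xs x where "s (Suc i) = xs @ [x]" "s i = xs" "xs @ [x] \<in> T" by blast
      then have "s (Suc i) = s i @ [x] \<and> s (Suc i) \<in> T" by (simp only: simp_thms)
      then show "\<exists>x. s (Suc i) = s i @ [x] \<and> s (Suc i) \<in> T" by (rule exI)
    qed
    from choice[OF this] obtain g where g': "\<forall>i. s (Suc i) = s i @ [g i] \<and> s (Suc i) \<in> T" by (elim exE)
    have g: "s (Suc i) = s i @ [g i]" "s (Suc i) \<in> T" for i using g' by blast+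
    have s: "s i = s 0 @ map g [0..<i]" for i by (induction i) (auto simp: g(1))
    \<comment> \<open>The chain may start at a nonempty node; the entries of that node come first,
      so that the path starts at the root.\<close>
    define f where "f i = (if i < length (s 0) then s 0 ! i else g (i - length (s 0)))" for i
    have "map f [0..<n] = take n (s (Suc n))" for n
      by (rule nth_equalityI) (auto simp: f_def s[of "Suc n"] nth_append)
    then have "map f [0..<n] \<in> T" for n
      using pref'[of "take n (s (Suc n))" "drop n (s (Suc n))"] g(2)[of n] by simp
    then show False using nopath by blast
  qed
  then have least: "\<exists>ys\<in>Q. \<forall>zs\<in>Q. kb_le ys zs"
    if "Q \<subseteq> T" "Q \<noteq> {}" "\<And>ys. ys \<in> Q \<Longrightarrow> take (length xs) ys = xs" for Q xs
    using that
  proof (induction xs arbitrary: Q rule: wf_induct_rule)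
    case (less xs)
    show ?case
    \<comment> \<open>The stem itself comes last among its extensions, so it matters only if it is
      alone.\<close>
    proof (cases "Q = {xs}")
      case True
      then show ?thesis by (simp add: kb_le_refl)
    next
      case False
      then obtain ys where ys: "ys \<in> Q" "ys \<noteq> xs" using less.prems(2) by blast
      define Y where "Y = {y. \<exists>zs\<in>Q. take (Suc (length xs)) zs = xs @ [y]}"
      have "\<exists>y. take (Suc (length xs)) zs = xs @ [y]" if "zs \<in> Q" "zs \<noteq> xs" for zs
      proof -
        have "length xs < length zs"
          using less.prems(3)[OF that(1)] that(2) by (metis leI take_all)
        then show ?thesis using less.prems(3)[OF that(1)] by (simp add: take_Suc_conv_app_nth)
      qed note split = this
      then have "Y \<noteq> {}" using ys unfolding Y_def by blast
      define y where "y = (LEAST y. y \<in> Y)"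
      have y: "y \<in> Y" "\<And>y'. y' \<in> Y \<Longrightarrow> y \<le> y'"
        unfolding y_def using \<open>Y \<noteq> {}\<close> by (auto intro: LeastI Least_le)
      define Q' where "Q' = {zs \<in> Q. take (Suc (length xs)) zs = xs @ [y]}"
      have "Q' \<noteq> {}" using y(1) unfolding Y_def Q'_def by blast
      then obtain ws where ws: "ws \<in> Q'" by blast
      have "take (Suc (length xs)) ws \<in> T"
        by (rule pref'[where ys = "drop (Suc (length xs)) ws"], subst append_take_drop_id)
          (use ws less.prems(1) in \<open>auto simp: Q'_def\<close>)
      then have "xs @ [y] \<in> T" using ws by (simp add: Q'_def)
      then have "(xs @ [y], xs) \<in> ?E" by blast
      from less.IH[OF this, of Q'] obtain us where us: "us \<in> Q'" "\<forall>zs\<in>Q'. kb_le us zs"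
        using less.prems(1) \<open>Q' \<noteq> {}\<close> by (auto simp: Q'_def)
      have us_eq: "us = xs @ y # drop (Suc (length xs)) us"
        using us(1) append_take_drop_id[of "Suc (length xs)" us] by (simp add: Q'_def)
      have "kb_le us zs" if zs: "zs \<in> Q" for zs
      proof (cases "zs = xs")
        case True
        then show ?thesis using us_eq kb_le_append by metis
      next
        case False
        then obtain z where z: "take (Suc (length xs)) zs = xs @ [z]" using split zs by blast
        then have zs_eq: "zs = xs @ z # drop (Suc (length xs)) zs"
          using append_take_drop_id[of "Suc (length xs)" zs] by simp
        have "z \<in> Y" using z zs unfolding Y_def by blast
        show ?thesis
        proof (cases "z = y")
          case True
          then show ?thesis using us(2) z zs by (auto simp: Q'_def)
        next
          case False
          then have "y < z" using y(2)[OF \<open>z \<in> Y\<close>] by simp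
          then show ?thesis by (subst us_eq, subst zs_eq) (simp add: kb_le_same_prefix)
        qed
      qed
      then show ?thesis using us(1) by (auto simp: Q'_def)
    qed
  qed
  have "wf (r - Id)"
    unfolding wf_eq_minimal
  proof (intro allI impI)
    fix Q :: "nat set" and c assume c: "c \<in> Q"
    show "\<exists>z\<in>Q. \<forall>y. (y, z) \<in> r - Id \<longrightarrow> y \<notin> Q"
    proof (cases "\<exists>xs\<in>T. list_encode xs \<in> Q")
      case True
      define Q' where "Q' = {xs \<in> T. list_encode xs \<in> Q}"
      obtain ys where ys: "ys \<in> Q'" "\<And>zs. zs \<in> Q' \<Longrightarrow> kb_le ys zs"
        using least[of Q' "[]"] True unfolding Q'_def by auto
      have "y \<notin> Q" if "(y, list_encode ys) \<in> r - Id" for y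
      proof
        assume "y \<in> Q"
        with that obtain zs where zs: "y = list_encode zs" "zs \<in> Q'" "kb_le zs ys"
          unfolding r_def Q'_def by (auto simp: list_encode_eq)
        then show False using ys(2)[OF zs(2)] kb_le_antisym that by blast
      qed
      then show ?thesis using ys(1) unfolding Q'_def by blast
    next
      case False
      then show ?thesis using c unfolding r_def by (intro bexI[of _ c]) auto
    qed
  qed
  moreover have "refl_on (Field r) r" unfolding F refl_on_def by (auto simp: r_def list_encode_eq kb_le_refl)
  moreover have "trans r" unfolding r_def trans_def using kb_le_trans by (fastforce simp: list_encode_eq)
  moreover have "antisym r" unfolding r_def antisym_def using kb_le_antisym by (auto simp: list_encode_eq)
  moreover have "total_on (Field r) r" unfolding F total_on_def using kb_le_total by (auto simp: r_def list_encode_eq)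
  moreover have "r \<subseteq> Field r \<times> Field r" by (auto simp: Field_def)
  ultimately show "Well_order r"
    unfolding well_order_on_def linear_order_on_def partial_order_on_def preorder_on_def by blast
qed

section \<open>Nadel's bound on the Scott rank\<close>

declare list_encode.simps [simp del]

lemma iso_map_Sigma_type:
  assumes M: "is_structure L M" and h: "iso_map L h M N" and as: "set as \<subseteq> univ M"
  shows "Sigma_type L b N (map h as) = Sigma_type L b M as"
proof -
  obtain u where u: "u \<in> univ M" using M by (auto simp: is_structure_def)
  have "sat N ((!) (map h as)) p = sat M ((!) as) p" if "fm_wf L p" "fv p \<subseteq> {..<length as}" for p
  proof -
    \<comment> \<open>Preservation of truth is known for assignments into the universe, so positions
      beyond the tuple get a default element.\<close>
    define e where "e i = (if i < length as then as ! i else u)" for i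
    have "e i \<in> univ M" for i using as u by (auto simp: e_def)
    then have "sat N (\<lambda>i. h (e i)) p = sat M e p" by (intro iso_map_sat[OF M h that(1)])
    moreover have "sat M e p = sat M ((!) as) p"
      using that(2) by (intro sat_cong) (auto simp: e_def)
    moreover have "sat N (\<lambda>i. h (e i)) p = sat N ((!) (map h as)) p"
      using that(2) by (intro sat_cong) (auto simp: e_def)
    ultimately show ?thesis by simp
  qed
  then show ?thesis by (auto simp: Sigma_type_def)
qed

section \<open>The tree of attempts to build an automorphism\<close>

lemma diagram_univ: "list_encode [0, a] \<in> diagram L B \<longleftrightarrow> a \<in> univ B"
  by (auto simp: diagram_def list_encode_eq simp del: list_encode.simps)

lemma diagram_rel: "list_encode (1 # i # as) \<in> diagram L B \<longleftrightarrow>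
    (i, length as) \<in> rels L \<and> set as \<subseteq> univ B \<and> rel_interp B i as"
  by (auto simp: diagram_def list_encode_eq simp del: list_encode.simps)

lemma diagram_fun: "list_encode (2 # i # b # as) \<in> diagram L B \<longleftrightarrow>
    (i, length as) \<in> funs L \<and> set as \<subseteq> univ B \<and> fun_interp B i as = b"
  by (auto simp: diagram_def list_encode_eq simp del: list_encode.simps)

text \<open>A finite partial map of \<open>B\<close> to itself is listed as a sequence \<open>z\<close> of codes of pairs.\<close>

definition corresponding :: "(nat \<Rightarrow> nat) \<Rightarrow> nat \<Rightarrow> nat \<Rightarrow> nat \<Rightarrow> bool" where
  "corresponding z m u v \<longleftrightarrow> length_code u = length_code v \<and>
     (\<forall>p<length_code u. (p < 2 \<longrightarrow> nth_code u p = nth_code v p) \<and>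
        (2 \<le> p \<longrightarrow> (\<exists>j<m. fst (prod_decode (z j)) = nth_code u p \<and> snd (prod_decode (z j)) = nth_code v p)))"

text \<open>At stage \<open>m\<close> only codes below \<open>m\<close> are compared, so the test is
  a bounded search; along an infinite path every code is compared eventually. The first clause makes
  the finite map well defined and injective. In \<open>corresponding\<close>, the entries 0 and 1 of
  a code are exempt from the map because in codes of relations and functions they are tag and
  symbol.\<close>

definition agreeing :: "nat set \<Rightarrow> (nat \<Rightarrow> nat) \<Rightarrow> nat \<Rightarrow> bool" where
  "agreeing D z m \<longleftrightarrow>
     (\<forall>i<m. \<forall>j<m. fst (prod_decode (z i)) = fst (prod_decode (z j)) \<longleftrightarrow>
        snd (prod_decode (z i)) = snd (prod_decode (z j))) \<and>
     (\<forall>u<m. \<forall>v<m. corresponding z m u v \<longrightarrow> (u \<in> D \<longleftrightarrow> v \<in> D))"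

text \<open>The first \<open>k\<close> pairs are listed by \<open>W\<close>; after them, the elements of \<open>B\<close> are put alternately into
  the range and the domain. If \<open>D\<close> is the diagram of \<open>B\<close>, then \<open>list_encode [0, i] \<in> D\<close> says that
  \<open>i\<close> is an element of \<open>B\<close>.\<close>

definition scheduled :: "nat set \<Rightarrow> nat \<Rightarrow> nat \<Rightarrow> (nat \<Rightarrow> nat) \<Rightarrow> nat \<Rightarrow> bool" where
  "scheduled D k W z m \<longleftrightarrow>
     (\<forall>j<m. list_encode [0, fst (prod_decode (z j))] \<in> D \<and> list_encode [0, snd (prod_decode (z j))] \<in> D \<and>
        (j < k \<longrightarrow> z j = nth_code W j)) \<and>
     (\<forall>i<m. list_encode [0, i] \<in> D \<longrightarrow>
        (k + (i + i) < m \<longrightarrow> snd (prod_decode (z (k + (i + i)))) = i) \<and>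
        (k + Suc (i + i) < m \<longrightarrow> fst (prod_decode (z (k + Suc (i + i)))) = i))"

lemma agreeing_cong:
  assumes "\<And>j. j < m \<Longrightarrow> z j = z' j"
  shows "agreeing D z m = agreeing D z' m"
proof -
  have "corresponding z m u v = corresponding z' m u v" for u v
    unfolding corresponding_def using assms by (simp cong: conj_cong)
  then show ?thesis unfolding agreeing_def using assms by simp
qed

lemma scheduled_cong:
  assumes "\<And>j. j < m \<Longrightarrow> z j = z' j"
  shows "scheduled D k W z m = scheduled D k W z' m"
  unfolding scheduled_def using assms by (simp cong: conj_cong)

text \<open>Every stage up to the length is tested, which makes the set closed under initial
  segments, hence a tree.\<close>

definition nodes :: "nat set \<Rightarrow> nat \<Rightarrow> nat \<Rightarrow> nat list set" where
  "nodes D k W = {zs. \<forall>m<Suc (length zs). scheduled D k W ((!) zs) m \<and> agreeing D ((!) zs) m}"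

lemma nodes_append:
  "zs @ [z] \<in> nodes D k W \<longleftrightarrow> zs \<in> nodes D k W \<and>
     scheduled D k W ((!) (zs @ [z])) (Suc (length zs)) \<and> agreeing D ((!) (zs @ [z])) (Suc (length zs))"
proof -
  have "scheduled D k W ((!) (zs @ [z])) m = scheduled D k W ((!) zs) m"
    "agreeing D ((!) (zs @ [z])) m = agreeing D ((!) zs) m" if "m < Suc (length zs)" for m
    using that by (auto simp: nth_append intro!: scheduled_cong agreeing_cong)
  then show ?thesis unfolding nodes_def by (auto simp: less_Suc_eq[of _ "Suc (length zs)"])
qed

lemma Nil_node: "[] \<in> nodes D k W"
  by (simp add: nodes_def scheduled_def agreeing_def)

lemmas decidability_rules = decidable_in_and decidable_in_imp decidable_in_iff decidable_in_ball
  decidable_in_bex decidable_in_less decidable_in_le decidable_in_eq decidable_in_or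
  recursive_in_nth_code recursive_in_length_code recursive_in_add recursive_in_Suc
  recursive_in.pair recursive_in_fst recursive_in_snd recursive_in_id recursive_in_const

text \<open>All quantifiers are bounded, and unfolding \<open>list_encode\<close> turns the codes in
  \<open>scheduled\<close> into pairing and successor.\<close>

lemma decidable_in_nodes:
  assumes D: "computes_set X D"
  shows "decidable_in X (\<lambda>c. \<forall>m<Suc (length_code c). scheduled D k W (nth_code c) m \<and> agreeing D (nth_code c) m)"
  unfolding scheduled_def agreeing_def corresponding_def list_encode.simps
  by (intro decidability_rules decidable_in_mem[OF D])

lemma node_code_iff:
  "list_encode zs \<in> list_encode ` nodes D k W \<longleftrightarrow> (\<forall>m<Suc (length_code (list_encode zs)).
     scheduled D k W (nth_code (list_encode zs)) m \<and> agreeing D (nth_code (list_encode zs)) m)"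
proof -
  have "scheduled D k W (nth_code (list_encode zs)) m = scheduled D k W ((!) zs) m"
    "agreeing D (nth_code (list_encode zs)) m = agreeing D ((!) zs) m" if "m < Suc (length zs)" for m
    using that by (auto simp: nth_code intro!: scheduled_cong agreeing_cong)
  then show ?thesis by (auto simp: nodes_def length_code inj_image_mem_iff[OF inj_list_encode])
qed

lemma computable_kb_order:
  fixes k W :: nat
  assumes D: "computes_set X D"
  defines "r \<equiv> {(list_encode xs, list_encode ys) | xs ys.
     xs \<in> nodes D k W \<and> ys \<in> nodes D k W \<and> kb_le xs ys}"
  shows "computes_set X (prod_encode ` r)"
proof -
  let ?node = "\<lambda>c. \<forall>m<Suc (length_code c). scheduled D k W (nth_code c) m \<and> agreeing D (nth_code c) m"
  let ?kb = "\<lambda>c d. \<exists>i<Suc (length_code d). i \<le> length_code c \<and> (\<forall>j<i. nth_code c j = nth_code d j) \<and>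
     (i = length_code d \<or> i < length_code c \<and> i < length_code d \<and> nth_code c i < nth_code d i)"
  have "n \<in> prod_encode ` r \<longleftrightarrow>
      ?node (fst (prod_decode n)) \<and> ?node (snd (prod_decode n)) \<and> ?kb (fst (prod_decode n)) (snd (prod_decode n))" for n
  proof -
    obtain xs ys where n: "n = prod_encode (list_encode xs, list_encode ys)"
      by (metis list_decode_inverse prod_decode_inverse surj_pair)
    have "n \<in> prod_encode ` r \<longleftrightarrow> xs \<in> nodes D k W \<and> ys \<in> nodes D k W \<and> kb_le xs ys"
      unfolding n inj_image_mem_iff[OF inj_prod_encode] r_def by (auto simp: list_encode_eq)
    moreover have "kb_le xs ys \<longleftrightarrow> ?kb (list_encode xs) (list_encode ys)"
      unfolding kb_le_iff length_code by (intro ex_cong1) (auto simp: nth_code)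
    moreover have "zs \<in> nodes D k W \<longleftrightarrow> ?node (list_encode zs)" for zs
      using node_code_iff[of zs D k W] unfolding inj_image_mem_iff[OF inj_list_encode] .
    ultimately show ?thesis unfolding n prod_encode_inverse fst_conv snd_conv by simp
  qed
  moreover have node: "decidable_in X (\<lambda>n. ?node (f n))" if "recursive_in X f" for f
    using recursive_in.comp[OF decidable_in_nodes[OF D, of k W, unfolded decidable_in_def] that]
    unfolding decidable_in_def .
  have "decidable_in X (\<lambda>n. ?node (fst (prod_decode n)) \<and> ?node (snd (prod_decode n)) \<and>
      ?kb (fst (prod_decode n)) (snd (prod_decode n)))"
    by (intro decidable_in_and node recursive_in_fst recursive_in_snd recursive_in_id)
      (intro decidability_rules)
  ultimately show ?thesis unfolding computes_set_iff by presburger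
qed

text \<open>The arguments in \<open>v\<close> are values of \<open>y\<close> and so lie in the
  universe; hence \<open>v\<close> is missing from the diagram because its atomic fact is false, not
  because it is ill-formed. That fact, with variables for its arguments, is the atom. A code of an
  element has no entries to be moved, so there \<open>v\<close> would equal
  \<open>u\<close>.\<close>

lemma corresponding_mismatch:
  fixes x y :: "nat \<Rightarrow> nat"
  assumes B: "is_structure L B" and U: "\<And>j. j < m \<Longrightarrow> y j \<in> univ B"
    and u: "u \<in> diagram L B" and v: "v \<notin> diagram L B" and len: "length_code u = length_code v"
    and head: "\<And>p. p < length_code u \<Longrightarrow> p < 2 \<Longrightarrow> nth_code u p = nth_code v p"
    and tail: "\<And>p. p < length_code u \<Longrightarrow> 2 \<le> p \<Longrightarrow> \<exists>j<m. x j = nth_code u p \<and> y j = nth_code v p"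
  shows "\<exists>A\<in>atoms L m. sat B x A \<and> \<not> sat B y A"
proof -
  obtain vs where vs: "v = list_encode vs" by (metis list_decode_inverse)
  \<comment> \<open>\<open>v\<close> repeats tag and symbol of \<open>u\<close>, and the arguments
    of both are read along one list \<open>js\<close> of positions.\<close>
  have split: "\<exists>js bs. vs = h # i # bs \<and> set js \<subseteq> {..<m} \<and> as = map x js \<and> bs = map y js"
    if us: "u = list_encode (h # i # as)" for h i as
  proof -
    have l: "length vs = Suc (Suc (length as))" using len unfolding us vs length_code by simp
    have "vs ! 0 = h" using head[of 0] l unfolding us vs length_code by (simp add: nth_code)
    moreover have "vs ! 1 = i" using head[of 1] l unfolding us vs length_code by (simp add: nth_code)
    ultimately obtain bs where bs: "vs = h # i # bs" using l
      by (cases vs; cases "tl vs") auto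
    have "\<exists>j<m. x j = as ! p \<and> y j = bs ! p" if "p < length as" for p
      using tail[of "Suc (Suc p)"] that l unfolding us vs bs length_code by (simp add: nth_code)
    then obtain g where g: "\<And>p. p < length as \<Longrightarrow> g p < m \<and> x (g p) = as ! p \<and> y (g p) = bs ! p"
      by metis
    have "as = map x (map g [0..<length as])" "bs = map y (map g [0..<length as])"
      using g l by (auto simp: bs intro!: nth_equalityI)
    moreover have "set (map g [0..<length as]) \<subseteq> {..<m}" using g by auto
    ultimately show ?thesis using bs by blast
  qed
  from u consider (univ) a where "u = list_encode [0, a]" "a \<in> univ B"
    | (rel) i as where "u = list_encode (1 # i # as)"
    | (func) i as where "u = list_encode (2 # i # fun_interp B i as # as)"
    unfolding diagram_def by blast
  then show ?thesis
  proof cases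
    case univ
    from split[OF univ(1)] have "vs = [0, a]" by auto
    then show ?thesis using univ v vs diagram_univ by blast
  next
    case rel
    from split[OF rel] obtain js bs where js: "vs = 1 # i # bs" "set js \<subseteq> {..<m}" "as = map x js" "bs = map y js"
      by (elim exE conjE)
    have ru: "(i, length js) \<in> rels L" "rel_interp B i (map x js)"
      using u unfolding rel diagram_rel js by auto
    have "set bs \<subseteq> univ B" using U js(2,4) by auto
    then have "\<not> rel_interp B i (map y js)"
      using v ru(1) unfolding vs js(1) diagram_rel js(4) by auto
    moreover have "map (tm_val B e) (map Var js) = map e js" for e by simp
    ultimately show ?thesis
      using atoms.intros(2)[OF ru(1) js(2)] ru(2) by (intro bexI[of _ "Rel i (map Var js)"]) (simp_all only: sat.simps, simp)
  next
    case func
    from split[OF func] obtain js bs where js: "vs = 2 # i # bs" "set js \<subseteq> {..<m}"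
        "fun_interp B i as # as = map x js" "bs = map y js"
      by (elim exE conjE)
    \<comment> \<open>In the code of a function fact the value precedes the arguments.\<close>
    then obtain j ks where ks: "js = j # ks" by (cases js) auto
    have fu: "(i, length ks) \<in> funs L" "fun_interp B i (map x ks) = x j"
      using u js(3) unfolding func diagram_fun ks by auto
    have "set (map y ks) \<subseteq> univ B" using U js(2) unfolding ks by auto
    then have "fun_interp B i (map y ks) \<noteq> y j"
      using v fu(1) unfolding vs js(1,4) ks list.map diagram_fun by auto
    moreover have "map (tm_val B e) (map Var ks) = map e ks" for e by simp
    ultimately show ?thesis
      using atoms.intros(3)[OF fu(1), of m j] js(2) fu(2) unfolding ks
      by (intro bexI[of _ "Eq (App i (map Var ks)) (Var j)"]) (simp_all only: sat.simps tm_val.simps, simp_all)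
  qed
qed

lemma not_agreeing_atom:
  assumes B: "is_structure L B"
    and U: "\<And>j. j < m \<Longrightarrow> fst (prod_decode (z j)) \<in> univ B \<and> snd (prod_decode (z j)) \<in> univ B"
    and na: "\<not> agreeing (diagram L B) z m"
  shows "\<exists>A\<in>atoms L m. sat B (\<lambda>j. fst (prod_decode (z j))) A \<noteq> sat B (\<lambda>j. snd (prod_decode (z j))) A"
proof -
  let ?x = "\<lambda>j. fst (prod_decode (z j))" and ?y = "\<lambda>j. snd (prod_decode (z j))"
  consider (eq) i j where "i < m" "j < m" "(?x i = ?x j) \<noteq> (?y i = ?y j)"
    | (uv) u v where "corresponding z m u v" "u \<in> diagram L B" "v \<notin> diagram L B"
    | (vu) u v where "corresponding z m u v" "v \<in> diagram L B" "u \<notin> diagram L B"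
    using na unfolding agreeing_def by blast
  then show ?thesis
  proof cases
    case eq
    then show ?thesis by (intro bexI[OF _ atoms.intros(1)[OF eq(1,2)]]) simp
  next
    case uv
    have "\<exists>A\<in>atoms L m. sat B ?x A \<and> \<not> sat B ?y A"
      by (rule corresponding_mismatch[OF B _ uv(2,3)]) (use uv(1) U in \<open>auto simp: corresponding_def\<close>)
    then show ?thesis by blast
  next
    case vu
    have "\<exists>A\<in>atoms L m. sat B ?y A \<and> \<not> sat B ?x A"
      by (rule corresponding_mismatch[OF B _ vu(2,3)]) (use vu(1) U in \<open>auto simp: corresponding_def\<close>)
    then show ?thesis by blast
  qed
qed

lemma corresponding_codes:
  assumes "\<And>j. j \<in> set js \<Longrightarrow> j < m"
  shows "corresponding z m (list_encode (h # i # map (\<lambda>j. fst (prod_decode (z j))) js))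
    (list_encode (h # i # map (\<lambda>j. snd (prod_decode (z j))) js))"
  unfolding corresponding_def length_code
proof (intro conjI allI impI)
  fix p assume p: "p < length (h # i # map (\<lambda>j. fst (prod_decode (z j))) js)"
  then have l: "p < length (h # i # map (\<lambda>j. snd (prod_decode (z j))) js)" by simp
  show "nth_code (list_encode (h # i # map (\<lambda>j. fst (prod_decode (z j))) js)) p =
      nth_code (list_encode (h # i # map (\<lambda>j. snd (prod_decode (z j))) js)) p" if "p < 2"
    unfolding nth_code[OF p] nth_code[OF l] using that by (cases p) (auto simp: less_Suc_eq)
  show "\<exists>j<m. fst (prod_decode (z j)) = nth_code (list_encode (h # i # map (\<lambda>j. fst (prod_decode (z j))) js)) p \<and>
      snd (prod_decode (z j)) = nth_code (list_encode (h # i # map (\<lambda>j. snd (prod_decode (z j))) js)) p" if "2 \<le> p"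
  proof -
    define q where "q = p - 2"
    then have q: "p = Suc (Suc q)" using that by simp
    then have "q < length js" using p by simp
    then show ?thesis unfolding nth_code[OF p] nth_code[OF l]
      using assms by (intro exI[of _ "js ! q"]) (simp add: q)
  qed
qed simp

text \<open>The schedule makes both coordinates of the path exhaust \<open>B\<close>, agreement at
  all stages makes the pairs an automorphism, and the first entries, prescribed by \<open>W\<close>,
  send \<open>as\<close> to \<open>bs\<close>.\<close>

lemma path_automorphism:
  assumes B: "is_structure L B" and len: "length as = length bs"
    and W: "W = list_encode (map prod_encode (zip as bs))"
    and path: "\<And>n. map f [0..<n] \<in> nodes (diagram L B) (length as) W"
  shows "\<exists>h. iso_map L h B B \<and> map h as = bs"
proof -
  let ?D = "diagram L B" and ?k = "length as"
  let ?x = "\<lambda>j. fst (prod_decode (f j))" and ?y = "\<lambda>j. snd (prod_decode (f j))"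
  have sched: "scheduled ?D ?k W f m" and agree: "agreeing ?D f m" for m
  proof -
    have "scheduled ?D ?k W ((!) (map f [0..<m])) m \<and> agreeing ?D ((!) (map f [0..<m])) m"
      using path[of m] unfolding nodes_def by simp
    moreover have "scheduled ?D ?k W ((!) (map f [0..<m])) m = scheduled ?D ?k W f m"
      by (rule scheduled_cong) simp
    moreover have "agreeing ?D ((!) (map f [0..<m])) m = agreeing ?D f m"
      by (rule agreeing_cong) simp
    ultimately show "scheduled ?D ?k W f m" "agreeing ?D f m" by simp_all
  qed
  have xU: "?x j \<in> univ B" and yU: "?y j \<in> univ B" for j
    using sched[of "Suc j"] unfolding scheduled_def diagram_univ by blast+
  have "\<exists>h. iso_map L h B B \<and> (\<forall>j. h (?x j) = ?y j)"
  proof (rule iso_map_from_sequences[OF B])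
    show "range ?x = univ B"
    proof
      show "univ B \<subseteq> range ?x"
      proof
        fix i assume "i \<in> univ B"
        then have "?x (?k + Suc (i + i)) = i"
          using sched[of "Suc (?k + Suc (i + i))"] unfolding scheduled_def diagram_univ by auto
        then show "i \<in> range ?x" by (metis rangeI)
      qed
    qed (use xU in auto)
    show "range ?y = univ B"
    proof
      show "univ B \<subseteq> range ?y"
      proof
        fix i assume "i \<in> univ B"
        then have "?y (?k + (i + i)) = i"
          using sched[of "Suc (?k + (i + i))"] unfolding scheduled_def diagram_univ by auto
        then show "i \<in> range ?y" by (metis rangeI)
      qed
    qed (use yU in auto)
    show "?x i = ?x j \<longleftrightarrow> ?y i = ?y j" for i j
      using agree[of "Suc (max i j)"] unfolding agreeing_def by (auto simp: less_Suc_eq_le)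
    have codes: "list_encode (h # i # map ?x js) \<in> ?D \<longleftrightarrow> list_encode (h # i # map ?y js) \<in> ?D" for h i js
    proof -
      let ?u = "list_encode (h # i # map ?x js)" and ?v = "list_encode (h # i # map ?y js)"
      \<comment> \<open>A stage beyond both codes and all positions in \<open>js\<close>, so that
        \<open>agreeing\<close> compares the two codes.\<close>
      define m where "m = Suc (max (max ?u ?v) (Max (set (0 # js))))"
      have "?u < m" "?v < m" unfolding m_def by simp_all
      moreover have "j < m" if "j \<in> set js" for j
      proof -
        have "j \<le> Max (set (0 # js))" using that by (intro Max_ge) auto
        then show ?thesis unfolding m_def by simp
      qed
      then have "corresponding f m ?u ?v" by (rule corresponding_codes)
      ultimately show ?thesis using agree[of m] unfolding agreeing_def by blast
    qed
    have xs: "set (map ?x js) \<subseteq> univ B" and ys: "set (map ?y js) \<subseteq> univ B" for js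
      using xU yU by auto
    show "rel_interp B i (map ?y js) = rel_interp B i (map ?x js)" if "(i, length js) \<in> rels L" for i js
      using codes[of 1 i js] that xs[of js] ys[of js] unfolding diagram_rel by simp
    show "fun_interp B i (map ?y js) = ?y j"
      if "(i, length js) \<in> funs L" "fun_interp B i (map ?x js) = ?x j" for i js j
      using codes[of 2 i "j # js"] that xs[of js] ys[of js] unfolding list.map diagram_fun by simp
  qed
  then obtain h where h: "iso_map L h B B" "\<And>j. h (?x j) = ?y j" by blast
  have "map h as = bs"
  proof (rule nth_equalityI)
    fix j assume "j < length (map h as)"
    then have j: "j < ?k" by simp
    then have "f j = nth_code W j" using sched[of "Suc j"] unfolding scheduled_def by blast
    then have "f j = prod_encode (as ! j, bs ! j)" using j len unfolding W by (simp add: nth_code)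
    then show "map h as ! j = bs ! j" using h(2)[of j] j by simp
  qed (simp add: len)
  then show ?thesis using h(1) by blast
qed

section \<open>Formulas that separate the two sides of a node\<close>

lemma atom_separates:
  assumes "A \<in> atoms L n" "sat B x A \<noteq> sat B y A"
  shows "\<exists>P. pi_definable L c {..<n} P \<and> P B x \<and> \<not> P B y"
proof -
  have A: "qfree A" "fm_wf L A" "fv A \<subseteq> {..<n}" using atoms_props[OF assms(1)] by auto
  have "pi_definable L c {..<n} (\<lambda>M e. sat M e A)" by (rule qfree_definable(2)[OF A])
  moreover have "pi_definable L c {..<n} (\<lambda>M e. \<not> sat M e A)"
    using qfree_definable(2)[of "Neg A" L "{..<n}" c] A by simp
  ultimately show ?thesis using assms(2) by (cases "sat B x A") blast+
qed

definition side :: "bool \<Rightarrow> nat list \<Rightarrow> nat list" where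
  "side s zs = map (\<lambda>z. if s then fst (prod_decode z) else snd (prod_decode z)) zs"

lemma side_simps [simp]:
  "length (side s zs) = length zs"
  "side s (zs @ [z]) = side s zs @ [if s then fst (prod_decode z) else snd (prod_decode z)]"
  by (simp_all add: side_def)

lemma not_agreeing_separation:
  assumes B: "is_structure L B" and sched: "scheduled (diagram L B) k W ((!) zs) (length zs)"
    and na: "\<not> agreeing (diagram L B) ((!) zs) (length zs)"
  shows "\<exists>P. pi_definable L c {..<length zs} P \<and> P B ((!) (side s zs)) \<and> \<not> P B ((!) (side (\<not> s) zs))"
proof -
  have U: "fst (prod_decode (zs ! j)) \<in> univ B \<and> snd (prod_decode (zs ! j)) \<in> univ B"
    if "j < length zs" for j
    using sched that unfolding scheduled_def diagram_univ by blast
  obtain A where A: "A \<in> atoms L (length zs)"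
    "sat B (\<lambda>j. fst (prod_decode (zs ! j))) A \<noteq> sat B (\<lambda>j. snd (prod_decode (zs ! j))) A"
    using not_agreeing_atom[OF B U na] by blast
  have "fv A \<subseteq> {..<length zs}" using atoms_props[OF A(1)] by auto
  then have "sat B ((!) (side True zs)) A = sat B (\<lambda>j. fst (prod_decode (zs ! j))) A"
     "sat B ((!) (side False zs)) A = sat B (\<lambda>j. snd (prod_decode (zs ! j))) A"
    by (auto simp: side_def intro!: sat_cong)
  with A(2) have "sat B ((!) (side s zs)) A \<noteq> sat B ((!) (side (\<not> s) zs)) A" by (cases s) auto
  from atom_separates[OF A(1) this] show ?thesis .
qed

text \<open>Induction on the place of a node in the Kleene-Brouwer order. The next stage puts a
  fixed element d on one side, and each answer c on the other side gives a child. A formula P_c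
  separates the child, by induction or, off the tree, by an atom. That some element satisfies all
  P_c is true on the side of d and false on the other side; the negation of this separates the node.
  The side on which the formula holds alternates with the parity of the stage.\<close>

lemma automorphism_separation:
  assumes B: "is_structure L B" and D: "computes_set X (diagram L B)"
    and len: "length as = length bs" and U: "set as \<subseteq> univ B" "set bs \<subseteq> univ B"
    and noaut: "\<not> (\<exists>h. iso_map L h B B \<and> map h as = bs)"
  shows "\<exists>P. pi_definable L (omega1_rel X) {..<length as} P \<and> P B ((!) as) \<and> \<not> P B ((!) bs)"
proof -
  define k where "k = length as"
  define w where "w = map prod_encode (zip as bs)"
  define W where "W = list_encode w"
  define D where "D = diagram L B"
  define T where "T = nodes D k W"
  define r where "r = {(list_encode xs, list_encode ys) | xs ys. xs \<in> T \<and> ys \<in> T \<and> kb_le xs ys}"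
  have lw: "length w = k" by (simp add: w_def k_def len)
  have sw: "side True w = as" "side False w = bs"
    using len by (auto simp: side_def w_def intro!: nth_equalityI)
  have nopath: "\<not> (\<exists>f. \<forall>n. map f [0..<n] \<in> T)"
    using path_automorphism[OF B len, of W] noaut unfolding T_def D_def k_def W_def w_def by blast
  have pref: "xs \<in> T" if "xs @ [x] \<in> T" for xs x
    using that nodes_append unfolding T_def by blast
  have wo: "Well_order r" and Fr: "Field r = list_encode ` T"
    unfolding r_def by (rule kb_well_order[OF pref nopath], assumption)+
  have "computes_set X (prod_encode ` r)"
    unfolding r_def T_def by (rule computable_kb_order) (use \<open>computes_set X (diagram L B)\<close> in \<open>simp add: D_def\<close>)
  from computable_well_order_rank[OF wo this] obtain e0 where
    e0: "\<forall>c\<in>Field r. e0 c < omega1_rel X" "\<forall>c d. (c, d) \<in> r \<longrightarrow> c \<noteq> d \<longrightarrow> e0 c < e0 d" by (elim exE conjE)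
  define e where "e zs = e0 (list_encode zs)" for zs
  have e_less: "e xs < e ys" if "xs \<in> T" "ys \<in> T" "kb_le xs ys" "xs \<noteq> ys" for xs ys
  proof -
    have "(list_encode xs, list_encode ys) \<in> r" using that unfolding r_def by blast
    then show ?thesis using e0(2) that(4) unfolding e_def by (simp add: list_encode_eq)
  qed
  \<comment> \<open>A child lies strictly lower, so its formula is Pi of level at most
    \<open>osuc (e zs)\<close>. The countable conjunction stays there, the existential quantifier
    gives Sigma of the next level, and the negation turns this into Pi.\<close>
  have sep: "\<exists>P. pi_definable L (osuc (osuc (e zs))) {..<length zs} P \<and>
      P B ((!) (side (even (length zs - k)) zs)) \<and> \<not> P B ((!) (side (odd (length zs - k)) zs))"
    if "zs \<in> T" "k \<le> length zs" for zs
    using that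
  proof (induction "e zs" arbitrary: zs rule: less_induct)
    case less
    let ?n = "length zs"
    define s where "s = even (?n - k)"
    obtain u0 where u0: "u0 \<in> univ B" using B by (auto simp: is_structure_def)
    \<comment> \<open>The stages \<open>k + (i + i)\<close> and \<open>k + Suc (i + i)\<close> serve
      the number i. If i is not in the universe, the schedule prescribes no value, and any element
      will do.\<close>
    define d where "d = (if (?n - k) div 2 \<in> univ B then (?n - k) div 2 else u0)"
    have dU: "d \<in> univ B" using u0 by (simp add: d_def)
    define pr where "pr c = (if s then prod_encode (c, d) else prod_encode (d, c))" for c
    have sched: "scheduled D k W ((!) (zs @ [pr c])) (Suc ?n)" if c: "c \<in> univ B" for c
    proof -
      have old: "scheduled D k W ((!) zs) ?n" using less.prems(1) unfolding T_def nodes_def by blast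
      have "list_encode [0, fst (prod_decode ((zs @ [pr c]) ! j))] \<in> D \<and>
          list_encode [0, snd (prod_decode ((zs @ [pr c]) ! j))] \<in> D \<and>
          (j < k \<longrightarrow> (zs @ [pr c]) ! j = nth_code W j)" if "j < Suc ?n" for j
      proof (cases "j = ?n")
        case True
        then show ?thesis using c dU less.prems(2) by (simp add: D_def diagram_univ pr_def)
      next
        case False
        then have "j < ?n" using that by simp
        then show ?thesis using old unfolding scheduled_def by (simp add: nth_append)
      qed
      moreover have "snd (prod_decode ((zs @ [pr c]) ! (k + (i + i)))) = i"
        if i: "list_encode [0, i] \<in> D" "k + (i + i) < Suc ?n" for i
      proof (cases "k + (i + i) = ?n")
        case True
        then have "?n - k = i + i" by simp
        then have "s" "(?n - k) div 2 = i" by (simp_all add: s_def)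
        then show ?thesis using i(1) True by (simp add: pr_def d_def D_def diagram_univ)
      next
        case False
        then have "k + (i + i) < ?n" "i < ?n" using i(2) by simp_all
        then show ?thesis using old i(1) unfolding scheduled_def by (simp add: nth_append)
      qed
      moreover have "fst (prod_decode ((zs @ [pr c]) ! (k + Suc (i + i)))) = i"
        if i: "list_encode [0, i] \<in> D" "k + Suc (i + i) < Suc ?n" for i
      proof (cases "k + Suc (i + i) = ?n")
        case True
        then have n: "?n - k = Suc (i + i)" by simp
        then have "\<not> s" "(?n - k) div 2 = i" by (simp_all add: s_def)
        then show ?thesis using i(1) True by (simp add: pr_def d_def D_def diagram_univ)
      next
        case False
        then have "k + Suc (i + i) < ?n" "i < ?n" using i(2) by simp_all
        then show ?thesis using old i(1) unfolding scheduled_def by (simp add: nth_append)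
      qed
      ultimately show ?thesis unfolding scheduled_def by blast
    qed
    have child: "side (\<not> s) (zs @ [pr c]) = side (\<not> s) zs @ [d]" "side s (zs @ [pr c]) = side s zs @ [c]" for c
      by (simp_all add: pr_def)
    have "\<exists>P. pi_definable L (osuc (e zs)) {..<Suc ?n} P \<and>
        P B ((!) (side (\<not> s) zs @ [d])) \<and> \<not> P B ((!) (side s zs @ [c]))" if c: "c \<in> univ B" for c
    proof (cases "zs @ [pr c] \<in> T")
      case True
      have lt: "e (zs @ [pr c]) < e zs" using e_less[OF True less.prems(1) kb_le_append] by simp
      have par: "even (length (zs @ [pr c]) - k) = (\<not> s)" "odd (length (zs @ [pr c]) - k) = s"
        using less.prems(2) by (simp_all add: s_def Suc_diff_le)
      obtain P where P: "pi_definable L (osuc (osuc (e (zs @ [pr c])))) {..<Suc ?n} P"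
        "P B ((!) (side (\<not> s) (zs @ [pr c])))" "\<not> P B ((!) (side s (zs @ [pr c])))"
        using less.hyps[OF lt True] less.prems(2) unfolding par by auto
      have "osuc (osuc (e (zs @ [pr c]))) \<le> osuc (e zs)"
        using lt by (simp add: osuc_le_iff less_osuc_iff)
      from pi_definable_mono[OF P(1) this] P(2,3) show ?thesis unfolding child by blast
    next
      case False
      \<comment> \<open>Every answer respects the schedule, so a child can leave the tree only by a
        disagreement.\<close>
      then have "\<not> agreeing D ((!) (zs @ [pr c])) (Suc ?n)"
        using less.prems(1) sched[OF c] nodes_append unfolding T_def by blast
      then have "\<exists>P. pi_definable L (osuc (e zs)) {..<length (zs @ [pr c])} P \<and>
          P B ((!) (side (\<not> s) (zs @ [pr c]))) \<and> \<not> P B ((!) (side (\<not> (\<not> s)) (zs @ [pr c])))"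
        using sched[OF c] unfolding D_def by (intro not_agreeing_separation[OF B]) simp_all
      then show ?thesis unfolding not_not child by simp
    qed
    then have "\<forall>c\<in>univ B. \<exists>P. pi_definable L (osuc (e zs)) {..<Suc ?n} P \<and>
        P B ((!) (side (\<not> s) zs @ [d])) \<and> \<not> P B ((!) (side s zs @ [c]))" by blast
    from bchoice[OF this] obtain P where P: "\<forall>c\<in>univ B. pi_definable L (osuc (e zs)) {..<Suc ?n} (P c) \<and>
        P c B ((!) (side (\<not> s) zs @ [d])) \<and> \<not> P c B ((!) (side s zs @ [c]))" by (elim exE)
    let ?Q = "\<lambda>M e. \<forall>c\<in>univ B. P c M e"
    have "pi_definable L (osuc (e zs)) {..<Suc ?n} ?Q"
      by (intro pi_definable_Ball osuc_pos) (use P in auto)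
    then have "sigma_definable L (osuc (osuc (e zs))) {..<Suc ?n} ?Q"
      by (rule sigma_definable_if_pi[OF _ less_osuc])
    from sigma_definable_ex_tuple[OF osuc_pos this, of ?n]
    have "sigma_definable L (osuc (osuc (e zs))) {..<?n} (\<lambda>M e. \<exists>ws. length ws = Suc ?n - ?n \<and>
        set ws \<subseteq> univ M \<and> ?Q M ((!) (map e [0..<?n] @ ws)))" by simp
    then have "pi_definable L (osuc (osuc (e zs))) {..<?n} (\<lambda>M e. \<not> (\<exists>ws. length ws = Suc ?n - ?n \<and>
        set ws \<subseteq> univ M \<and> ?Q M ((!) (map e [0..<?n] @ ws))))" by (simp only: pi_definable_not_iff)
    moreover have mp: "map ((!) (side t zs)) [0..<?n] = side t zs" for t
      using map_nth[of "side t zs"] by simp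
    have "\<not> (\<exists>ws. length ws = Suc ?n - ?n \<and> set ws \<subseteq> univ B \<and>
        ?Q B ((!) (map ((!) (side s zs)) [0..<?n] @ ws)))"
      unfolding mp
    proof
      assume "\<exists>ws. length ws = Suc ?n - ?n \<and> set ws \<subseteq> univ B \<and> ?Q B ((!) (side s zs @ ws))"
      then obtain ws where ws: "length ws = Suc ?n - ?n" "set ws \<subseteq> univ B" "?Q B ((!) (side s zs @ ws))"
        by (elim exE conjE)
      then obtain v where v: "ws = [v]" by (auto simp: length_Suc_conv)
      then have vU: "v \<in> univ B" using ws(2) by simp
      with ws(3) have "P v B ((!) (side s zs @ [v]))" unfolding v by blast
      then show False using P vU by blast
    qed
    moreover have "\<exists>ws. length ws = Suc ?n - ?n \<and> set ws \<subseteq> univ B \<and>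
        ?Q B ((!) (map ((!) (side (\<not> s) zs)) [0..<?n] @ ws))"
      unfolding mp by (rule exI[of _ "[d]"]) (use P dU in auto)
    ultimately show ?case unfolding s_def by blast
  qed
  \<comment> \<open>The empty tuple is fixed by the identity. Hence \<open>w\<close>, if it is a
    node, lies strictly below the root, and the root lies below \<open>omega1_rel X\<close>: this
    pays for the two successors in \<open>sep\<close>.\<close>
  have "0 < k"
  proof (rule ccontr)
    assume "\<not> 0 < k"
    then have "as = []" "bs = []" using len by (auto simp: k_def)
    moreover have "iso_map L id B B" by (auto simp: iso_map_def)
    ultimately show False using noaut by auto
  qed
  have sched: "scheduled D k W ((!) w) m" if "m \<le> k" for m
  proof -
    have *: "list_encode [0, fst (prod_decode (w ! j))] \<in> D \<and> list_encode [0, snd (prod_decode (w ! j))] \<in> D \<and>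
        w ! j = nth_code W j" if "j < k" for j
      using that U len lw unfolding D_def diagram_univ W_def
      by (auto simp: nth_code) (auto simp: w_def k_def)
    have "j < k" if "j < m" for j using that \<open>m \<le> k\<close> by simp
    moreover have "\<not> k + i < m" for i using \<open>m \<le> k\<close> by simp
    ultimately show ?thesis unfolding scheduled_def using * by blast
  qed
  show ?thesis
  proof (cases "w \<in> T")
    case True
    have "[] \<in> T" unfolding T_def by (rule Nil_node)
    then have "e w < e []" using True \<open>0 < k\<close> lw by (intro e_less) auto
    moreover have "e [] < omega1_rel X"
      using e0(1) \<open>[] \<in> T\<close> unfolding Fr e_def by blast
    ultimately have "osuc (osuc (e w)) \<le> omega1_rel X"
      by (metis osuc_le_iff le_less_trans)
    moreover obtain P where P: "pi_definable L (osuc (osuc (e w))) {..<k} P" "P B ((!) as)" "\<not> P B ((!) bs)"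
      using sep[OF True] lw sw by auto
    ultimately show ?thesis using pi_definable_mono unfolding k_def by blast
  next
    case False
    \<comment> \<open>The pairs in \<open>w\<close> respect the schedule, so if \<open>w\<close> is
      not a node, some initial parts of the two tuples already differ by an atom.\<close>
    then obtain m where m: "m \<le> k" "\<not> agreeing D ((!) w) m"
      using sched lw unfolding T_def nodes_def by (auto simp: less_Suc_eq_le)
    have tk: "(take m w) ! j = w ! j" if "j < m" for j using that by simp
    have "scheduled D k W ((!) (take m w)) m = scheduled D k W ((!) w) m"
      "agreeing D ((!) (take m w)) m = agreeing D ((!) w) m"
      by (intro scheduled_cong agreeing_cong tk, assumption)+
    then have "\<exists>P. pi_definable L (omega1_rel X) {..<length (take m w)} P \<and>
        P B ((!) (side True (take m w))) \<and> \<not> P B ((!) (side (\<not> True) (take m w)))"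
      using m sched[OF m(1)] lw unfolding D_def by (intro not_agreeing_separation[OF B]) simp_all
    moreover have "length (take m w) = m" using m(1) lw by simp
    moreover have "side True (take m w) = take m as" "side (\<not> True) (take m w) = take m bs"
      using sw by (simp_all add: side_def flip: take_map)
    ultimately obtain P where P: "pi_definable L (omega1_rel X) {..<m} P"
        "P B ((!) (take m as))" "\<not> P B ((!) (take m bs))"
      by auto
    have "P B ((!) (take m as)) = P B ((!) as)" "P B ((!) (take m bs)) = P B ((!) bs)"
      by (intro pi_definable_cong[OF P(1)], simp)+
    moreover have "pi_definable L (omega1_rel X) {..<length as} P"
      using m(1) by (intro pi_definable_vars[OF P(1)]) (auto simp: k_def)
    ultimately show ?thesis using P(2,3) by blast
  qed
qed

text \<open>A countable conjunction of separating formulas defines the automorphism orbit of a tuple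
  by a Pi_k formula, where k is \<open>omega1_rel X\<close>. Such a formula is a support at level k
  + 1 with no witnesses, so the Scott sentence is Pi_(k+2).\<close>

theorem Scott_sentence_of_computes_copy:
  assumes comp: "computes_copy L X A"
  shows "\<exists>S. Scott_sentence L A S \<and> Pi_in (osuc (osuc (omega1_rel X))) S"
proof -
  obtain B where iso: "isomorphic L B A" and D: "computes_set X (diagram L B)"
    using comp unfolding computes_copy_def by blast
  have B: "is_structure L B" using isomorphic_structure[OF iso] by blast
  let ?k = "omega1_rel X"
  \<comment> \<open>Countable conjunctions need a positive level; the empty order is computable and
    has type 0.\<close>
  have k0: "0 < ?k"
  proof (rule ccontr)
    assume "\<not> 0 < ?k"
    then have k: "?k = 0" using zero_le_omega1[of ?k] by simp
    have "segment 0 = {}" using zero_le_omega1 by (auto simp: not_less)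
    moreover have "computes_set X (prod_encode ` {})"
      unfolding computes_set_def by (simp add: recursive_in.zero)
    moreover have "Well_order ({} :: nat rel)" by simp
    moreover have "({} :: nat rel) =o ({} :: omega1 rel)"
      unfolding ordIso_def iso_def embed_def by (simp add: bij_betw_def)
    ultimately show False
      using omega1_rel_not_computable[of X] unfolding k by (simp only:) blast
  qed
  have "atomic_model L (osuc ?k) {B} B"
    unfolding atomic_model_def
  proof (intro allI impI)
    fix as assume as: "set as \<subseteq> univ B"
    let ?bad = "{bs. length bs = length as \<and> set bs \<subseteq> univ B \<and> \<not> (\<exists>h. iso_map L h B B \<and> map h as = bs)}"
    have "\<forall>bs\<in>?bad. \<exists>P. pi_definable L ?k {..<length as} P \<and> P B ((!) as) \<and> \<not> P B ((!) bs)"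
    proof
      fix bs assume "bs \<in> ?bad"
      then show "\<exists>P. pi_definable L ?k {..<length as} P \<and> P B ((!) as) \<and> \<not> P B ((!) bs)"
        by (intro automorphism_separation[OF B D _ as]) simp_all
    qed
    from bchoice[OF this] obtain P where
      P: "\<forall>bs\<in>?bad. pi_definable L ?k {..<length as} (P bs) \<and> P bs B ((!) as) \<and> \<not> P bs B ((!) bs)"
      by (elim exE)
    let ?Q = "\<lambda>M e. \<forall>bs\<in>?bad. P bs M e"
    have "pi_definable L ?k {..<length as} ?Q"
      by (intro pi_definable_Ball k0) (use P in auto)
    moreover have "?Q B ((!) as)" using P by blast
    moreover have "Sigma_type L (osuc ?k) B cs \<subseteq> Sigma_type L (osuc ?k) B as"
      if cs: "length cs = length as" "set cs \<subseteq> univ B" "?Q B ((!) cs)" for cs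
    proof -
      have "cs \<notin> ?bad" using P cs(3) by blast
      then obtain h where "iso_map L h B B" "map h as = cs" using cs(1,2) by blast
      then show ?thesis using iso_map_Sigma_type[OF B _ as] by blast
    qed
    ultimately have "supports L (osuc ?k) {B} B as [] ?Q"
      unfolding supports_def using less_osuc[of ?k] by auto
    then show "\<exists>ws Q. supports L (osuc ?k) {B} B as ws Q" by blast
  qed
  from atomic_model_Scott_sentence[OF osuc_pos B this] obtain S where
    S: "Scott_sentence L B S" "Pi_in (osuc (osuc ?k)) S" by blast
  have "{N. isomorphic L N B} = {N. isomorphic L N A}"
    using iso isomorphic_sym isomorphic_trans by blast
  then have "Scott_sentence L A S" using S(1) unfolding Scott_sentence_def by simp
  then show ?thesis using S(2) by blast
qed

section \<open>Isomorphism invariance\<close>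

lemma isomorphic_class_eq: "isomorphic L M N \<Longrightarrow> {K. isomorphic L K M} = {K. isomorphic L K N}"
  using isomorphic_sym isomorphic_trans by blast

lemma cSR_isomorphic: "isomorphic L M N \<Longrightarrow> cSR L M = cSR L N"
  unfolding cSR_def Scott_sentence_def using isomorphic_class_eq[of L M N] by simp

lemma computes_copy_isomorphic: "isomorphic L M N \<Longrightarrow> computes_copy L X M \<longleftrightarrow> computes_copy L X N"
  unfolding computes_copy_def using isomorphic_sym isomorphic_trans by blast

lemma omega1_struct_isomorphic: "isomorphic L M N \<Longrightarrow> omega1_struct L M = omega1_struct L N"
  unfolding omega1_struct_def using computes_copy_isomorphic[of L M N] by simp

lemma omega1_struct_attained:
  assumes "is_structure L A"
  shows "\<exists>X. computes_copy L X A \<and> omega1_struct L A = omega1_rel X"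
proof -
  have "computes_copy L (diagram L A) A"
    unfolding computes_copy_def using isomorphic_refl[OF assms] computes_set_self by blast
  then have "\<exists>a. \<exists>X. computes_copy L X A \<and> a = omega1_rel X" by blast
  from LeastI_ex[OF this] show ?thesis unfolding omega1_struct_def .
qed

text \<open>That a Scott sentence of some level exists is taken from Nadel's bound, since some set
  computes a copy.\<close>

lemma cSR_attained:
  assumes "is_structure L A"
  shows "\<exists>S. Scott_sentence L A S \<and> Pi_in (osuc (cSR L A)) S"
proof -
  obtain X where "computes_copy L X A" using omega1_struct_attained[OF assms] by blast
  from Scott_sentence_of_computes_copy[OF this]
  have "\<exists>a. \<exists>S. Scott_sentence L A S \<and> Pi_in (osuc a) S" by blast
  from LeastI_ex[OF this] show ?thesis unfolding cSR_def .
qed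

lemma cSR_le: "Scott_sentence L A S \<Longrightarrow> Pi_in (osuc a) S \<Longrightarrow> cSR L A \<le> a"
  unfolding cSR_def by (intro Least_le) blast

theorem cSR_le_omega1_struct:
  assumes "is_structure L A"
  shows "cSR L A \<le> osuc (omega1_struct L A)"
proof -
  obtain X where X: "computes_copy L X A" "omega1_struct L A = omega1_rel X"
    using omega1_struct_attained[OF assms] by blast
  from Scott_sentence_of_computes_copy[OF X(1)] show ?thesis
    unfolding X(2) using cSR_le by blast
qed

lemma Scott_sentence_Mod: "Scott_sentence L M S \<Longrightarrow> is_structure L M \<Longrightarrow> M \<in> Mod L S"
  unfolding Scott_sentence_def using isomorphic_refl by blast

text \<open>A quantifier-free sentence is not literally of a positive level, so the passage to lower
  levels goes through an equivalent sentence.\<close>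

lemma equiv_upto_mono:
  assumes "equiv_upto L b M N" "sentence L S" "Pi_in a S" "a \<le> b"
  shows "models M S \<longleftrightarrow> models N S"
proof -
  have "pi_definable L b {} (\<lambda>M e. models M S)"
    by (rule pi_definable_mono[OF sentence_pi_definable[OF assms(2,3)] assms(4)])
  from pi_definable_sentence[OF this] obtain S' where
    "sentence L S'" "Pi_in b S'" "\<And>M (e :: nat \<Rightarrow> nat). models M S' \<longleftrightarrow> models M S" by metis
  then show ?thesis using assms(1) unfolding equiv_upto_def by metis
qed

lemma equiv_upto_sigma:
  assumes "equiv_upto L b M N" "sigma_definable L b {} Q"
  shows "Q M e \<longleftrightarrow> Q N e"
proof -
  have "pi_definable L b {} (\<lambda>M e. \<not> Q M e)" using assms(2) by (simp only: pi_definable_not_iff)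
  then obtain p where p: "Pi_in b p" "fm_wf L p" "fv p \<subseteq> {}" "\<forall>M e. sat M e p \<longleftrightarrow> \<not> Q M e"
    unfolding pi_definable_def by (elim exE conjE)
  then have s: "sentence L p" by (simp add: sentence_def)
  have "models M p \<longleftrightarrow> models N p" using assms(1) s p(1) unfolding equiv_upto_def by blast
  then show ?thesis using sentence_iff_models[OF s, of M e] sentence_iff_models[OF s, of N e] p(4) by blast
qed

section \<open>Counting isomorphism types\<close>

lemma countable_iso_types_subset:
  assumes "countable (iso_types L K)" "K' \<subseteq> K"
  shows "countable (iso_types L K')"
  using assms unfolding iso_types_def quotient_def by (elim countable_subset[rotated]) auto

lemma iso_types_Union: "iso_types L (\<Union>C) = (\<Union>K\<in>C. iso_types L K)"
  unfolding iso_types_def quotient_def by auto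

text \<open>An isomorphism type may contain structures outside \<open>K\<close>, but an invariant
  function takes the same value on all of them, so any representative will do.\<close>

lemma countable_iso_types_image:
  assumes "countable (iso_types L K)" "\<And>M. M \<in> K \<Longrightarrow> is_structure L M"
    and "\<And>M N. isomorphic L M N \<Longrightarrow> f M = f N"
  shows "countable (f ` K)"
proof -
  have "f ` K \<subseteq> (\<lambda>t. f (SOME N. N \<in> t)) ` iso_types L K"
  proof (rule image_subsetI)
    fix M assume M: "M \<in> K"
    let ?t = "{(M, N). isomorphic L M N} `` {M}"
    have "M \<in> ?t" using isomorphic_refl assms(2)[OF M] by blast
    then have "(SOME N. N \<in> ?t) \<in> ?t" by (rule someI)
    then have "f M = f (SOME N. N \<in> ?t)" using assms(3) by blast
    moreover have "?t \<in> iso_types L K" using M unfolding iso_types_def by (rule quotientI)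
    ultimately show "f M \<in> (\<lambda>t. f (SOME N. N \<in> t)) ` iso_types L K" by blast
  qed
  then show ?thesis by (rule countable_subset) (rule countable_image[OF assms(1)])
qed


section \<open>Labels\<close>

text \<open>Used at \<lambda> and at its successor. Positivity excludes the level that lacks
  countable disjunctions.\<close>

locale minimal_counterexample_at =
  fixes L :: vocab and \<phi> :: fm and b :: omega1
  assumes mc: "minimal_counterexample L \<phi>" and qr_le: "qr L \<phi> \<le> b" and b_pos: "0 < b"
begin

abbreviation "\<C> \<equiv> big_class L \<phi> b"

lemma sentence_phi: "sentence L \<phi>"
  using mc by (simp add: minimal_counterexample_def)

lemma countable_classes: "countable (equiv_classes L \<phi> b)"
  using mc by (simp add: minimal_counterexample_def)

lemma Mod_Union: "Mod L \<phi> = \<Union>(equiv_classes L \<phi> b)"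
  by (auto simp: equiv_classes_def equiv_upto_def)

lemma uncountable_iso_types: "uncountable (iso_types L (Mod L \<phi>))"
proof
  assume "countable (iso_types L (Mod L \<phi>))"
  then have "|iso_types L (Mod L \<phi>)| \<le>o natLeq" using countable_card_le_natLeq by blast
  moreover have "|iso_types L (Mod L \<phi>)| =o cardSuc natLeq"
    using mc by (simp add: minimal_counterexample_def)
  ultimately have "cardSuc natLeq \<le>o natLeq" using ordIso_symmetric ordIso_ordLeq_trans by blast
  moreover have "natLeq <o cardSuc natLeq" by (rule cardSuc_greater[OF natLeq_Card_order])
  ultimately show False using not_ordLess_ordLeq by blast
qed

text \<open>The truth value \<open>c\<close> keeps the sentence itself at Pi_b, whichever of the two
  classes satisfies it.\<close>

lemma classes_separated:
  assumes "K \<in> equiv_classes L \<phi> b" "K' \<in> equiv_classes L \<phi> b" "K \<noteq> K'"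
  shows "\<exists>S c. sentence L S \<and> Pi_in b S \<and> (\<forall>N\<in>K. models N S = c) \<and> (\<forall>N\<in>K'. models N S = (\<not> c))"
proof -
  obtain M M' where M: "K = {N \<in> Mod L \<phi>. equiv_upto L b M N}" "K' = {N \<in> Mod L \<phi>. equiv_upto L b M' N}"
    using assms(1,2) unfolding equiv_classes_def by blast
  have "\<not> equiv_upto L b M M'"
  proof
    assume "equiv_upto L b M M'"
    then have "equiv_upto L b M N = equiv_upto L b M' N" for N unfolding equiv_upto_def by blast
    then show False using M assms(3) by simp
  qed
  then obtain S where S: "sentence L S" "Pi_in b S" "models M S \<noteq> models M' S"
    unfolding equiv_upto_def by blast
  have "\<forall>N\<in>K. models N S = models M S" "\<forall>N\<in>K'. models N S = (\<not> models M S)"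
    using S unfolding M equiv_upto_def by blast+
  then show ?thesis using S(1,2) by blast
qed

lemma models_Neg: "sentence L S \<Longrightarrow> models N (Neg S) \<longleftrightarrow> \<not> models N S"
  using sentence_iff_models[of L S N undefined] sentence_iff_models[of L "Neg S" N undefined]
  by (simp add: sentence_def)

text \<open>Minimality is applied to a sentence that separates the two classes: one side of the
  split has only countably many models.\<close>

lemma countable_other_class:
  assumes "K \<in> equiv_classes L \<phi> b" "K' \<in> equiv_classes L \<phi> b" "K \<noteq> K'"
    and "uncountable (iso_types L K)"
  shows "countable (iso_types L K')"
proof -
  obtain S0 c where S0: "sentence L S0" "\<forall>N\<in>K. models N S0 = c" "\<forall>N\<in>K'. models N S0 = (\<not> c)"
    using classes_separated[OF assms(1-3)] by blast
  define S where "S = (if c then S0 else Neg S0)"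
  have S: "sentence L S" "\<forall>N\<in>K. models N S" "\<forall>N\<in>K'. \<not> models N S"
    using S0 models_Neg[OF S0(1)] by (auto simp: S_def sentence_def)
  have KM: "K \<subseteq> Mod L \<phi>" "K' \<subseteq> Mod L \<phi>" using assms(1,2) Mod_Union by blast+
  have models_And: "models N (And \<phi> R) \<longleftrightarrow> models N \<phi> \<and> models N R" for N R
    by (auto simp: models_def)
  have "K \<subseteq> Mod L (And \<phi> S)" "K' \<subseteq> Mod L (And \<phi> (Neg S))"
    using KM S(2,3) unfolding Mod_def models_And models_Neg[OF S(1)] by blast+
  moreover have "countable (iso_types L (Mod L (And \<phi> S))) \<or> countable (iso_types L (Mod L (And \<phi> (Neg S))))"
    using mc S(1) unfolding minimal_counterexample_def by blast
  ultimately show ?thesis using countable_iso_types_subset assms(4) by blast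
qed

lemma big_class: "\<C> \<in> equiv_classes L \<phi> b" "uncountable (iso_types L \<C>)"
proof -
  have "\<exists>K. K \<in> equiv_classes L \<phi> b \<and> uncountable (iso_types L K)"
  proof (rule ccontr)
    assume "\<not> ?thesis"
    then have "countable (\<Union>K\<in>equiv_classes L \<phi> b. iso_types L K)"
      using countable_classes by auto
    then show False using uncountable_iso_types unfolding Mod_Union iso_types_Union by blast
  qed
  then have "\<exists>!K. K \<in> equiv_classes L \<phi> b \<and> uncountable (iso_types L K)"
    using countable_other_class by blast
  from theI'[OF this] show "\<C> \<in> equiv_classes L \<phi> b" "uncountable (iso_types L \<C>)"
    unfolding big_class_def by blast+
qed

lemma big_class_subset: "\<C> \<subseteq> Mod L \<phi>"
  using big_class(1) Mod_Union by blast

lemma big_class_structure: "M \<in> \<C> \<Longrightarrow> is_structure L M"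
  using big_class_subset by (auto simp: Mod_def)

lemma big_class_equiv: "M \<in> \<C> \<Longrightarrow> N \<in> \<C> \<Longrightarrow> equiv_upto L b M N"
  using big_class(1) unfolding equiv_classes_def equiv_upto_def by blast

lemma qr_sentence:
  "\<exists>T. sentence L T \<and> Mod L T = Mod L \<phi> \<and> (Pi_in (qr L \<phi>) T \<or> Sigma_in (qr L \<phi>) T)"
  unfolding qr_def
proof (rule LeastI_ex)
  obtain a where a: "pi_definable L a (fv \<phi>) (\<lambda>M e. sat M e \<phi>)"
    using pi_definable_fm sentence_phi unfolding sentence_def by blast
  have "fv \<phi> = {}" using sentence_phi by (simp add: sentence_def)
  with a obtain p where p: "Pi_in a p" "fm_wf L p" "fv p \<subseteq> {}" "\<forall>M e. sat M e p \<longleftrightarrow> sat M e \<phi>"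
    unfolding pi_definable_def by (simp only:) (elim exE conjE)
  then have "sentence L p" "Mod L p = Mod L \<phi>" by (auto simp: sentence_def Mod_def models_def)
  then show "\<exists>a T. sentence L T \<and> Mod L T = Mod L \<phi> \<and> (Pi_in a T \<or> Sigma_in a T)"
    using p(1) by blast
qed

text \<open>One separating sentence, or its negation, for each of the countably many other classes,
  together with a sentence of level \<open>qr L \<phi>\<close> equivalent to \<open>\<phi>\<close>;
  each of these is Pi_(b+1) up to equivalence.\<close>

lemma big_class_axiomatized: "\<exists>T. sentence L T \<and> Pi_in (osuc b) T \<and> Mod L T = \<C>"
proof -
  obtain T0 where T0: "sentence L T0" "Mod L T0 = Mod L \<phi>" "Pi_in (qr L \<phi>) T0 \<or> Sigma_in (qr L \<phi>) T0"
    using qr_sentence by blast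
  have lt: "qr L \<phi> < osuc b" using qr_le by (simp add: less_osuc_iff)
  have sat_T0: "sat M e T0 \<longleftrightarrow> models M T0" for M e using sentence_iff_models[OF T0(1)] by blast
  have "pi_definable L (osuc b) {} (\<lambda>M e. models M T0)"
    using T0(3)
  proof
    assume "Pi_in (qr L \<phi>) T0"
    from pi_definable_mono[OF sentence_pi_definable[OF T0(1) this] less_imp_le[OF lt]] show ?thesis .
  next
    assume "Sigma_in (qr L \<phi>) T0"
    then have "sigma_definable L (qr L \<phi>) {} (\<lambda>M e. sat M e T0)"
      using T0(1) by (intro sigma_definableI) (auto simp: sentence_def)
    from pi_definable_if_sigma[OF this lt] show ?thesis unfolding sat_T0 .
  qed
  moreover define E where "E = equiv_classes L \<phi> b - {\<C>}"
  have "\<forall>K\<in>E. \<exists>Sc. sentence L (fst Sc) \<and> Pi_in b (fst Sc) \<and> (\<forall>N\<in>\<C>. models N (fst Sc) = snd Sc) \<and>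
      (\<forall>N\<in>K. models N (fst Sc) = (\<not> snd Sc))"
  proof
    fix K assume "K \<in> E"
    then have "K \<in> equiv_classes L \<phi> b" "\<C> \<noteq> K" unfolding E_def by blast+
    from classes_separated[OF big_class(1) this] obtain S c where
      "sentence L S \<and> Pi_in b S \<and> (\<forall>N\<in>\<C>. models N S = c) \<and> (\<forall>N\<in>K. models N S = (\<not> c))"
      by (elim exE)
    then show "\<exists>Sc. sentence L (fst Sc) \<and> Pi_in b (fst Sc) \<and> (\<forall>N\<in>\<C>. models N (fst Sc) = snd Sc) \<and>
        (\<forall>N\<in>K. models N (fst Sc) = (\<not> snd Sc))"
      by (intro exI[of _ "(S, c)"]) simp
  qed
  from bchoice[OF this] obtain f where f: "\<forall>K\<in>E. sentence L (fst (f K)) \<and> Pi_in b (fst (f K)) \<and>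
      (\<forall>N\<in>\<C>. models N (fst (f K)) = snd (f K)) \<and> (\<forall>N\<in>K. models N (fst (f K)) = (\<not> snd (f K)))"
    by (elim exE)
  have "pi_definable L (osuc b) {} (\<lambda>M e. \<forall>K\<in>E. models M (fst (f K)) = snd (f K))"
  proof (rule pi_definable_Ball[OF osuc_pos])
    show "countable E" using countable_classes by (simp add: E_def)
    fix K assume "K \<in> E"
    then have pd: "pi_definable L b {} (\<lambda>M e. models M (fst (f K)))"
      using f sentence_pi_definable by blast
    show "pi_definable L (osuc b) {} (\<lambda>M e. models M (fst (f K)) = snd (f K))"
    proof (cases "snd (f K)")
      case True
      then show ?thesis using pi_definable_mono[OF pd less_imp_le[OF less_osuc]] by simp
    next
      case False
      have "sigma_definable L b {} (\<lambda>M e. \<not> models M (fst (f K)))"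
        using pd by (simp only: sigma_definable_not_iff)
      from pi_definable_if_sigma[OF this less_osuc] False show ?thesis by simp
    qed
  qed
  ultimately have "pi_definable L (osuc b) {}
      (\<lambda>M e. models M T0 \<and> (\<forall>K\<in>E. models M (fst (f K)) = snd (f K)))"
    by (rule pi_definable_and)
  then obtain p where p: "Pi_in (osuc b) p" "fm_wf L p" "fv p \<subseteq> {}"
      "\<forall>M e. sat M e p \<longleftrightarrow> models M T0 \<and> (\<forall>K\<in>E. models M (fst (f K)) = snd (f K))"
    unfolding pi_definable_def by (elim exE conjE)
  have "N \<in> Mod L p \<longleftrightarrow> N \<in> Mod L T0 \<and> (\<forall>K\<in>E. models N (fst (f K)) = snd (f K))" for N
    using p(4) by (auto simp: Mod_def models_def[of _ p])
  moreover have "N \<in> \<C>" if "N \<in> Mod L \<phi>" "\<forall>K\<in>E. models N (fst (f K)) = snd (f K)" for N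
  proof -
    have "N \<in> \<Union>(equiv_classes L \<phi> b)" using that(1) unfolding Mod_Union .
    then obtain K where K: "K \<in> equiv_classes L \<phi> b" "N \<in> K" by (elim UnionE)
    have "K \<notin> E"
    proof
      assume "K \<in> E"
      from bspec[OF f this] have "\<forall>N\<in>K. models N (fst (f K)) = (\<not> snd (f K))" by (elim conjE)
      from bspec[OF this K(2)] bspec[OF that(2) \<open>K \<in> E\<close>] show False by simp
    qed
    then show ?thesis using K by (simp add: E_def)
  qed
  moreover have "models N (fst (f K)) = snd (f K)" if "N \<in> \<C>" "K \<in> E" for N K
    using f that by simp
  ultimately have "Mod L p = \<C>" using big_class_subset T0(2) by (intro set_eqI) (metis subsetD)
  moreover have "sentence L p" using p(2,3) by (simp add: sentence_def)
  ultimately show ?thesis using p(1) by blast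
qed

lemma big_class_isomorphic: "isomorphic L M N \<Longrightarrow> M \<in> \<C> \<longleftrightarrow> N \<in> \<C>"
  using big_class_axiomatized Mod_isomorphic by metis

text \<open>A smaller rank would give a Scott sentence of level at most b; the whole class would
  satisfy it and be one isomorphism type, although it has uncountably many.\<close>

lemma cSR_ge:
  assumes M: "M \<in> \<C>"
  shows "b \<le> cSR L M"
proof (rule ccontr)
  assume "\<not> b \<le> cSR L M"
  then have le: "osuc (cSR L M) \<le> b" by (simp add: osuc_le_iff)
  have str: "is_structure L M" by (rule big_class_structure[OF M])
  obtain S where S: "Scott_sentence L M S" "Pi_in (osuc (cSR L M)) S" using cSR_attained[OF str] by blast
  have "isomorphic L N M" if N: "N \<in> \<C>" for N
  proof -
    have "models M S" using Scott_sentence_Mod[OF S(1) str] by (simp add: Mod_def)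
    then have "models N S"
      using equiv_upto_mono[OF big_class_equiv[OF M N] _ S(2) le] S(1) by (simp add: Scott_sentence_def)
    then have "N \<in> Mod L S" using big_class_structure[OF N] by (simp add: Mod_def)
    then show ?thesis using S(1) by (simp add: Scott_sentence_def)
  qed
  then have "{(M, N). isomorphic L M N} `` {N} = {(M, N). isomorphic L M N} `` {M}" if "N \<in> \<C>" for N
    using that isomorphic_sym isomorphic_trans by blast
  then have "iso_types L \<C> \<subseteq> {{(M, N). isomorphic L M N} `` {M}}"
    unfolding iso_types_def quotient_def by blast
  then have "countable (iso_types L \<C>)" by (rule countable_subset) simp
  then show False using big_class(2) by blast
qed

lemma isomorphic_if_cSR_eq:
  assumes K: "K \<in> \<C>" "atomic_model L b \<C> K" and N: "N \<in> \<C>" "cSR L N = b"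
  shows "isomorphic L N K"
proof -
  have strN: "is_structure L N" and strK: "is_structure L K" using big_class_structure K(1) N(1) by blast+
  obtain S where S: "Scott_sentence L N S" "Pi_in (osuc b) S" using cSR_attained[OF strN] N(2) by auto
  have sS: "sentence L S" using S(1) by (simp add: Scott_sentence_def)
  have NS: "models N S" using Scott_sentence_Mod[OF S(1) strN] by (simp add: Mod_def)
  have "sigma_definable L (osuc b) {} (\<lambda>M e. \<not> models M S)"
    using sentence_pi_definable[OF sS S(2)] by (simp only: sigma_definable_not_iff)
  from this[unfolded sigma_definable_iff_blocks[OF osuc_pos]] obtain xs c R where
    cR: "\<forall>i::nat. c i < osuc b \<and> pi_definable L (c i) ({} \<union> set (xs i)) (R i)" and
    R_eq: "(\<lambda>M (e :: nat \<Rightarrow> nat). \<not> models M S) = (\<lambda>M e. \<exists>i e'. reassign M (xs i) e e' \<and> R i M e')"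
    by (elim exE conjE)
  have R: "\<forall>i. c i < osuc b" "\<forall>i. pi_definable L (c i) ({} \<union> set (xs i)) (R i)" using cR by simp_all
  have R_iff: "\<not> models M S \<longleftrightarrow> (\<exists>i e'. reassign M (xs i) e e' \<and> R i M e')" for M and e :: "nat \<Rightarrow> nat"
    using fun_cong[OF fun_cong[OF R_eq]] .
  have "models K S"
  proof (rule ccontr)
    assume "\<not> models K S"
    then obtain i e' where e': "reassign K (xs i) undefined e'" "R i K e'" using R_iff[of K undefined] by blast
    obtain n where n: "\<forall>x\<in>set (xs i). x < n" using finite_nat_set_iff_bounded[of "set (xs i)"] by auto
    obtain u where u: "u \<in> univ K" using strK by (auto simp: is_structure_def)
    \<comment> \<open>The values of the block variables stand at their own positions;
      \<open>u\<close> fills the gaps.\<close>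
    define as where "as = map (\<lambda>j. if j \<in> set (xs i) then e' j else u) [0..<n]"
    have las: "length as = n" by (simp add: as_def)
    have as: "set as \<subseteq> univ K" using e'(1) u by (auto simp: as_def reassign_def)
    have pd: "pi_definable L b {..<n} (R i)"
    proof (rule pi_definable_vars[OF pi_definable_mono])
      show "pi_definable L (c i) ({} \<union> set (xs i)) (R i)" "c i \<le> b" using R(1,2) by (auto simp: less_osuc_iff)
    qed (use n in auto)
    have "R i K ((!) as) = R i K e'"
      by (rule pi_definable_cong[OF R(2)[rule_format, of i]]) (use n in \<open>auto simp: as_def\<close>)
    then have RK: "R i K ((!) as)" using e'(2) by simp
    obtain ws Q where Q: "supports L b \<C> K as ws Q" using K(2) as unfolding atomic_model_def by blast
    then obtain d where d: "d < b" "pi_definable L d {..<length (as @ ws)} Q" unfolding supports_def by blast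
    \<comment> \<open>The existence of a tuple with witnesses for \<open>Q\<close> is a Sigma_b
      sentence, so it carries over from \<open>K\<close> to \<open>N\<close>.\<close>
    have "sigma_definable L b {} (\<lambda>M e. \<exists>vs. length vs = length (as @ ws) - 0 \<and> set vs \<subseteq> univ M \<and>
        Q M ((!) (map e [0..<0] @ vs)))"
      using sigma_definable_ex_tuple[OF b_pos sigma_definable_if_pi[OF d(2,1)] le0] by simp
    from equiv_upto_sigma[OF big_class_equiv[OF K(1) N(1)] this, of undefined]
    have "\<exists>vs. length vs = length (as @ ws) \<and> set vs \<subseteq> univ N \<and> Q N ((!) vs)"
      using Q as unfolding supports_def by auto
    then obtain vs where vs: "length vs = length (as @ ws)" "set vs \<subseteq> univ N" "Q N ((!) vs)"
      by (elim exE conjE)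
    define cs where "cs = take n vs"
    have lcs: "length cs = length as" using vs(1) by (simp add: cs_def las)
    have "Q N ((!) (cs @ drop n vs))" "length (drop n vs) = length ws" "set (cs @ drop n vs) \<subseteq> univ N"
      using vs las by (simp_all add: cs_def)
    then have "Sigma_type L b N cs \<subseteq> Sigma_type L b K as"
      using Q N(1) lcs unfolding supports_def by blast
    \<comment> \<open>The inclusion of Sigma_b types is used contrapositively: if \<open>cs\<close>
      satisfied the negation of \<open>R i\<close>, which is Sigma_b, so would
      \<open>as\<close>.\<close>
    moreover have "sigma_definable L b {..<length as} (\<lambda>M e. \<not> R i M e)"
      using pd unfolding las by (simp only: sigma_definable_not_iff)
    ultimately have RN: "R i N ((!) cs)"
      using Sigma_type_transfer[OF _ lcs, of L b N K "\<lambda>M e. \<not> R i M e"] RK by blast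
    have "reassign N (xs i) ((!) cs) ((!) cs)"
      using n vs(2) lcs las unfolding reassign_def cs_def
      by (metis in_set_takeD nth_mem subsetD)
    then show False using RN R_iff[of N "(!) cs"] NS by blast
  qed
  then have "K \<in> Mod L S" using strK by (simp add: Mod_def)
  then have "isomorphic L K N" using S(1) by (simp add: Scott_sentence_def)
  then show ?thesis by (rule isomorphic_sym)
qed

text \<open>The atomic model meets the description in \<open>label\<close>, so the chosen structure
  meets it too; comparing the two ranks gives b.\<close>

lemma label_props:
  "label L \<phi> b \<in> \<C>" "cSR L (label L \<phi> b) = b"
  "\<And>N. N \<in> \<C> \<Longrightarrow> cSR L N = b \<Longrightarrow> isomorphic L N (label L \<phi> b)"
proof -
  obtain T where T: "sentence L T" "Pi_in (osuc b) T" "Mod L T = \<C>" using big_class_axiomatized by blast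
  have "\<C> \<noteq> {}" using big_class(2) by (auto simp: iso_types_def)
  moreover have "countable {Sigma_type L b M as | M as. M \<in> \<C> \<and> set as \<subseteq> univ M}"
  proof (rule countable_subset)
    show "{Sigma_type L b M as | M as. M \<in> \<C> \<and> set as \<subseteq> univ M} \<subseteq>
        {Sigma_type L b M as | M as. M \<in> Mod L \<phi> \<and> set as \<subseteq> univ M}" using big_class_subset by blast
    show "countable {Sigma_type L b M as | M as. M \<in> Mod L \<phi> \<and> set as \<subseteq> univ M}"
      using mc by (simp add: minimal_counterexample_def)
  qed
  ultimately obtain K where K: "K \<in> \<C>" "atomic_model L b \<C> K"
    using atomic_model_exists[OF b_pos T(1,2)] unfolding T(3) by blast
  have "atomic_model L b {K} K" using atomic_model_subset[OF K(2)] K(1) by blast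
  from atomic_model_Scott_sentence[OF b_pos big_class_structure[OF K(1)] this]
  have "cSR L K \<le> b" using cSR_le by blast
  then have cK: "cSR L K = b" using cSR_ge[OF K(1)] by simp
  define good where "good K \<longleftrightarrow> K \<in> \<C> \<and>
     (\<forall>N \<in> \<C>. cSR L K \<le> cSR L N \<and> (cSR L N = cSR L K \<longrightarrow> isomorphic L N K))" for K
  have "good K" unfolding good_def using K cK cSR_ge isomorphic_if_cSR_eq[OF K] by simp
  then have good: "good (label L \<phi> b)" unfolding label_def good_def[symmetric] by (rule someI)
  show mem: "label L \<phi> b \<in> \<C>" using good by (simp add: good_def)
  show cl: "cSR L (label L \<phi> b) = b"
    using good K(1) cK cSR_ge[OF mem] unfolding good_def by (metis order_antisym)
  show "\<And>N. N \<in> \<C> \<Longrightarrow> cSR L N = b \<Longrightarrow> isomorphic L N (label L \<phi> b)"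
    using good cl unfolding good_def by simp
qed

text \<open>Outside the big class there are only countably many isomorphism types, so their ranks
  have a bound and the minimum in \<open>rank_bound\<close> is attained.\<close>

lemma cSR_less_rank_bound:
  assumes "M \<in> Mod L \<phi>" "M \<notin> \<C>"
  shows "cSR L M < rank_bound L \<phi> b"
proof -
  have "countable (iso_types L (\<Union>(equiv_classes L \<phi> b - {\<C>})))"
    unfolding iso_types_Union using countable_classes countable_other_class[OF big_class(1) _ _ big_class(2)]
    by (intro countable_UN) auto
  moreover have "Mod L \<phi> - \<C> \<subseteq> \<Union>(equiv_classes L \<phi> b - {\<C>})" using Mod_Union by blast
  ultimately have "countable (iso_types L (Mod L \<phi> - \<C>))" by (rule countable_iso_types_subset)
  then have "countable (cSR L ` (Mod L \<phi> - \<C>))"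
    by (rule countable_iso_types_image) (auto simp: Mod_def intro: cSR_isomorphic)
  from countable_bounded_omega1[OF this]
  have "\<exists>a. \<forall>M\<in>Mod L \<phi>. M \<notin> \<C> \<longrightarrow> cSR L M < a" by auto
  from LeastI_ex[OF this] show ?thesis using assms unfolding rank_bound_def by blast
qed

end

section \<open>The labels at \<lambda> and at its successor\<close>

theorem mainTheorem2:
  fixes L :: vocab and \<phi> :: fm and l :: omega1
  assumes "minimal_counterexample L \<phi>"
    and "limit_ord l"
    and "l \<in> closure_points L \<phi>"
    and "qr L \<phi> < l"
  shows "(x_prop L \<phi> l \<longleftrightarrow> omega1_struct L (label L \<phi> l) = l) \<and>
    (y_g L \<phi> l \<longleftrightarrow> omega1_struct L (label L \<phi> (osuc l)) = l) \<and>
    omega1_struct L (label L \<phi> l) \<ge> l \<and>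
    omega1_struct L (label L \<phi> (osuc l)) \<ge> l \<and>
    (y_g L \<phi> l \<longrightarrow>
      {A \<in> W_high L \<phi> l. A \<in> big_class L \<phi> (osuc l)} =
      {A. isomorphic L A (label L \<phi> (osuc l))})"
proof -
  have "0 < l" using assms(2) zero_le_omega1[of l] by (auto simp: limit_ord_def order_le_less)
  then interpret at_l: minimal_counterexample_at L \<phi> l
    using assms(1,4) by unfold_locales auto
  interpret at_Suc: minimal_counterexample_at L \<phi> "osuc l"
    using assms(1,4) less_osuc[of l] osuc_pos by unfold_locales auto
  let ?K = "label L \<phi> l" and ?K' = "label L \<phi> (osuc l)"
  have K_Mod: "?K \<in> Mod L \<phi>" using at_l.label_props(1) at_l.big_class_subset by blast
  have K'_Mod: "?K' \<in> Mod L \<phi>" using at_Suc.label_props(1) at_Suc.big_class_subset by blast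
  have str: "is_structure L ?K" "is_structure L ?K'" using K_Mod K'_Mod by (simp_all add: Mod_def)
  \<comment> \<open>Here the limit enters: the bound alone says that \<lambda>, the rank of the
    label, is at most one more than its omega_1.\<close>
  have K_ge: "l \<le> omega1_struct L ?K"
  proof (rule ccontr)
    assume "\<not> l \<le> omega1_struct L ?K"
    then have "osuc (omega1_struct L ?K) < l" using assms(2) by (simp add: limit_ord_def)
    then show False using cSR_le_omega1_struct[OF str(1)] at_l.label_props(2) by simp
  qed
  \<comment> \<open>For rank \<lambda> + 1 the two successors cancel.\<close>
  have K'_ge: "l \<le> omega1_struct L ?K'"
    using cSR_le_omega1_struct[OF str(2)] at_Suc.label_props(2) by (simp add: osuc_le_iff less_osuc_iff)
  have x: "x_prop L \<phi> l \<longleftrightarrow> omega1_struct L ?K = l"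
  proof
    assume "x_prop L \<phi> l"
    then obtain A where A: "A \<in> Mod L \<phi>" "omega1_struct L A = l" "cSR L A = l"
      unfolding x_prop_def W_all_def by blast
    \<comment> \<open>At a closure point, rank \<lambda> is too large for a model outside the big
      class.\<close>
    have "rank_bound L \<phi> l \<le> l" using assms(3) by (simp add: closure_points_def)
    then have "A \<in> big_class L \<phi> l" using at_l.cSR_less_rank_bound[OF A(1)] A(3) by force
    from at_l.label_props(3)[OF this A(3)] show "omega1_struct L ?K = l"
      using omega1_struct_isomorphic A(2) by metis
  next
    assume "omega1_struct L ?K = l"
    then show "x_prop L \<phi> l"
      unfolding x_prop_def W_all_def using K_Mod at_l.label_props(2) by (intro bexI[of _ ?K]) auto
  qed
  \<comment> \<open>Membership in the big class at the successor is part of \<open>y_g\<close>, so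
    the uniqueness of the label applies at once.\<close>
  have high: "isomorphic L A ?K'" if "A \<in> W_high L \<phi> l" "A \<in> big_class L \<phi> (osuc l)" for A
    using at_Suc.label_props(3)[OF that(2)] that(1) by (simp add: W_high_def)
  have K'_high: "?K' \<in> W_high L \<phi> l" if "omega1_struct L ?K' = l"
    using that K'_Mod at_Suc.label_props(2) less_osuc[of l] by (auto simp: W_high_def W_all_def)
  have y: "y_g L \<phi> l \<longleftrightarrow> omega1_struct L ?K' = l"
  proof
    assume "y_g L \<phi> l"
    then obtain A where A: "A \<in> W_high L \<phi> l" "A \<in> big_class L \<phi> (osuc l)" unfolding y_g_def by blast
    then have "omega1_struct L A = l" by (simp add: W_high_def W_all_def)
    then show "omega1_struct L ?K' = l" using omega1_struct_isomorphic[OF high[OF A]] by simp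
  next
    assume "omega1_struct L ?K' = l"
    then show "y_g L \<phi> l" unfolding y_g_def using K'_high at_Suc.label_props(1) by blast
  qed
  have "A \<in> W_high L \<phi> l \<and> A \<in> big_class L \<phi> (osuc l)" if "y_g L \<phi> l" "isomorphic L A ?K'" for A
  proof -
    have "?K' \<in> W_high L \<phi> l" using K'_high y that(1) by blast
    moreover have "A \<in> Mod L \<phi> \<longleftrightarrow> ?K' \<in> Mod L \<phi>" by (rule Mod_isomorphic[OF that(2) at_l.sentence_phi])
    ultimately show ?thesis
      using omega1_struct_isomorphic[OF that(2)] cSR_isomorphic[OF that(2)]
        at_Suc.big_class_isomorphic[OF that(2)] at_Suc.label_props(1)
      by (auto simp: W_high_def W_all_def)
  qed
  then show ?thesis using x y K_ge K'_ge high by blast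
qed

end
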